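(* Let $H$ be a finite-dimensional pointed Hopf algebra over a field $\Bbbk$ and let $A$ be a finite-dimensional right $H$-simple left $H$-comodule algebra. Then $$\frac{\dim A}{\dim\mathrm{soc}(A)}\ \Big|\ \frac{\dim H}{\dim\mathrm{corad}(H)}.$$
   Context: Everything is over a field $\Bbbk$. A Hopf algebra is pointed if each of its simple subcoalgebras is one-dimensional. A left $H$-comodule algebra is an algebra $A$ that is a left $H$-comodule whose coaction is an algebra map. $A$ is right $H$-simple if $A\neq0$ and its only right ideals that are $H$-subcomodules are $0$ and $A$. $\mathrm{soc}(A)$ is the sum of all simple $H$-subcomodules of $A$; $\mathrm{corad}(H)$ is the sum of all simple subcoalgebras of $H$. In this situation $\dim\mathrm{soc}(A)$ divides $\dim A$ and $\dim\mathrm{corad}(H)$ divides $\dim H$, so both quotients are positive integers and the divisibility is one of integers. *)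

theory Defs
  imports "HOL.Vector_Spaces" "HOL-Library.Poly_Mapping"
begin

section \<open>Tensors as finite formal sums\<close>

text \<open>
  A list \<open>[(v\<^sub>1, w\<^sub>1), \<dots>, (v\<^sub>n, w\<^sub>n)]\<close> stands for the tensor
  \<open>v\<^sub>1 \<otimes> w\<^sub>1 + \<dots> + v\<^sub>n \<otimes> w\<^sub>n\<close> in \<open>V \<otimes> W\<close>; every tensor arises this way. Two lists denote the same
  tensor iff their difference, taken in the free vector space on \<open>V \<times> W\<close>, lies in the subspace
  spanned by the bilinearity relations. A linear map with values in \<open>V \<otimes> W\<close> is given below by a
  list-valued function that picks representatives; all its axioms, linearity included, are
  required up to this equality.
\<close>

definition free_scale :: "'k::field \<Rightarrow> ('x \<Rightarrow>\<^sub>0 'k) \<Rightarrow> ('x \<Rightarrow>\<^sub>0 'k)"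
  where "free_scale c p = Poly_Mapping.map ((*) c) p"

lemma lookup_free_scale [simp]:
  "Poly_Mapping.lookup (free_scale c p) x = c * Poly_Mapping.lookup p x"
  by (simp add: free_scale_def Poly_Mapping.map.rep_eq when_def)

lemma vector_space_free_scale: "vector_space free_scale"
  by (rule vector_space.intro) (auto intro!: poly_mapping_eqI simp: lookup_add algebra_simps)

definition formal_sum :: "'x list \<Rightarrow> ('x \<Rightarrow>\<^sub>0 'k::field)"
  where "formal_sum xs = (\<Sum>x\<leftarrow>xs. Poly_Mapping.single x 1)"

definition tensor_relations ::
    "('k::field \<Rightarrow> 'v::ab_group_add \<Rightarrow> 'v) \<Rightarrow> ('k \<Rightarrow> 'w::ab_group_add \<Rightarrow> 'w) \<Rightarrow> ('v \<times> 'w \<Rightarrow>\<^sub>0 'k) set"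
  where "tensor_relations sV sW =
    {Poly_Mapping.single (v + v', w) 1 - Poly_Mapping.single (v, w) 1
       - Poly_Mapping.single (v', w) 1 | v v' w. True} \<union>
    {Poly_Mapping.single (v, w + w') 1 - Poly_Mapping.single (v, w) 1
       - Poly_Mapping.single (v, w') 1 | v w w'. True} \<union>
    {Poly_Mapping.single (sV c v, w) 1 - Poly_Mapping.single (v, w) c | c v w. True} \<union>
    {Poly_Mapping.single (v, sW c w) 1 - Poly_Mapping.single (v, w) c | c v w. True}"

definition tensor_eq ::
    "('k::field \<Rightarrow> 'v::ab_group_add \<Rightarrow> 'v) \<Rightarrow> ('k \<Rightarrow> 'w::ab_group_add \<Rightarrow> 'w) \<Rightarrow>
     ('v \<times> 'w) list \<Rightarrow> ('v \<times> 'w) list \<Rightarrow> bool"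
  where "tensor_eq sV sW s t \<longleftrightarrow>
    formal_sum s - formal_sum t \<in> module.span free_scale (tensor_relations sV sW)"

text \<open>The threefold tensor product \<open>U \<otimes> V \<otimes> W\<close>, needed for coassociativity.\<close>

definition tensor3_relations ::
    "('k::field \<Rightarrow> 'u::ab_group_add \<Rightarrow> 'u) \<Rightarrow> ('k \<Rightarrow> 'v::ab_group_add \<Rightarrow> 'v) \<Rightarrow>
     ('k \<Rightarrow> 'w::ab_group_add \<Rightarrow> 'w) \<Rightarrow> ('u \<times> 'v \<times> 'w \<Rightarrow>\<^sub>0 'k) set"
  where "tensor3_relations sU sV sW =
    {Poly_Mapping.single (u + u', v, w) 1 - Poly_Mapping.single (u, v, w) 1
       - Poly_Mapping.single (u', v, w) 1 | u u' v w. True} \<union>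
    {Poly_Mapping.single (u, v + v', w) 1 - Poly_Mapping.single (u, v, w) 1
       - Poly_Mapping.single (u, v', w) 1 | u v v' w. True} \<union>
    {Poly_Mapping.single (u, v, w + w') 1 - Poly_Mapping.single (u, v, w) 1
       - Poly_Mapping.single (u, v, w') 1 | u v w w'. True} \<union>
    {Poly_Mapping.single (sU c u, v, w) 1 - Poly_Mapping.single (u, v, w) c | c u v w. True} \<union>
    {Poly_Mapping.single (u, sV c v, w) 1 - Poly_Mapping.single (u, v, w) c | c u v w. True} \<union>
    {Poly_Mapping.single (u, v, sW c w) 1 - Poly_Mapping.single (u, v, w) c | c u v w. True}"

definition tensor3_eq ::
    "('k::field \<Rightarrow> 'u::ab_group_add \<Rightarrow> 'u) \<Rightarrow> ('k \<Rightarrow> 'v::ab_group_add \<Rightarrow> 'v) \<Rightarrow>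
     ('k \<Rightarrow> 'w::ab_group_add \<Rightarrow> 'w) \<Rightarrow> ('u \<times> 'v \<times> 'w) list \<Rightarrow> ('u \<times> 'v \<times> 'w) list \<Rightarrow> bool"
  where "tensor3_eq sU sV sW s t \<longleftrightarrow>
    formal_sum s - formal_sum t \<in> module.span free_scale (tensor3_relations sU sV sW)"


section \<open>Algebras, coalgebras, Hopf algebras\<close>

definition (in vector_space) finite_dimensional :: bool
  where "finite_dimensional \<longleftrightarrow> (\<exists>B. finite B \<and> span B = UNIV)"

locale assoc_algebra = vector_space scale
  for scale :: "'k::field \<Rightarrow> 'a::ring_1 \<Rightarrow> 'a" +
  assumes mult_scale_left: "scale c x * y = scale c (x * y)"
    and mult_scale_right: "x * scale c y = scale c (x * y)"

locale coalgebra = vector_space scale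
  for scale :: "'k::field \<Rightarrow> 'h::ab_group_add \<Rightarrow> 'h" +
  fixes comult :: "'h \<Rightarrow> ('h \<times> 'h) list"
    and counit :: "'h \<Rightarrow> 'k"
  assumes comult_add: "tensor_eq scale scale (comult (x + y)) (comult x @ comult y)"
    and comult_scale:
      "tensor_eq scale scale (comult (scale c x)) [(scale c a, b). (a, b) \<leftarrow> comult x]"
    and linear_counit: "Vector_Spaces.linear scale (*) counit"
    and coassoc:
      "tensor3_eq scale scale scale
         [(a, b, c). (d, c) \<leftarrow> comult x, (a, b) \<leftarrow> comult d]
         [(a, b, c). (a, d) \<leftarrow> comult x, (b, c) \<leftarrow> comult d]"
    and counit_left: "(\<Sum>(a, b)\<leftarrow>comult x. scale (counit a) b) = x"
    and counit_right: "(\<Sum>(a, b)\<leftarrow>comult x. scale (counit b) a) = x"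
begin

definition subcoalgebra :: "'h set \<Rightarrow> bool"
  where "subcoalgebra C \<longleftrightarrow>
    subspace C \<and> (\<forall>x\<in>C. \<exists>t. set t \<subseteq> C \<times> C \<and> tensor_eq scale scale (comult x) t)"

definition simple_subcoalgebra :: "'h set \<Rightarrow> bool"
  where "simple_subcoalgebra C \<longleftrightarrow>
    subcoalgebra C \<and> C \<noteq> {0} \<and> (\<forall>D. subcoalgebra D \<and> D \<subseteq> C \<longrightarrow> D = {0} \<or> D = C)"

definition corad :: "'h set"
  where "corad = span (\<Union>{C. simple_subcoalgebra C})"

definition pointed :: bool
  where "pointed \<longleftrightarrow> (\<forall>C. simple_subcoalgebra C \<longrightarrow> dim C = 1)"

end

locale bialgebra = assoc_algebra scale + coalgebra scale comult counit
  for scale :: "'k::field \<Rightarrow> 'h::ring_1 \<Rightarrow> 'h"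
    and comult :: "'h \<Rightarrow> ('h \<times> 'h) list"
    and counit :: "'h \<Rightarrow> 'k" +
  assumes comult_mult:
      "tensor_eq scale scale (comult (x * y))
         [(a * c, b * d). (a, b) \<leftarrow> comult x, (c, d) \<leftarrow> comult y]"
    and comult_one: "tensor_eq scale scale (comult 1) [(1, 1)]"
    and counit_mult: "counit (x * y) = counit x * counit y"
    and counit_one: "counit 1 = 1"

locale hopf_algebra = bialgebra scale comult counit
  for scale :: "'k::field \<Rightarrow> 'h::ring_1 \<Rightarrow> 'h"
    and comult :: "'h \<Rightarrow> ('h \<times> 'h) list"
    and counit :: "'h \<Rightarrow> 'k" +
  fixes antipode :: "'h \<Rightarrow> 'h"
  assumes linear_antipode: "Vector_Spaces.linear scale scale antipode"
    and antipode_left: "(\<Sum>(a, b)\<leftarrow>comult x. antipode a * b) = scale (counit x) 1"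
    and antipode_right: "(\<Sum>(a, b)\<leftarrow>comult x. a * antipode b) = scale (counit x) 1"


section \<open>Comodules and comodule algebras\<close>

locale left_comodule = H: coalgebra sH comult counit + A: vector_space sA
  for sH :: "'k::field \<Rightarrow> 'h::ab_group_add \<Rightarrow> 'h"
    and comult :: "'h \<Rightarrow> ('h \<times> 'h) list"
    and counit :: "'h \<Rightarrow> 'k"
    and sA :: "'k \<Rightarrow> 'a::ab_group_add \<Rightarrow> 'a" +
  fixes coact :: "'a \<Rightarrow> ('h \<times> 'a) list"
  assumes coact_add: "tensor_eq sH sA (coact (x + y)) (coact x @ coact y)"
    and coact_scale: "tensor_eq sH sA (coact (sA c x)) [(sH c h, a). (h, a) \<leftarrow> coact x]"
    and coact_coassoc:
      "tensor3_eq sH sH sA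
         [(g, h, a). (d, a) \<leftarrow> coact x, (g, h) \<leftarrow> comult d]
         [(g, h, a). (g, y) \<leftarrow> coact x, (h, a) \<leftarrow> coact y]"
    and coact_counit: "(\<Sum>(h, a)\<leftarrow>coact x. sA (counit h) a) = x"
begin

definition subcomodule :: "'a set \<Rightarrow> bool"
  where "subcomodule V \<longleftrightarrow>
    A.subspace V \<and> (\<forall>x\<in>V. \<exists>t. set t \<subseteq> UNIV \<times> V \<and> tensor_eq sH sA (coact x) t)"

definition simple_subcomodule :: "'a set \<Rightarrow> bool"
  where "simple_subcomodule V \<longleftrightarrow>
    subcomodule V \<and> V \<noteq> {0} \<and> (\<forall>W. subcomodule W \<and> W \<subseteq> V \<longrightarrow> W = {0} \<or> W = V)"

definition soc :: "'a set"
  where "soc = A.span (\<Union>{V. simple_subcomodule V})"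

end

locale left_comodule_algebra =
  H: bialgebra sH comult counit + A: assoc_algebra sA + left_comodule sH comult counit sA coact
  for sH :: "'k::field \<Rightarrow> 'h::ring_1 \<Rightarrow> 'h"
    and comult :: "'h \<Rightarrow> ('h \<times> 'h) list"
    and counit :: "'h \<Rightarrow> 'k"
    and sA :: "'k \<Rightarrow> 'a::ring_1 \<Rightarrow> 'a"
    and coact :: "'a \<Rightarrow> ('h \<times> 'a) list" +
  assumes coact_mult:
      "tensor_eq sH sA (coact (x * y))
         [(g * h, a * b). (g, a) \<leftarrow> coact x, (h, b) \<leftarrow> coact y]"
    and coact_one: "tensor_eq sH sA (coact 1) [(1, 1)]"
begin

definition right_ideal :: "'a set \<Rightarrow> bool"
  where "right_ideal I \<longleftrightarrow> A.subspace I \<and> (\<forall>x\<in>I. \<forall>a. x * a \<in> I)"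

definition right_H_simple :: bool
  where "right_H_simple \<longleftrightarrow>
    (UNIV :: 'a set) \<noteq> {0} \<and> (\<forall>I. right_ideal I \<and> subcomodule I \<longrightarrow> I = {0} \<or> I = UNIV)"

end

end

(*
Let G be the set of grouplikes, so that corad H = kG, and filter H and A by their Loewy series H_n, A_n,
with H_0 = kG and A_0 = soc A, the sum of the isotypic parts A_g (g in G). Right H-simplicity makes every
nonzero element of A_g invertible. If M is a Hopf module and m in M spans a one-dimensional
subcomodule modulo a Hopf submodule N, then a |-> m a is injective modulo N: its kernel is a right ideal
and a subcomodule. As H is pointed such m exist whenever N is proper, so dim A divides dim M.
Applied to A as a Hopf module over A_0 this gives that dim soc A divides dim A. For the stronger divisibility
one needs a Hopf module over gr A of dimension (dim H / |G|) dim A_0, namely the cotensor product of gr H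
and A_0 over kG. No graded object has to be formed: its homogeneous components are quotients U_n / L_n
of subspaces of H (x) A on which the A_k act diagonally, and the dimension count works with subspaces
between L_n and U_n.
*)
theory Submission
  imports Defs "HOL-Library.Function_Algebras"
begin

section \<open>Linear algebra\<close>

text \<open>Grading is forced: \<open>A\<close> need not have an algebra projection onto
  \<open>A_0\<close>, but gr A has one, onto degree 0. After the coaction of gr A it yields an
  algebra map from gr A to gr H \<otimes> A_0. Through it gr A acts on gr H \<otimes> A_0, and the
  cotensor product over kG is a stable subspace. Its dimension is the sum of dim A_g over a
  homogeneous basis of gr H, where g is the right weight of the basis element. Right multiplication
  by G moves any weight to any other, so all weights occur equally often, dim H / |G| times each.
  This makes the dimension (dim H / |G|) dim A_0, and dim A_0 cancels because it divides dim A.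

  A coaction is a list fixed only up to equality of tensors. It is therefore replaced by the
  operators by which functionals on H act on the comodule; these determine it since H has a finite
  basis. The Loewy series is then cut out by the functionals that vanish on G: each of them lowers
  the degree by one, and the graded arguments use only this.\<close>

lemma vector_space_field: "vector_space ((*) :: 'k::field \<Rightarrow> 'k \<Rightarrow> 'k)"
  by (rule vector_space.intro) (auto simp: algebra_simps)

context vector_space
begin

abbreviation functional :: "('b \<Rightarrow> 'a) \<Rightarrow> bool"
  where "functional f \<equiv> Vector_Spaces.linear scale (*) f"

lemma functional_iff:
  "functional f \<longleftrightarrow> (\<forall>x y. f (x + y) = f x + f y) \<and> (\<forall>c x. f (scale c x) = c * f x)"
  using vector_space_axioms vector_space_field[where 'k = 'a] by (simp add: linear_iff)

lemma functionalI:
  "(\<And>x y. f (x + y) = f x + f y) \<Longrightarrow> (\<And>c x. f (scale c x) = c * f x) \<Longrightarrow> functional f"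
  by (simp add: functional_iff)

lemma functional_add: "functional f \<Longrightarrow> f (x + y) = f x + f y"
  and functional_scale: "functional f \<Longrightarrow> f (scale c x) = c * f x"
  by (simp_all add: functional_iff)

lemma functional_0: "functional f \<Longrightarrow> f 0 = 0"
  using functional_scale[of f 0 0] by simp

lemma functional_diff: "functional f \<Longrightarrow> f (x - y) = f x - f y"
  using functional_add[of f "x - y" y] by simp

lemma functional_sum: "functional f \<Longrightarrow> f (\<Sum>i\<in>I. g i) = (\<Sum>i\<in>I. f (g i))"
  by (induction I rule: infinite_finite_induct) (simp_all add: functional_0 functional_add)

lemma functional_sum_list: "functional f \<Longrightarrow> f (\<Sum>i\<leftarrow>xs. g i) = (\<Sum>i\<leftarrow>xs. f (g i))"
  by (induction xs) (simp_all add: functional_0 functional_add)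

lemma scale_sum_list: "scale c (\<Sum>i\<leftarrow>xs. g i) = (\<Sum>i\<leftarrow>xs. scale c (g i))"
  by (induction xs) (simp_all add: scale_right_distrib)

lemma subspace_sum_list: "subspace S \<Longrightarrow> (\<And>x. x \<in> set xs \<Longrightarrow> f x \<in> S) \<Longrightarrow> (\<Sum>x\<leftarrow>xs. f x) \<in> S"
  by (induction xs) (auto simp: subspace_0 subspace_add)

lemma functional_eq_0_on_span:
  assumes "functional f" "\<And>x. x \<in> S \<Longrightarrow> f x = 0" "x \<in> span S" shows "f x = 0"
  using assms(3)
  by (induction rule: span_induct_alt)
    (simp_all add: functional_0 functional_add functional_scale assms)

lemma separating_functional:
  assumes "subspace W" "v \<notin> W"
  obtains f where "functional f" "\<And>w. w \<in> W \<Longrightarrow> f w = 0" "f v = 1"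
proof -
  interpret p: vector_space_pair scale "(*) :: 'a \<Rightarrow> 'a \<Rightarrow> 'a"
    using vector_space_axioms vector_space_field by (simp add: vector_space_pair_def)
  obtain C where C: "C \<subseteq> W" "independent C" "W \<subseteq> span C"
    using maximal_independent_subset by blast
  have sC: "span C = W"
    using C assms(1) by (simp add: span_subspace)
  have "independent (insert v C)"
    using C(2) assms(2) sC by (simp add: independent_insertI)
  then obtain f where f: "functional f" "\<And>x. x \<in> insert v C \<Longrightarrow> f x = (if x = v then 1 else 0)"
    using p.linear_independent_extend[of "insert v C" "\<lambda>x. if x = v then 1 else 0"] by metis
  show thesis
  proof
    show "functional f" "f v = 1" using f by auto
    show "f w = 0" if "w \<in> W" for w
      by (rule functional_eq_0_on_span[OF f(1), of C]) (use f(2) that sC C(1) assms(2) in auto)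
  qed
qed

lemma eq_0_if_functionals_vanish:
  assumes "\<And>f. functional f \<Longrightarrow> f x = 0" shows "x = 0"
  using separating_functional[of "{0}" x] assms by (metis singletonD subspace_single_0 zero_neq_one)

lemma functional_dual_basis:
  assumes "independent B" "b \<in> B"
  obtains f where "functional f" "f b = 1" "\<And>c. c \<in> B \<Longrightarrow> c \<noteq> b \<Longrightarrow> f c = 0"
proof -
  have "b \<notin> span (B - {b})" using assms dependent_def by blast
  from separating_functional[OF subspace_span this] show thesis
    using that by (metis Diff_iff singletonD span_base)
qed

lemma independent_Un:
  assumes "independent B" "independent C" "finite C" "span B \<inter> span C \<subseteq> {0}"
  shows "independent (B \<union> C)"
  using assms(3,2,4)
proof (induction C rule: finite_induct)
  case (insert c C)
  have C: "independent C" "c \<notin> span C"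
    using insert.prems(1) insert.hyps by (simp_all add: independent_insert)
  have "independent (B \<union> C)"
    using insert.IH[OF C(1)] insert.prems(2) span_mono[of C "insert c C"] by blast
  moreover have "c \<notin> span (B \<union> C)"
  proof
    assume "c \<in> span (B \<union> C)"
    then obtain x y where xy: "c = x + y" "x \<in> span B" "y \<in> span C"
      by (auto simp: span_Un)
    have "x = c - y" using xy by simp
    also have "\<dots> \<in> span (insert c C)"
      using xy(3) span_mono[of C "insert c C"] by (intro span_diff) (auto intro: span_base)
    finally have "x = 0" using xy insert.prems(2) by blast
    then show False using xy C by simp
  qed
  ultimately show ?case by (simp add: independent_insertI)
qed (use assms(1) in simp)

text \<open>A property of sets, since an ambient space may be infinite-dimensional: the Hopf module
  built from H and A lives in the space of all functions from the type of H to A.\<close>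

definition fin_span :: "'b set \<Rightarrow> bool"
  where "fin_span X \<longleftrightarrow> (\<exists>B. finite B \<and> X \<subseteq> span B)"

lemma fin_span_mono: "fin_span Y \<Longrightarrow> X \<subseteq> Y \<Longrightarrow> fin_span X"
  unfolding fin_span_def by blast

lemma fin_span_basis:
  assumes "fin_span X" "C \<subseteq> X" "independent C"
  obtains B where "C \<subseteq> B" "B \<subseteq> X" "independent B" "X \<subseteq> span B" "finite B" "card B = dim X"
proof -
  obtain B where B: "C \<subseteq> B" "B \<subseteq> X" "independent B" "X \<subseteq> span B"
    using maximal_independent_subset_extend[OF assms(2,3)] by blast
  obtain D where D: "finite D" "X \<subseteq> span D" using assms(1) unfolding fin_span_def by blast
  have "finite B" using independent_span_bound[OF D(1) B(3)] B(2) D(2) by blast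
  from that[OF B this basis_card_eq_dim[OF B(2,4,3)]] show thesis .
qed

lemma fin_span_basis':
  assumes "fin_span X"
  obtains B where "B \<subseteq> X" "independent B" "X \<subseteq> span B" "finite B" "card B = dim X"
  by (rule fin_span_basis[OF assms, of "{}"]) (use that independent_empty in auto)

lemma dim_insert_subspace:
  assumes "subspace X" "fin_span X" "v \<notin> X"
  shows "dim (span (insert v X)) = Suc (dim X)" "fin_span (span (insert v X))"
proof -
  obtain B where B: "B \<subseteq> X" "independent B" "X \<subseteq> span B" "finite B" "card B = dim X"
    using fin_span_basis'[OF assms(2)] .
  have sB: "span B = X" using B assms(1) by (simp add: span_subspace)
  have "span (insert v X) = span (insert v B)"
  proof (rule subset_antisym)
    show "span (insert v X) \<subseteq> span (insert v B)"
      using B(3) span_mono[of B "insert v B"]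
      by (intro span_minimal) (auto intro: span_base)
    show "span (insert v B) \<subseteq> span (insert v X)" using B(1) by (intro span_mono) blast
  qed
  moreover have "independent (insert v B)" using B sB assms(3) by (simp add: independent_insertI)
  moreover have "v \<notin> B" using B assms(3) by blast
  ultimately show "dim (span (insert v X)) = Suc (dim X)"
    using B by (simp add: dim_eq_card_independent)
  show "fin_span (span (insert v X))"
    unfolding fin_span_def using \<open>span (insert v X) = span (insert v B)\<close> B(4) by blast
qed

lemma dim_mono_fin_span:
  assumes "fin_span Y" "X \<subseteq> Y" shows "dim X \<le> dim Y"
proof -
  obtain C where C: "C \<subseteq> X" "independent C" "X \<subseteq> span C" "card C = dim X"
    using fin_span_basis'[OF fin_span_mono[OF assms]] by metis
  obtain B where B: "C \<subseteq> B" "finite B" "card B = dim Y"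
    using fin_span_basis[OF assms(1) _ C(2)] C(1) assms(2) by (metis subset_trans)
  then show ?thesis using C card_mono by metis
qed

lemma dim_strict_mono_fin_span:
  assumes "subspace X" "fin_span Y" "X \<subseteq> Y" "subspace Y" "X \<noteq> Y" shows "dim X < dim Y"
proof -
  obtain v where v: "v \<in> Y" "v \<notin> X" using assms by blast
  have "span (insert v X) \<subseteq> Y" using v assms by (intro span_minimal) auto
  from dim_mono_fin_span[OF assms(2) this] show ?thesis
    using dim_insert_subspace[OF assms(1) fin_span_mono[OF assms(2,3)] v(2)] by simp
qed

end

text \<open>Rank-nullity without quotient spaces: \<open>\<phi>\<close> induces an injection of
  \<open>S / S'\<close> into the quotient by \<open>X\<close>. It counts the dimension gained when a
  submodule \<open>X\<close> is enlarged by the multiples of one element.\<close>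

lemma (in vector_space_pair) dim_sum_image:
  assumes lin: "Vector_Spaces.linear s1 s2 \<phi>"
    and S: "vs1.subspace S" "vs1.fin_span S"
    and S': "vs1.subspace S'" "S' \<subseteq> S"
    and X: "vs2.subspace X" "vs2.fin_span X"
    and iff: "\<And>a. a \<in> S \<Longrightarrow> \<phi> a \<in> X \<longleftrightarrow> a \<in> S'"
  shows "vs2.dim {x + \<phi> a |x a. x \<in> X \<and> a \<in> S} + vs1.dim S' = vs2.dim X + vs1.dim S"
    and "vs2.fin_span {x + \<phi> a |x a. x \<in> X \<and> a \<in> S}"
proof -
  interpret l: Vector_Spaces.linear s1 s2 \<phi> by (fact lin)
  have "vs2.dim {x + \<phi> a |x a. x \<in> X \<and> a \<in> S} + vs1.dim S' = vs2.dim X + vs1.dim S \<and>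
      vs2.fin_span {x + \<phi> a |x a. x \<in> X \<and> a \<in> S}"
    using S' X iff
  proof (induction "vs1.dim S - vs1.dim S'" arbitrary: S' X rule: less_induct)
    case less
    show ?case
    proof (cases "S' = S")
      case True
      have "{x + \<phi> a |x a. x \<in> X \<and> a \<in> S} = X"
      proof (intro subset_antisym subsetI)
        fix y assume "y \<in> {x + \<phi> a |x a. x \<in> X \<and> a \<in> S}"
        then show "y \<in> X" using less.prems True by (auto intro!: vs2.subspace_add)
      next
        fix y assume "y \<in> X"
        then have "y = y + \<phi> 0 \<and> y \<in> X \<and> 0 \<in> S" using S by (simp add: vs1.subspace_0 l.zero)
        then show "y \<in> {x + \<phi> a |x a. x \<in> X \<and> a \<in> S}" by blast
      qed
      then show ?thesis using True less.prems by simp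
    next
      case False
      then obtain a where a: "a \<in> S" "a \<notin> S'" using less.prems by blast
      have fa: "\<phi> a \<notin> X" using a less.prems by blast
      \<comment> \<open>Adjoining \<open>a\<close> to \<open>S'\<close> and \<open>\<phi> a\<close>
        to \<open>X\<close> keeps the membership hypothesis and the sum set, while both dimensions
        grow by one.\<close>
      define S1 where "S1 = vs1.span (insert a S')"
      define X1 where "X1 = vs2.span (insert (\<phi> a) X)"
      have S1: "vs1.dim S1 = Suc (vs1.dim S')"
        unfolding S1_def using vs1.dim_insert_subspace(1)[OF less.prems(1) _ a(2)]
          vs1.fin_span_mono[OF S(2) less.prems(2)] by blast
      have X1: "vs2.dim X1 = Suc (vs2.dim X)" "vs2.fin_span X1"
        unfolding X1_def using vs2.dim_insert_subspace[OF less.prems(3,4) fa] by blast+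
      have S1S: "S1 \<subseteq> S" unfolding S1_def using a S less.prems by (intro vs1.span_minimal) auto
      have mem1: "b \<in> S1 \<longleftrightarrow> (\<exists>k. b - s1 k a \<in> S')" for b
        unfolding S1_def using less.prems(1) by (simp add: vs1.span_breakdown_eq vs1.span_eq_iff[THEN iffD2])
      have mem2: "y \<in> X1 \<longleftrightarrow> (\<exists>k. y - s2 k (\<phi> a) \<in> X)" for y
        unfolding X1_def using less.prems(3) by (simp add: vs2.span_breakdown_eq vs2.span_eq_iff[THEN iffD2])
      have iff1: "\<phi> b \<in> X1 \<longleftrightarrow> b \<in> S1" if "b \<in> S" for b
      proof -
        have "\<phi> b - s2 k (\<phi> a) \<in> X \<longleftrightarrow> b - s1 k a \<in> S'" for k
        proof -
          have "b - s1 k a \<in> S" using that a S by (simp add: vs1.subspace_diff vs1.subspace_scale)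
          from less.prems(5)[OF this] show ?thesis by (simp add: l.diff l.scale)
        qed
        then show ?thesis by (simp add: mem1 mem2)
      qed
      have eq: "{x + \<phi> a |x a. x \<in> X1 \<and> a \<in> S} = {x + \<phi> a |x a. x \<in> X \<and> a \<in> S}"
      proof (intro subset_antisym subsetI)
        fix y assume "y \<in> {x + \<phi> a |x a. x \<in> X1 \<and> a \<in> S}"
        then obtain x b where xb: "y = x + \<phi> b" "x \<in> X1" "b \<in> S" by blast
        then obtain k where k: "x - s2 k (\<phi> a) \<in> X" by (auto simp: mem2)
        have "y = (x - s2 k (\<phi> a)) + \<phi> (b + s1 k a)" by (simp add: xb l.add l.scale)
        moreover have "b + s1 k a \<in> S" using xb a S by (simp add: vs1.subspace_add vs1.subspace_scale)
        ultimately show "y \<in> {x + \<phi> a |x a. x \<in> X \<and> a \<in> S}" using k by blast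
      next
        fix y assume "y \<in> {x + \<phi> a |x a. x \<in> X \<and> a \<in> S}"
        moreover have "X \<subseteq> X1" unfolding X1_def by (auto intro: vs2.span_base)
        ultimately show "y \<in> {x + \<phi> a |x a. x \<in> X1 \<and> a \<in> S}" by blast
      qed
      have le: "vs1.dim S1 \<le> vs1.dim S" using vs1.dim_mono_fin_span[OF S(2) S1S] .
      have "vs2.dim {x + \<phi> a |x a. x \<in> X1 \<and> a \<in> S} + vs1.dim S1 = vs2.dim X1 + vs1.dim S \<and>
          vs2.fin_span {x + \<phi> a |x a. x \<in> X1 \<and> a \<in> S}"
      proof (rule less.hyps)
        show "vs1.dim S - vs1.dim S1 < vs1.dim S - vs1.dim S'" using S1 le by simp
        show "vs1.subspace S1" "vs2.subspace X1" by (simp_all add: S1_def X1_def)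
      qed (use S1S X1 iff1 in auto)
      then show ?thesis unfolding eq using S1 X1 by simp
    qed
  qed
  then show "vs2.dim {x + \<phi> a |x a. x \<in> X \<and> a \<in> S} + vs1.dim S' = vs2.dim X + vs1.dim S"
    and "vs2.fin_span {x + \<phi> a |x a. x \<in> X \<and> a \<in> S}" by blast+
qed

subsection \<open>Functions with values in prescribed subspaces\<close>

lemma (in vector_space) vector_space_fun: "vector_space (\<lambda>c (x :: 'i \<Rightarrow> 'b) i. scale c (x i))"
  by (rule vector_space.intro)
    (simp_all add: fun_eq_iff plus_fun_def scale_right_distrib scale_left_distrib)

text \<open>For a basis \<open>B\<close> of H this is a coordinate model of the sum of the b
  \<otimes> \<open>V b\<close>, so that no type of tensors is needed.\<close>

definition fun_box :: "'i set \<Rightarrow> ('i \<Rightarrow> 'b::zero set) \<Rightarrow> ('i \<Rightarrow> 'b) set"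
  where "fun_box B V = {x. \<forall>i. x i \<in> (if i \<in> B then V i else {0})}"

lemma fun_box_mem: "x \<in> fun_box B V \<longleftrightarrow> (\<forall>i\<in>B. x i \<in> V i) \<and> (\<forall>i. i \<notin> B \<longrightarrow> x i = 0)"
  unfolding fun_box_def by auto

lemma (in vector_space) fun_box:
  fixes B :: "'i set"
  assumes "finite B" "\<And>i. i \<in> B \<Longrightarrow> subspace (V i)" "\<And>i. i \<in> B \<Longrightarrow> fin_span (V i)"
  shows "module.subspace (\<lambda>c x i. scale c (x i)) (fun_box B V)"
    and "vector_space.fin_span (\<lambda>c x i. scale c (x i)) (fun_box B V)"
    and "vector_space.dim (\<lambda>c x i. scale c (x i)) (fun_box B V) = (\<Sum>i\<in>B. dim (V i))"
proof -
  interpret F: vector_space "\<lambda>c (x :: 'i \<Rightarrow> 'b) i. scale c (x i)" by (fact vector_space_fun)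
  interpret p: vector_space_pair scale "\<lambda>c (x :: 'i \<Rightarrow> 'b) i. scale c (x i)" ..
  have sub: "F.subspace (fun_box B V)" if "\<And>i. i \<in> B \<Longrightarrow> subspace (V i)" for B V
    using that by (auto simp: F.subspace_def fun_box_mem subspace_0 subspace_add subspace_scale)
  show "F.subspace (fun_box B V)" using sub assms by blast
  have "F.fin_span (fun_box B V) \<and> F.dim (fun_box B V) = (\<Sum>i\<in>B. dim (V i))"
    using assms
  proof (induction B rule: finite_induct)
    case empty
    have eq: "fun_box {} V = {0}" by (auto simp: fun_box_mem fun_eq_iff)
    have "F.dim {0::'i \<Rightarrow> 'b} = 0"
      using F.dim_unique[of "{}" "{0}" 0] F.independent_empty by simp
    then show ?case unfolding eq F.fin_span_def by (auto intro!: exI[of _ "{}"])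
  next
    case (insert b B)
    define \<phi> where "\<phi> a = (\<lambda>i. if i = b then a else 0)" for a :: 'b
    have lin: "Vector_Spaces.linear scale (\<lambda>c x i. scale c (x i)) \<phi>"
      using vector_space_axioms F.vector_space_axioms
      by (auto simp: linear_iff \<phi>_def fun_eq_iff)
    have eq: "{x + \<phi> a |x a. x \<in> fun_box B V \<and> a \<in> V b} = fun_box (insert b B) V"
    proof (intro subset_antisym subsetI)
      fix y assume "y \<in> {x + \<phi> a |x a. x \<in> fun_box B V \<and> a \<in> V b}"
      then show "y \<in> fun_box (insert b B) V"
        using insert.hyps by (auto simp: fun_box_mem \<phi>_def)
    next
      fix y assume y: "y \<in> fun_box (insert b B) V"
      have "y = y(b := 0) + \<phi> (y b)" by (auto simp: \<phi>_def fun_eq_iff)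
      moreover have "y(b := 0) \<in> fun_box B V" "y b \<in> V b"
        using y insert.hyps by (auto simp: fun_box_mem)
      ultimately show "y \<in> {x + \<phi> a |x a. x \<in> fun_box B V \<and> a \<in> V b}" by blast
    qed
    have IH: "F.fin_span (fun_box B V)" "F.dim (fun_box B V) = (\<Sum>i\<in>B. dim (V i))"
      using insert by auto
    have V: "subspace (V b)" "fin_span (V b)" "F.subspace (fun_box B V)"
      using insert.prems sub by auto
    have "\<phi> a \<in> fun_box B V \<longleftrightarrow> a \<in> {0}" if "a \<in> V b" for a
      using insert.hyps(2) insert.prems(1) by (auto simp: fun_box_mem \<phi>_def subspace_0)
    note p.dim_sum_image[OF lin V(1,2) subspace_single_0 _ V(3) IH(1) this]
    then have "F.dim {x + \<phi> a |x a. x \<in> fun_box B V \<and> a \<in> V b} + dim {0} = F.dim (fun_box B V) + dim (V b) \<and>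
        F.fin_span {x + \<phi> a |x a. x \<in> fun_box B V \<and> a \<in> V b}"
      using V(1) by (auto simp: subspace_0)
    moreover have "dim {0} = 0" using dim_unique[of "{}" "{0}" 0] independent_empty by simp
    ultimately show ?case unfolding eq using insert.hyps IH by simp
  qed
  then show "F.fin_span (fun_box B V)" "F.dim (fun_box B V) = (\<Sum>i\<in>B. dim (V i))" by blast+
qed

section \<open>Tensors and bilinear forms\<close>

lemma poly_mapping_extension:
  fixes \<beta> :: "'x \<Rightarrow> 'w::ab_group_add" and s :: "'k::field \<Rightarrow> 'w \<Rightarrow> 'w"
  assumes "vector_space s"
  obtains ev where "Vector_Spaces.linear free_scale s ev"
    "\<And>x c. ev (Poly_Mapping.single x c) = s c (\<beta> x)"
    "\<And>xs. ev (formal_sum xs) = (\<Sum>x\<leftarrow>xs. \<beta> x)"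
proof -
  interpret vector_space s by fact
  define ev where "ev p = (\<Sum>x\<in>Poly_Mapping.keys p. s (Poly_Mapping.lookup p x) (\<beta> x))" for p
  have ev: "ev p = (\<Sum>x\<in>K. s (Poly_Mapping.lookup p x) (\<beta> x))"
    if "finite K" "Poly_Mapping.keys p \<subseteq> K" for p K
    unfolding ev_def by (rule sum.mono_neutral_left) (use that in \<open>auto simp: in_keys_iff\<close>)
  have add: "ev (p + q) = ev p + ev q" for p q
  proof -
    let ?K = "Poly_Mapping.keys p \<union> Poly_Mapping.keys q"
    have "ev (p + q) = (\<Sum>x\<in>?K. s (Poly_Mapping.lookup (p + q) x) (\<beta> x))"
      by (rule ev) (use Poly_Mapping.keys_add[of p q] in auto)
    also have "\<dots> = (\<Sum>x\<in>?K. s (Poly_Mapping.lookup p x) (\<beta> x)) + (\<Sum>x\<in>?K. s (Poly_Mapping.lookup q x) (\<beta> x))"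
      by (simp add: lookup_add scale_left_distrib sum.distrib)
    also have "\<dots> = ev p + ev q" using ev[of ?K p] ev[of ?K q] by simp
    finally show ?thesis .
  qed
  have sc: "ev (free_scale c p) = s c (ev p)" for c p
  proof -
    have "ev (free_scale c p) = (\<Sum>x\<in>Poly_Mapping.keys p. s (Poly_Mapping.lookup (free_scale c p) x) (\<beta> x))"
      by (rule ev) (auto simp: in_keys_iff)
    then show ?thesis by (simp add: ev_def scale_sum_right)
  qed
  have single: "ev (Poly_Mapping.single x c) = s c (\<beta> x)" for x c
    unfolding ev_def by (cases "c = 0") auto
  have zero: "ev 0 = 0" by (simp add: ev_def)
  show thesis
  proof
    show "Vector_Spaces.linear free_scale s ev"
      using assms add sc vector_space_free_scale by (simp add: linear_iff)
    show "ev (formal_sum xs) = (\<Sum>x\<leftarrow>xs. \<beta> x)" for xs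
      by (induction xs) (simp_all add: formal_sum_def add single zero)
  qed (fact single)
qed

definition bilinear_map ::
    "('k::field \<Rightarrow> 'v::ab_group_add \<Rightarrow> 'v) \<Rightarrow> ('k \<Rightarrow> 'w::ab_group_add \<Rightarrow> 'w) \<Rightarrow>
     ('k \<Rightarrow> 'z::ab_group_add \<Rightarrow> 'z) \<Rightarrow> ('v \<Rightarrow> 'w \<Rightarrow> 'z) \<Rightarrow> bool"
  where "bilinear_map sV sW sZ \<beta> \<longleftrightarrow>
    (\<forall>v v' w. \<beta> (v + v') w = \<beta> v w + \<beta> v' w) \<and> (\<forall>v w w'. \<beta> v (w + w') = \<beta> v w + \<beta> v w') \<and>
    (\<forall>c v w. \<beta> (sV c v) w = sZ c (\<beta> v w)) \<and> (\<forall>c v w. \<beta> v (sW c w) = sZ c (\<beta> v w))"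

text \<open>The extension of \<beta> to the free vector space kills the bilinearity relations. All
  tensor axioms are used through this lemma and its threefold analogue.\<close>

lemma tensor_eq_sum_list:
  assumes "vector_space sZ" "bilinear_map sV sW sZ \<beta>" "tensor_eq sV sW s t"
  shows "(\<Sum>(v, w)\<leftarrow>s. \<beta> v w) = (\<Sum>(v, w)\<leftarrow>t. \<beta> v w)"
proof -
  interpret Z: vector_space sZ by fact
  obtain ev where ev: "Vector_Spaces.linear free_scale sZ ev"
    "\<And>x c. ev (Poly_Mapping.single x c) = sZ c (case x of (v, w) \<Rightarrow> \<beta> v w)"
    "\<And>xs. ev (formal_sum xs) = (\<Sum>(v, w)\<leftarrow>xs. \<beta> v w)"
    using poly_mapping_extension[OF assms(1), of "\<lambda>(v, w). \<beta> v w"] by metis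
  interpret l: Vector_Spaces.linear free_scale sZ ev by fact
  have "ev p = 0" if "p \<in> tensor_relations sV sW" for p
    using that assms(2) unfolding tensor_relations_def bilinear_map_def
    by (elim UnE) (auto simp: l.diff ev)
  then have "ev (formal_sum s - formal_sum t) = 0"
    using assms(3) l.eq_0_on_span unfolding tensor_eq_def by blast
  then show ?thesis by (simp add: l.diff ev(3))
qed

text \<open>Bilinear forms separate tensors: a functional on the free space that kills the relations
  but not the difference of the two sums is itself a bilinear form.\<close>

lemma tensor_eqI:
  fixes sV :: "'k::field \<Rightarrow> 'v::ab_group_add \<Rightarrow> 'v" and sW :: "'k \<Rightarrow> 'w::ab_group_add \<Rightarrow> 'w"
  assumes "\<And>\<beta>. bilinear_map sV sW (*) \<beta> \<Longrightarrow> (\<Sum>(v, w)\<leftarrow>s. \<beta> v w) = (\<Sum>(v, w)\<leftarrow>t. \<beta> v w)"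
  shows "tensor_eq sV sW s t"
proof (rule ccontr)
  interpret P: vector_space "free_scale :: 'k \<Rightarrow> ('v \<times> 'w \<Rightarrow>\<^sub>0 'k) \<Rightarrow> _" by (rule vector_space_free_scale)
  assume "\<not> tensor_eq sV sW s t"
  then have "formal_sum s - formal_sum t \<notin> P.span (tensor_relations sV sW)"
    by (simp add: tensor_eq_def)
  from P.separating_functional[OF P.subspace_span this] obtain ev
    where ev: "P.functional ev" "\<And>p. p \<in> P.span (tensor_relations sV sW) \<Longrightarrow> ev p = 0"
      and ne: "ev (formal_sum s - formal_sum t) = 1" by metis
  define \<beta> where "\<beta> v w = ev (Poly_Mapping.single (v, w) 1)" for v w
  have rel: "ev p = 0" if "p \<in> tensor_relations sV sW" for p
    using ev(2) that P.span_base by blast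
  have sc: "ev (Poly_Mapping.single (v, w) c) = c * \<beta> v w" for v w c
  proof -
    have "Poly_Mapping.single (v, w) c = free_scale c (Poly_Mapping.single (v, w) 1)"
      by (intro poly_mapping_eqI) (auto simp: lookup_single when_def)
    then show ?thesis by (simp add: P.functional_scale[OF ev(1)] \<beta>_def)
  qed
  have "bilinear_map sV sW (*) \<beta>"
    unfolding bilinear_map_def
  proof (intro conjI allI)
    fix v v' w w' c
    have "Poly_Mapping.single (v + v', w) 1 - Poly_Mapping.single (v, w) 1
       - Poly_Mapping.single (v', w) 1 \<in> tensor_relations sV sW"
      unfolding tensor_relations_def by blast
    from rel[OF this] show "\<beta> (v + v') w = \<beta> v w + \<beta> v' w"
      by (simp add: P.functional_diff[OF ev(1)] P.functional_add[OF ev(1)] sc algebra_simps)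
    have "Poly_Mapping.single (v, w + w') 1 - Poly_Mapping.single (v, w) 1
       - Poly_Mapping.single (v, w') 1 \<in> tensor_relations sV sW"
      unfolding tensor_relations_def by blast
    from rel[OF this] show "\<beta> v (w + w') = \<beta> v w + \<beta> v w'"
      by (simp add: P.functional_diff[OF ev(1)] P.functional_add[OF ev(1)] sc algebra_simps)
    have "Poly_Mapping.single (sV c v, w) 1 - Poly_Mapping.single (v, w) c \<in> tensor_relations sV sW"
      unfolding tensor_relations_def by blast
    from rel[OF this] show "\<beta> (sV c v) w = c * \<beta> v w"
      by (simp add: P.functional_diff[OF ev(1)] sc)
    have "Poly_Mapping.single (v, sW c w) 1 - Poly_Mapping.single (v, w) c \<in> tensor_relations sV sW"
      unfolding tensor_relations_def by blast
    from rel[OF this] show "\<beta> v (sW c w) = c * \<beta> v w"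
      by (simp add: P.functional_diff[OF ev(1)] sc)
  qed
  from assms[OF this] have "ev (formal_sum s) = ev (formal_sum t)"
  proof -
    have "ev (formal_sum xs) = (\<Sum>(v, w)\<leftarrow>xs. \<beta> v w)" for xs
      by (induction xs) (auto simp: formal_sum_def P.functional_0[OF ev(1)] P.functional_add[OF ev(1)] \<beta>_def)
    then show ?thesis using \<open>(\<Sum>(v, w)\<leftarrow>s. \<beta> v w) = (\<Sum>(v, w)\<leftarrow>t. \<beta> v w)\<close> by simp
  qed
  then show False using ne by (simp add: P.functional_diff[OF ev(1)])
qed

lemma tensor3_eq_sum_list:
  assumes "vector_space sZ"
    and lin: "\<And>u u' v w. \<beta> (u + u') v w = \<beta> u v w + \<beta> u' v w" "\<And>u v v' w. \<beta> u (v + v') w = \<beta> u v w + \<beta> u v' w"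
      "\<And>u v w w'. \<beta> u v (w + w') = \<beta> u v w + \<beta> u v w'" "\<And>c u v w. \<beta> (sU c u) v w = sZ c (\<beta> u v w)"
      "\<And>c u v w. \<beta> u (sV c v) w = sZ c (\<beta> u v w)" "\<And>c u v w. \<beta> u v (sW c w) = sZ c (\<beta> u v w)"
    and eq: "tensor3_eq sU sV sW s t"
  shows "(\<Sum>(u, v, w)\<leftarrow>s. \<beta> u v w) = (\<Sum>(u, v, w)\<leftarrow>t. \<beta> u v w)"
proof -
  interpret Z: vector_space sZ by fact
  obtain ev where ev: "Vector_Spaces.linear free_scale sZ ev"
    "\<And>x c. ev (Poly_Mapping.single x c) = sZ c (case x of (u, v, w) \<Rightarrow> \<beta> u v w)"
    "\<And>xs. ev (formal_sum xs) = (\<Sum>(u, v, w)\<leftarrow>xs. \<beta> u v w)"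
    using poly_mapping_extension[OF assms(1), of "\<lambda>(u, v, w). \<beta> u v w"] by metis
  interpret l: Vector_Spaces.linear free_scale sZ ev by fact
  have "ev p = 0" if "p \<in> tensor3_relations sU sV sW" for p
    using that unfolding tensor3_relations_def
    by (elim UnE) (auto simp: l.diff ev lin)
  then have "ev (formal_sum s - formal_sum t) = 0"
    using eq l.eq_0_on_span unfolding tensor3_eq_def by blast
  then show ?thesis by (simp add: l.diff ev(3))
qed

section \<open>The action of the dual of a coalgebra on a comodule\<close>

text \<open>The operator (f \<otimes> id) after the coaction. For linear f it depends only on the
  tensor that the list represents, so it is an honest linear map in x.\<close>

definition coact_op ::
    "('k::field \<Rightarrow> 'a::ab_group_add \<Rightarrow> 'a) \<Rightarrow> ('a \<Rightarrow> ('h \<times> 'a) list) \<Rightarrow> ('h \<Rightarrow> 'k) \<Rightarrow> 'a \<Rightarrow> 'a"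
  where "coact_op sA coact f x = (\<Sum>(h, a)\<leftarrow>coact x. sA (f h) a)"

lemma sum_list_concat_map: "sum_list (concat (map f xs)) = (\<Sum>x\<leftarrow>xs. sum_list (f x))"
  by (induction xs) auto

context coalgebra
begin

definition conv :: "('h \<Rightarrow> 'k) \<Rightarrow> ('h \<Rightarrow> 'k) \<Rightarrow> 'h \<Rightarrow> 'k"
  where "conv f g x = (\<Sum>(a, b)\<leftarrow>comult x. f a * g b)"

text \<open>The operator (id \<otimes> f) after the comultiplication, whereas
  \<open>coact_op scale comult f\<close> is (f \<otimes> id). By coassociativity the two kinds
  commute; the first carries right weights, the second the left comodule structure.\<close>

definition right_op :: "('h \<Rightarrow> 'k) \<Rightarrow> 'h \<Rightarrow> 'h"
  where "right_op f x = (\<Sum>(a, b)\<leftarrow>comult x. scale (f b) a)"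

lemma regular_comodule: "left_comodule scale comult counit scale comult"
  using coalgebra_axioms
  by (auto simp: left_comodule_def left_comodule_axioms_def coalgebra_def coalgebra_axioms_def)

end

context left_comodule
begin

abbreviation T :: "('h \<Rightarrow> 'k) \<Rightarrow> 'a \<Rightarrow> 'a"
  where "T \<equiv> coact_op sA coact"

lemma
  assumes "vector_space sZ" "bilinear_map sH sA sZ \<beta>"
  shows coact_sum_add: "(\<Sum>(h, a)\<leftarrow>coact (x + y). \<beta> h a) = (\<Sum>(h, a)\<leftarrow>coact x. \<beta> h a) + (\<Sum>(h, a)\<leftarrow>coact y. \<beta> h a)"
    and coact_sum_scale: "(\<Sum>(h, a)\<leftarrow>coact (sA c x). \<beta> h a) = sZ c (\<Sum>(h, a)\<leftarrow>coact x. \<beta> h a)"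
proof -
  interpret Z: vector_space sZ by fact
  show "(\<Sum>(h, a)\<leftarrow>coact (x + y). \<beta> h a) = (\<Sum>(h, a)\<leftarrow>coact x. \<beta> h a) + (\<Sum>(h, a)\<leftarrow>coact y. \<beta> h a)"
    using tensor_eq_sum_list[OF assms coact_add] by simp
  show "(\<Sum>(h, a)\<leftarrow>coact (sA c x). \<beta> h a) = sZ c (\<Sum>(h, a)\<leftarrow>coact x. \<beta> h a)"
    using tensor_eq_sum_list[OF assms coact_scale, of c x] assms(2)
    by (simp add: bilinear_map_def Z.scale_sum_list comp_def case_prod_unfold)
qed

lemma bilinear_T: "H.functional f \<Longrightarrow> bilinear_map sH sA sA (\<lambda>h a. sA (f h) a)"
  by (simp add: bilinear_map_def H.functional_add H.functional_scale
      A.scale_left_distrib A.scale_right_distrib mult.commute)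

lemma T_add: "H.functional f \<Longrightarrow> T f (x + y) = T f x + T f y"
  and T_scale: "H.functional f \<Longrightarrow> T f (sA c x) = sA c (T f x)"
  unfolding coact_op_def
  by (simp_all add: coact_sum_add[OF A.vector_space_axioms bilinear_T]
      coact_sum_scale[OF A.vector_space_axioms bilinear_T])

lemma T_linear: "H.functional f \<Longrightarrow> Vector_Spaces.linear sA sA (T f)"
  using A.vector_space_axioms by (simp add: linear_iff T_add T_scale)

lemma T_0: "H.functional f \<Longrightarrow> T f 0 = 0"
  using T_scale[of f 0 0] by simp

lemma T_diff: "H.functional f \<Longrightarrow> T f (x - y) = T f x - T f y"
  using T_add[of f "x - y" y] by simp

lemma T_sum: "H.functional f \<Longrightarrow> T f (\<Sum>i\<in>I. g i) = (\<Sum>i\<in>I. T f (g i))"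
  by (induction I rule: infinite_finite_induct) (simp_all add: T_0 T_add)

lemma T_sum_list: "H.functional f \<Longrightarrow> T f (\<Sum>i\<leftarrow>xs. g i) = (\<Sum>i\<leftarrow>xs. T f (g i))"
  by (induction xs) (simp_all add: T_0 T_add)

lemma T_fun_add: "T (\<lambda>h. f h + g h) x = T f x + T g x"
  by (simp add: coact_op_def A.scale_left_distrib sum_list_addf case_prod_unfold)

lemma T_fun_scale: "T (\<lambda>h. c * f h) x = sA c (T f x)"
  by (simp add: coact_op_def A.scale_sum_list case_prod_unfold)

lemma T_fun_diff: "T (\<lambda>h. f h - g h) x = T f x - T g x"
  using T_fun_add[of "\<lambda>h. f h - g h" g x] by simp

lemma T_fun_0: "T (\<lambda>h. 0) x = 0"
  using T_fun_scale[of 0 "\<lambda>_. 0" x] by simp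

lemma T_fun_sum: "T (\<lambda>h. \<Sum>i\<in>I. f i h) x = (\<Sum>i\<in>I. T (f i) x)"
  by (induction I rule: infinite_finite_induct) (simp_all add: T_fun_0 T_fun_add)

lemma T_counit: "T counit x = x"
  by (simp add: coact_op_def coact_counit)

text \<open>Coassociativity. The order is reversed in the convolution because the functional applied
  first takes the outermost tensor factor.\<close>

lemma T_T:
  assumes "H.functional f" "H.functional g"
  shows "T f (T g x) = T (H.conv g f) x"
proof -
  have "T f (T g x) = (\<Sum>(u, v, w)\<leftarrow>[(g, h, a). (g, y) \<leftarrow> coact x, (h, a) \<leftarrow> coact y]. sA (g u * f v) w)"
    using assms
    by (simp add: coact_op_def[of _ _ g] T_sum_list T_scale map_concat sum_list_concat_map comp_def case_prod_unfold)
      (simp add: coact_op_def A.scale_sum_list case_prod_unfold)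
  also have "\<dots> = (\<Sum>(u, v, w)\<leftarrow>[(g, h, a). (d, a) \<leftarrow> coact x, (g, h) \<leftarrow> comult d]. sA (g u * f v) w)"
    by (rule tensor3_eq_sum_list[OF A.vector_space_axioms _ _ _ _ _ _ coact_coassoc, symmetric])
      (use assms in \<open>simp_all add: H.functional_add H.functional_scale A.scale_left_distrib
        A.scale_right_distrib algebra_simps\<close>)
  also have "\<dots> = T (H.conv g f) x"
  proof -
    have *: "(\<Sum>(g', h)\<leftarrow>comult d. sA (g g' * f h) a) = sA (H.conv g f d) a" for d a
    proof -
      have "sA (\<Sum>p\<leftarrow>ps. g (fst p) * f (snd p)) a = (\<Sum>p\<leftarrow>ps. sA (g (fst p) * f (snd p)) a)" for ps
        by (induction ps) (simp_all add: A.scale_left_distrib)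
      then show ?thesis by (simp add: H.conv_def case_prod_unfold)
    qed
    show ?thesis
      unfolding coact_op_def *[symmetric]
      by (simp add: map_concat sum_list_concat_map comp_def case_prod_unfold)
  qed
  finally show ?thesis .
qed

text \<open>Expanding the H-factor in a basis shows that the coaction of x is the sum of the b
  \<otimes> \<open>T (coord b) x\<close>. Hence the operators \<open>T\<close> determine the
  coaction.\<close>

lemma coact_sum_basis:
  fixes sZ :: "'k \<Rightarrow> 'z::ab_group_add \<Rightarrow> 'z"
  assumes B: "finite B" "H.independent B" "H.span B = UNIV"
    and Z: "vector_space sZ" "bilinear_map sH sA sZ \<beta>"
  shows "(\<Sum>(h, a)\<leftarrow>coact x. \<beta> h a) = (\<Sum>b\<in>B. \<beta> b (T (\<lambda>h. H.representation B h b) x))"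
proof -
  interpret Z: vector_space sZ by fact
  have \<beta>0: "\<beta> 0 a = 0" "\<beta> h 0 = 0" for a h
    using Z(2) Z.scale_zero_left unfolding bilinear_map_def by (metis H.scale_zero_left A.scale_zero_left)+
  have \<beta>1: "\<beta> (\<Sum>i\<in>I. sH (c i) (e i)) a = (\<Sum>i\<in>I. \<beta> (e i) (sA (c i) a))" for I :: "'h set" and c e a
    using Z(2) by (induction I rule: infinite_finite_induct) (simp_all add: \<beta>0 bilinear_map_def)
  have \<beta>2: "\<beta> h (\<Sum>p\<leftarrow>ps. q p) = (\<Sum>p\<leftarrow>ps. \<beta> h (q p))" for h and ps :: "('h \<times> 'a) list" and q
    using Z(2) by (induction ps) (simp_all add: \<beta>0 bilinear_map_def)
  have "\<beta> h a = (\<Sum>b\<in>B. \<beta> b (sA (H.representation B h b) a))" for h a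
    using \<beta>1[of "\<lambda>b. H.representation B h b" "\<lambda>b. b" B a] H.sum_representation_eq[of B h B] B by simp
  then have "(\<Sum>(h, a)\<leftarrow>coact x. \<beta> h a) = (\<Sum>(h, a)\<leftarrow>coact x. \<Sum>b\<in>B. \<beta> b (sA (H.representation B h b) a))"
    by (metis (no_types, lifting))
  also have "\<dots> = (\<Sum>b\<in>B. \<Sum>(h, a)\<leftarrow>coact x. \<beta> b (sA (H.representation B h b) a))"
  proof -
    have "(\<Sum>p\<leftarrow>ps. \<Sum>b\<in>B. \<gamma> p b) = (\<Sum>b\<in>B. \<Sum>p\<leftarrow>ps. \<gamma> p b)" for ps :: "('h \<times> 'a) list" and \<gamma> :: "_ \<Rightarrow> _ \<Rightarrow> 'z"
      by (induction ps) (simp_all add: sum.distrib)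
    then show ?thesis by (simp add: case_prod_unfold)
  qed
  also have "\<dots> = (\<Sum>b\<in>B. \<beta> b (T (\<lambda>h. H.representation B h b) x))"
    by (simp add: coact_op_def \<beta>2 case_prod_unfold)
  finally show ?thesis .
qed

end

section \<open>The left and right operators of functionals on a coalgebra, and convolution\<close>

context coalgebra
begin

abbreviation left_op :: "('h \<Rightarrow> 'k) \<Rightarrow> 'h \<Rightarrow> 'h"
  where "left_op \<equiv> coact_op scale comult"

interpretation reg: left_comodule scale comult counit scale comult by (rule regular_comodule)

lemmas left_op_add = reg.T_add and left_op_scale = reg.T_scale and left_op_0 = reg.T_0
  and left_op_diff = reg.T_diff and left_op_sum = reg.T_sum
  and left_op_counit = reg.T_counit

lemma bilinear_mult: "functional f \<Longrightarrow> functional g \<Longrightarrow> bilinear_map scale scale (*) (\<lambda>a b. f a * g b)"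
  by (simp add: bilinear_map_def functional_add functional_scale algebra_simps)

lemma bilinear_right: "functional f \<Longrightarrow> bilinear_map scale scale scale (\<lambda>a b. scale (f b) a)"
  by (simp add: bilinear_map_def functional_add functional_scale
      scale_left_distrib scale_right_distrib mult.commute)

lemma functional_conv: "functional f \<Longrightarrow> functional g \<Longrightarrow> functional (conv f g)"
  by (intro functionalI)
    (simp_all add: conv_def reg.coact_sum_add[OF vector_space_field bilinear_mult]
      reg.coact_sum_scale[OF vector_space_field bilinear_mult])

lemma right_op_add: "functional f \<Longrightarrow> right_op f (x + y) = right_op f x + right_op f y"
  and right_op_scale: "functional f \<Longrightarrow> right_op f (scale c x) = scale c (right_op f x)"
  by (simp_all add: right_op_def reg.coact_sum_add[OF vector_space_axioms bilinear_right]
      reg.coact_sum_scale[OF vector_space_axioms bilinear_right])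

lemma right_op_linear: "functional f \<Longrightarrow> Vector_Spaces.linear scale scale (right_op f)"
  using vector_space_axioms by (simp add: linear_iff right_op_add right_op_scale)

lemma right_op_0: "functional f \<Longrightarrow> right_op f 0 = 0"
  using right_op_scale[of f 0 0] by simp

lemma right_op_fun_add: "right_op (\<lambda>h. f h + g h) x = right_op f x + right_op g x"
  by (simp add: right_op_def scale_left_distrib sum_list_addf case_prod_unfold)

lemma right_op_fun_scale: "right_op (\<lambda>h. c * f h) x = scale c (right_op f x)"
  by (simp add: right_op_def scale_sum_list case_prod_unfold)

lemma right_op_fun_diff: "right_op (\<lambda>h. f h - g h) x = right_op f x - right_op g x"
  using right_op_fun_add[of "\<lambda>h. f h - g h" g x] by simp

lemma right_op_fun_0: "right_op (\<lambda>h. 0) x = 0"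
  using right_op_fun_scale[of 0 "\<lambda>_. 0" x] by simp

lemma right_op_fun_sum: "right_op (\<lambda>h. \<Sum>i\<in>I. f i h) x = (\<Sum>i\<in>I. right_op (f i) x)"
  by (induction I rule: infinite_finite_induct) (simp_all add: right_op_fun_0 right_op_fun_add)

lemma right_op_counit: "right_op counit x = x"
  by (simp add: right_op_def counit_right)

text \<open>Together with the next lemma: the transposes of the left and right operators are the
  convolutions by f from either side. Identities between operators are checked by testing against
  all functionals.\<close>

lemma functional_left_op: "functional g \<Longrightarrow> g (left_op f x) = conv f g x"
  by (simp add: coact_op_def conv_def functional_sum_list functional_scale case_prod_unfold)

lemma functional_right_op: "functional g \<Longrightarrow> g (right_op f x) = conv g f x"
  by (simp add: right_op_def conv_def functional_sum_list functional_scale case_prod_unfold mult.commute)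

lemma eq_if_functionals_eq: "(\<And>f. functional f \<Longrightarrow> f x = f y) \<Longrightarrow> x = y"
  using eq_0_if_functionals_vanish[of "x - y"] by (simp add: functional_diff)

lemma left_left: "functional f \<Longrightarrow> functional g \<Longrightarrow> left_op f (left_op g x) = left_op (conv g f) x"
  by (rule reg.T_T)

lemma conv_assoc:
  assumes "functional f" "functional g" "functional h"
  shows "conv (conv f g) h = conv f (conv g h)"
proof
  fix x
  have "conv (conv f g) h x = h (left_op (conv f g) x)"
    by (simp add: functional_left_op assms)
  also have "\<dots> = conv f (conv g h) x"
    using assms by (simp add: left_left[symmetric] functional_left_op functional_conv)
  finally show "conv (conv f g) h x = conv f (conv g h) x" .
qed

lemma right_right:
  assumes "functional f" "functional g"
  shows "right_op f (right_op g x) = right_op (conv f g) x"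
  by (rule eq_if_functionals_eq) (simp add: functional_right_op functional_conv conv_assoc assms)

lemma left_right:
  assumes "functional f" "functional g"
  shows "left_op f (right_op g x) = right_op g (left_op f x)"
  by (rule eq_if_functionals_eq)
    (simp add: functional_right_op functional_left_op functional_conv conv_assoc assms)

lemma conv_counit: "functional f \<Longrightarrow> conv counit f = f" "functional f \<Longrightarrow> conv f counit = f"
  by (simp_all add: functional_left_op[symmetric] left_op_counit functional_right_op[symmetric]
      right_op_counit fun_eq_iff)

end

section \<open>Finite-dimensional pointed coalgebras\<close>

context vector_space
begin

lemma finite_dimensional_fin_span: "finite_dimensional \<Longrightarrow> fin_span X"
  unfolding finite_dimensional_def fin_span_def by blast

lemma finite_basis:
  assumes finite_dimensional
  obtains B where "finite B" "independent B" "span B = UNIV"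
proof (rule fin_span_basis'[OF finite_dimensional_fin_span[OF assms], of UNIV])
  fix B assume "finite B" "independent B" "UNIV \<subseteq> span B"
  then show thesis using that by blast
qed

abbreviation coord :: "'b set \<Rightarrow> 'b \<Rightarrow> 'b \<Rightarrow> 'a"
  where "coord B b \<equiv> (\<lambda>v. representation B v b)"

lemma functional_coord: "independent B \<Longrightarrow> span B = UNIV \<Longrightarrow> functional (coord B b)"
  by (rule functionalI) (simp_all add: representation_add representation_scale)

lemma coord_eq_0:
  assumes "independent B" "C \<subseteq> B" "x \<in> span C" "b \<notin> C" shows "coord B b x = 0"
  using representation_extend[OF assms(1,3,2)] representation_ne_zero[of C x b] assms(4) by auto

lemma functional_eq_sum_coord:
  assumes "finite B" "independent B" "span B = UNIV" "functional f"
  shows "f x = (\<Sum>b\<in>B. coord B b x * f b)"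
proof -
  have "f x = f (\<Sum>b\<in>B. scale (coord B b x) b)"
    using sum_representation_eq[of B x B] assms by simp
  then show ?thesis using assms(4) by (simp add: functional_sum functional_scale)
qed

end

lemma (in left_comodule) subcomodule_T:
  assumes "subcomodule V" "x \<in> V" "H.functional f" shows "T f x \<in> V"
proof -
  have V: "A.subspace V" using assms(1) by (simp add: subcomodule_def)
  obtain t where t: "set t \<subseteq> UNIV \<times> V" "tensor_eq sH sA (coact x) t"
    using assms(1,2) unfolding subcomodule_def by blast
  have "T f x = (\<Sum>(h, a)\<leftarrow>t. sA (f h) a)"
    unfolding coact_op_def
    by (rule tensor_eq_sum_list[OF A.vector_space_axioms bilinear_T[OF assms(3)] t(2)])
  also have "\<dots> \<in> V"
    using t(1) V by (intro A.subspace_sum_list) (auto simp: A.subspace_scale)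
  finally show ?thesis .
qed

text \<open>In the expansion of the coaction over a basis of H the second factors are
  \<open>T (coord b) x\<close>, which stability places in \<open>V\<close>.\<close>

lemma (in left_comodule) subcomoduleI:
  assumes "H.finite_dimensional" "A.subspace V" "\<And>x f. x \<in> V \<Longrightarrow> H.functional f \<Longrightarrow> T f x \<in> V"
  shows "subcomodule V"
  unfolding subcomodule_def
proof (intro conjI ballI assms(2))
  fix x assume x: "x \<in> V"
  obtain B where B: "finite B" "H.independent B" "H.span B = UNIV"
    using H.finite_basis[OF assms(1)] .
  obtain bs where bs: "set bs = B" "distinct bs" using finite_distinct_list[OF B(1)] by blast
  let ?t = "map (\<lambda>b. (b, T (H.coord B b) x)) bs"
  have "tensor_eq sH sA (coact x) ?t"
  proof (rule tensor_eqI)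
    fix \<beta> :: "'h \<Rightarrow> 'a \<Rightarrow> 'k" assume "bilinear_map sH sA (*) \<beta>"
    from coact_sum_basis[OF B vector_space_field this]
    show "(\<Sum>(v, w)\<leftarrow>coact x. \<beta> v w) = (\<Sum>(v, w)\<leftarrow>?t. \<beta> v w)"
      using bs by (simp add: sum_list_distinct_conv_sum_set comp_def)
  qed
  moreover have "set ?t \<subseteq> UNIV \<times> V"
    using assms(3)[OF x H.functional_coord[OF B(2,3)]] by auto
  ultimately show "\<exists>t. set t \<subseteq> UNIV \<times> V \<and> tensor_eq sH sA (coact x) t" by blast
qed

section \<open>Subcoalgebras, grouplike elements and the annihilator of their span\<close>

context coalgebra
begin

interpretation reg: left_comodule scale comult counit scale comult by (rule regular_comodule)

lemma subcoalgebra_left_op: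
  assumes "subcoalgebra C" "x \<in> C" "functional f"
  shows "left_op f x \<in> C"
proof -
  have C: "subspace C" using assms(1) by (simp add: subcoalgebra_def)
  obtain t where t: "set t \<subseteq> C \<times> C" "tensor_eq scale scale (comult x) t"
    using assms(1,2) unfolding subcoalgebra_def by blast
  have "left_op f x = (\<Sum>(a, b)\<leftarrow>t. scale (f a) b)"
    unfolding coact_op_def
    by (rule tensor_eq_sum_list[OF vector_space_axioms reg.bilinear_T[OF assms(3)] t(2)])
  also have "\<dots> \<in> C" using t(1) C by (intro subspace_sum_list) (auto simp: subspace_scale)
  finally show ?thesis .
qed

text \<open>Expand \<open>comult x\<close> over a basis of H that extends a basis of
  \<open>C\<close>. Left stability puts the second factors into \<open>C\<close>; right stability
  makes the terms with first factor outside \<open>C\<close> vanish.\<close>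

lemma subcoalgebraI:
  assumes "finite_dimensional" "subspace C"
    and left: "\<And>x f. x \<in> C \<Longrightarrow> functional f \<Longrightarrow> left_op f x \<in> C"
    and right: "\<And>x f. x \<in> C \<Longrightarrow> functional f \<Longrightarrow> right_op f x \<in> C"
  shows "subcoalgebra C"
  unfolding subcoalgebra_def
proof (intro conjI ballI assms(2))
  fix x assume x: "x \<in> C"
  obtain C0 where C0: "C0 \<subseteq> C" "independent C0" "C \<subseteq> span C0" "finite C0"
    using fin_span_basis'[OF finite_dimensional_fin_span[OF assms(1)], of C] by metis
  obtain B where B: "C0 \<subseteq> B" "finite B" "independent B" "span B = UNIV"
    using fin_span_basis[OF finite_dimensional_fin_span[OF assms(1)], of C0 UNIV] C0(2)
    by (metis subset_UNIV top.extremum_unique)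
  obtain bs where bs: "set bs = C0" "distinct bs" using finite_distinct_list[OF C0(4)] by blast
  let ?t = "map (\<lambda>b. (b, left_op (coord B b) x)) bs"
  have zero: "left_op (coord B b) x = 0" if "b \<notin> C0" for b
  proof (rule eq_0_if_functionals_vanish)
    fix f assume f: "functional f"
    have "f (left_op (coord B b) x) = coord B b (right_op f x)"
      using f by (simp add: functional_left_op functional_right_op[OF functional_coord[OF B(3,4)]])
    also have "\<dots> = 0" using right[OF x f] C0(3) that by (intro coord_eq_0[OF B(3,1)]) auto
    finally show "f (left_op (coord B b) x) = 0" .
  qed
  have "tensor_eq scale scale (comult x) ?t"
  proof (rule tensor_eqI)
    fix \<beta> :: "'h \<Rightarrow> 'h \<Rightarrow> 'k" assume \<beta>: "bilinear_map scale scale (*) \<beta>"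
    have "\<beta> b 0 = 0" for b using \<beta> unfolding bilinear_map_def by (metis mult_zero_left scale_zero_left)
    then have "(\<Sum>b\<in>B. \<beta> b (left_op (coord B b) x)) = (\<Sum>b\<in>C0. \<beta> b (left_op (coord B b) x))"
      by (intro sum.mono_neutral_right) (use B zero in auto)
    with reg.coact_sum_basis[OF B(2-4) vector_space_field \<beta>]
    show "(\<Sum>(v, w)\<leftarrow>comult x. \<beta> v w) = (\<Sum>(v, w)\<leftarrow>?t. \<beta> v w)"
      using bs by (simp add: sum_list_distinct_conv_sum_set comp_def)
  qed
  moreover have "set ?t \<subseteq> C \<times> C"
    using left[OF x functional_coord[OF B(3,4)]] C0(1) bs by auto
  ultimately show "\<exists>t. set t \<subseteq> C \<times> C \<and> tensor_eq scale scale (comult x) t" by blast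
qed

text \<open>The equation \<Delta>(g) = g \<otimes> g in dual form, tested on the first factor by all
  functionals.\<close>

definition grouplikes :: "'h set"
  where "grouplikes = {g. counit g = 1 \<and> (\<forall>f. functional f \<longrightarrow> left_op f g = scale (f g) g)}"

lemma grouplike_left_op: "g \<in> grouplikes \<Longrightarrow> functional f \<Longrightarrow> left_op f g = scale (f g) g"
  by (simp add: grouplikes_def)

lemma grouplike_right_op:
  assumes "g \<in> grouplikes" "functional f" shows "right_op f g = scale (f g) g"
proof (rule eq_if_functionals_eq)
  fix f' assume f': "functional f'"
  have "f' (right_op f g) = f (left_op f' g)"
    using assms(2) f' by (simp add: functional_left_op functional_right_op)
  then show "f' (right_op f g) = f' (scale (f g) g)"
    using assms f' by (simp add: grouplike_left_op functional_scale)
qed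

lemma grouplike_counit: "g \<in> grouplikes \<Longrightarrow> counit g = 1"
  by (simp add: grouplikes_def)

lemma grouplike_conv:
  "g \<in> grouplikes \<Longrightarrow> functional f \<Longrightarrow> functional f' \<Longrightarrow> conv f f' g = f g * f' g"
  by (simp add: functional_left_op[symmetric] grouplike_left_op functional_scale)

text \<open>Apply \<open>left_op f\<close> to a relation expressing g by other grouplikes s and
  subtract \<open>f g\<close> times the relation. Independence of the s gives u s (f s - f g) = 0
  for all f, so a nonzero coefficient u s forces s = g.\<close>

lemma independent_grouplikes: "independent grouplikes"
proof -
  have fin: "independent S" if "finite S" "S \<subseteq> grouplikes" for S
    using that
  proof (induction S rule: finite_induct)
    case (insert g S)
    have S: "independent S" "g \<in> grouplikes" "S \<subseteq> grouplikes" using insert by auto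
    have "g \<notin> span S"
    proof
      assume "g \<in> span S"
      then obtain u where u: "g = (\<Sum>s\<in>S. scale (u s) s)"
        using insert.hyps(1) by (auto simp: span_finite)
      have "u s = 0" if s: "s \<in> S" for s
      proof (rule ccontr)
        assume us: "u s \<noteq> 0"
        have "f s = f g" if f: "functional f" for f
        proof -
          have "scale (f g) g = left_op f g" using S f by (simp add: grouplike_left_op)
          also have "\<dots> = (\<Sum>s\<in>S. scale (u s) (left_op f s))"
            using f by (subst u) (simp add: left_op_sum left_op_scale)
          also have "\<dots> = (\<Sum>s\<in>S. scale (u s * f s) s)"
            using S f by (intro sum.cong) (auto simp: grouplike_left_op)
          finally have "(\<Sum>s\<in>S. scale (u s * f s - f g * u s) s) = 0"
            using u by (simp add: scale_left_diff_distrib sum_subtractf scale_sum_right[symmetric]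
                flip: scale_scale)
          then have "u s * f s - f g * u s = 0"
            using independentD[OF S(1) insert.hyps(1) subset_refl, of "\<lambda>s. u s * f s - f g * u s"] s by blast
          then show ?thesis using us by (simp add: mult.commute)
        qed
        then have "s = g" by (rule eq_if_functionals_eq)
        then show False using s insert.hyps by blast
      qed
      then have "g = 0" using u by simp
      then show False using grouplike_counit[OF S(2)] functional_0[OF linear_counit] by simp
    qed
    then show ?case using S(1) by (simp add: independent_insertI)
  qed (rule independent_empty)
  show ?thesis
  proof
    assume "dependent grouplikes"
    then obtain S where "finite S" "S \<subseteq> grouplikes" "dependent S"
      unfolding dependent_explicit by blast
    then show False using fin by blast
  qed
qed

text \<open>For pointed H this is the annihilator of the coradical, that is, the Jacobson radical of
  the dual algebra.\<close>

definition rad :: "('h \<Rightarrow> 'k) set"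
  where "rad = {f. functional f \<and> (\<forall>g\<in>grouplikes. f g = 0)}"

lemma rad_functional: "f \<in> rad \<Longrightarrow> functional f"
  and rad_grouplike: "f \<in> rad \<Longrightarrow> g \<in> grouplikes \<Longrightarrow> f g = 0"
  by (simp_all add: rad_def)

lemma rad_conv: "f \<in> rad \<Longrightarrow> functional g \<Longrightarrow> conv f g \<in> rad" "f \<in> rad \<Longrightarrow> functional g \<Longrightarrow> conv g f \<in> rad"
  by (simp_all add: rad_def functional_conv grouplike_conv)

end

section \<open>Pointed coalgebras: coradical and semi-invariant vectors\<close>

locale pointed_coalgebra = coalgebra scale comult counit
  for scale :: "'k::field \<Rightarrow> 'h::ab_group_add \<Rightarrow> 'h"
    and comult :: "'h \<Rightarrow> ('h \<times> 'h) list"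
    and counit :: "'h \<Rightarrow> 'k" +
  assumes finite_dimensional: "finite_dimensional"
    and pointed: "pointed"
begin

lemmas fin_span = finite_dimensional_fin_span[OF finite_dimensional]

lemma finite_grouplikes: "finite grouplikes"
proof -
  obtain B where "finite B" "span B = UNIV" using finite_dimensional finite_dimensional_def by blast
  then show ?thesis using independent_span_bound[OF _ independent_grouplikes] by blast
qed

text \<open>By pointedness \<open>D\<close> is a line through some c. The counit axioms force
  \<open>counit c\<close> to be nonzero, and dividing c by it gives a grouplike.\<close>

lemma simple_subcoalgebra_grouplike:
  assumes "simple_subcoalgebra D"
  obtains g where "g \<in> grouplikes" "D = span {g}"
proof -
  have D: "subcoalgebra D" "subspace D" "dim D = 1"
    using assms pointed unfolding simple_subcoalgebra_def pointed_def subcoalgebra_def by auto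
  obtain C where "C \<subseteq> D" "independent C" "D \<subseteq> span C" "card C = dim D"
    using fin_span_basis'[OF fin_span, of D] by metis
  then obtain c where c: "independent {c}" "c \<in> D" "D = span {c}"
    using D card_1_singletonE[of C] span_subspace by (metis insert_subset)
  then have c0: "c \<noteq> 0" by simp
  have ex: "\<exists>\<mu>. left_op f c = scale \<mu> c" if "functional f" for f
    using subcoalgebra_left_op[OF D(1) c(2) that] c(3) by (auto simp: span_singleton)
  have fc: "f c = \<mu> * counit c" if f: "functional f" and \<mu>: "left_op f c = scale \<mu> c" for f \<mu>
  proof -
    have "f c = conv f counit c" using f by (simp add: conv_counit)
    also have "\<dots> = counit (left_op f c)" using functional_left_op[OF linear_counit] by simp
    finally show ?thesis using \<mu> functional_scale[OF linear_counit] by simp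
  qed
  have e0: "counit c \<noteq> 0"
    using fc ex c0 eq_0_if_functionals_vanish[of c] by (metis mult_zero_right)
  define g where "g = scale (inverse (counit c)) c"
  have "left_op f g = scale (f g) g" if f: "functional f" for f
  proof -
    obtain \<mu> where \<mu>: "left_op f c = scale \<mu> c" using ex[OF f] by blast
    have "f g = \<mu>" using e0 f by (simp add: g_def functional_scale fc[OF f \<mu>])
    moreover have "left_op f g = scale \<mu> g"
      using f \<mu> by (simp add: g_def left_op_scale mult.commute)
    ultimately show ?thesis by simp
  qed
  then have "g \<in> grouplikes"
    using e0 by (simp add: grouplikes_def g_def functional_scale[OF linear_counit])
  moreover have "D = span {g}"
  proof -
    have "c = scale (counit c) g" using e0 by (simp add: g_def)
    then have "c \<in> span {g}" using span_scale span_base by (metis singletonI)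
    moreover have "g \<in> span {c}" unfolding g_def by (intro span_scale span_base) simp
    ultimately show ?thesis unfolding c(3) by (simp add: span_eq)
  qed
  ultimately show thesis by (rule that)
qed

text \<open>A nonzero subcoalgebra of least dimension inside \<open>C\<close> is simple, hence the
  span of a grouplike.\<close>

lemma subcoalgebra_contains_grouplike:
  assumes "subcoalgebra C" "C \<noteq> {0}"
  obtains g where "g \<in> grouplikes" "g \<in> C"
proof -
  obtain D where D: "subcoalgebra D \<and> D \<noteq> {0} \<and> D \<subseteq> C"
    and min: "\<And>E. subcoalgebra E \<and> E \<noteq> {0} \<and> E \<subseteq> C \<Longrightarrow> dim D \<le> dim E"
    using ex_has_least_nat[of "\<lambda>D. subcoalgebra D \<and> D \<noteq> {0} \<and> D \<subseteq> C" C dim] assms by auto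
  have "simple_subcoalgebra D"
    unfolding simple_subcoalgebra_def
  proof (intro conjI allI impI)
    fix E assume E: "subcoalgebra E \<and> E \<subseteq> D"
    show "E = {0} \<or> E = D"
    proof (rule ccontr)
      assume *: "\<not> (E = {0} \<or> E = D)"
      then have "dim E < dim D"
        using E D by (intro dim_strict_mono_fin_span[OF _ fin_span]) (auto simp: subcoalgebra_def)
      moreover have "dim D \<le> dim E" using E D * by (intro min) auto
      ultimately show False by simp
    qed
  qed (use D in auto)
  then obtain g where "g \<in> grouplikes" "D = span {g}" by (rule simple_subcoalgebra_grouplike)
  then show thesis using that D span_base by blast
qed

lemma simple_subcoalgebra_span_grouplike:
  assumes g: "g \<in> grouplikes" shows "simple_subcoalgebra (span {g})"
  unfolding simple_subcoalgebra_def
proof (intro conjI allI impI)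
  show "subcoalgebra (span {g})"
    using g by (intro subcoalgebraI finite_dimensional subspace_span)
      (auto simp: span_singleton left_op_scale right_op_scale grouplike_left_op grouplike_right_op)
  have "g \<noteq> 0" using grouplike_counit[OF g] functional_0[OF linear_counit] by auto
  then show "span {g} \<noteq> {0}" using span_base by blast
  fix D assume D: "subcoalgebra D \<and> D \<subseteq> span {g}"
  show "D = {0} \<or> D = span {g}"
  proof (cases "D = {0}")
    case False
    then obtain g' where g': "g' \<in> grouplikes" "g' \<in> D"
      using subcoalgebra_contains_grouplike D by blast
    then obtain k where "g' = scale k g" using D by (auto simp: span_singleton)
    then have "g' = g"
      using grouplike_counit[OF g] grouplike_counit[OF g'(1)] functional_scale[OF linear_counit] by simp
    then have "span {g} \<subseteq> D" using g'(2) D by (intro span_minimal) (auto simp: subcoalgebra_def)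
    then show ?thesis using D by blast
  qed simp
qed

lemma corad_eq: "corad = span grouplikes"
proof (rule subset_antisym)
  show "corad \<subseteq> span grouplikes"
    unfolding corad_def
  proof (rule span_minimal)
    show "\<Union>{C. simple_subcoalgebra C} \<subseteq> span grouplikes"
    proof
      fix x assume "x \<in> \<Union>{C. simple_subcoalgebra C}"
      then obtain g where "g \<in> grouplikes" "x \<in> span {g}"
        by (metis UnionE mem_Collect_eq simple_subcoalgebra_grouplike)
      then show "x \<in> span grouplikes" using span_mono[of "{g}" grouplikes] by blast
    qed
  qed simp
  show "span grouplikes \<subseteq> corad"
    unfolding corad_def
    by (rule span_mono) (use simple_subcoalgebra_span_grouplike span_base in blast)
qed

lemma dim_corad: "dim corad = card grouplikes"
  unfolding corad_eq using dim_span_eq_card_independent[OF independent_grouplikes] .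

text \<open>For \<open>V\<close> minimal over \<open>W\<close>, the span \<open>C\<close> of the images of \<open>V\<close> under the \<open>right_op \<alpha>\<close> with
  \<open>\<alpha>\<close> vanishing on \<open>W\<close> is a subcoalgebra, hence contains some grouplike \<open>g\<close>. As a comodule, \<open>C\<close> is a
  sum of copies of the simple comodule \<open>V / W\<close>, so that \<open>V / W\<close> is isomorphic to the span of \<open>g\<close>.\<close>

lemma semi_invariant_mod:
  assumes W: "subspace W" "\<And>f x. functional f \<Longrightarrow> x \<in> W \<Longrightarrow> left_op f x \<in> W" and ne: "W \<noteq> UNIV"
  obtains g v where "g \<in> grouplikes" "v \<notin> W" "\<And>f. functional f \<Longrightarrow> left_op f v - scale (f g) v \<in> W"
proof -
  define P where "P V \<longleftrightarrow> subspace V \<and> W \<subseteq> V \<and> V \<noteq> W \<and> (\<forall>f x. functional f \<longrightarrow> x \<in> V \<longrightarrow> left_op f x \<in> V)" for V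
  have "P UNIV" using ne by (auto simp: P_def)
  then obtain V where V: "P V" and min: "\<And>E. P E \<Longrightarrow> dim V \<le> dim E"
    using ex_has_least_nat[of P UNIV dim] by auto
  have V': "subspace V" "W \<subseteq> V" "V \<noteq> W" "\<And>f x. functional f \<Longrightarrow> x \<in> V \<Longrightarrow> left_op f x \<in> V"
    using V by (auto simp: P_def)
  \<comment> \<open>\<open>V / W\<close> is a simple comodule because \<open>V\<close> has least
    dimension.\<close>
  have dich: "Y = W \<or> Y = V"
    if "subspace Y" "W \<subseteq> Y" "Y \<subseteq> V" "\<And>f x. functional f \<Longrightarrow> x \<in> Y \<Longrightarrow> left_op f x \<in> Y" for Y
  proof (rule ccontr)
    assume *: "\<not> (Y = W \<or> Y = V)"
    then have "P Y" using that by (auto simp: P_def)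
    moreover have "dim Y < dim V"
      using that * V' by (intro dim_strict_mono_fin_span[OF _ fin_span]) auto
    ultimately show False using min by (meson not_le)
  qed
  define Ann where "Ann = {\<alpha>. functional \<alpha> \<and> (\<forall>w\<in>W. \<alpha> w = 0)}"
  have Ann: "functional \<alpha>" "\<And>w. w \<in> W \<Longrightarrow> \<alpha> w = 0" if "\<alpha> \<in> Ann" for \<alpha>
    using that by (auto simp: Ann_def)
  have Ann_W: "right_op \<alpha> w = 0" if "\<alpha> \<in> Ann" "w \<in> W" for \<alpha> w
  proof (rule eq_0_if_functionals_vanish)
    fix f assume f: "functional f"
    have "f (right_op \<alpha> w) = \<alpha> (left_op f w)"
      using f Ann[OF that(1)] by (simp add: functional_left_op functional_right_op)
    then show "f (right_op \<alpha> w) = 0" using Ann(2)[OF that(1)] W(2)[OF f that(2)] by simp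
  qed
  define im where "im I = (\<Union>\<alpha>\<in>I. right_op \<alpha> ` V)" for I
  have imL: "left_op f x \<in> span (im I)" if "I \<subseteq> Ann" "functional f" "x \<in> span (im I)" for f x I
    using that(3)
  proof (induction rule: span_induct_alt)
    case (step c x y)
    then obtain \<alpha> v where x: "\<alpha> \<in> I" "v \<in> V" "x = right_op \<alpha> v" by (auto simp: im_def)
    have "left_op f x = right_op \<alpha> (left_op f v)"
      using x that Ann(1) by (auto simp: left_right)
    also have "\<dots> \<in> im I" using x V'(4)[OF that(2)] by (auto simp: im_def)
    finally show ?case using step that(2)
      by (simp add: left_op_add left_op_scale span_add span_scale span_base)
  qed (simp add: left_op_0 that span_zero)
  define C where "C = span (im Ann)"
  have "right_op f x \<in> C" if "functional f" "x \<in> C" for f x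
    using that(2) unfolding C_def
  proof (induction rule: span_induct_alt)
    case (step c x y)
    then obtain \<alpha> v where x: "\<alpha> \<in> Ann" "v \<in> V" "x = right_op \<alpha> v" by (auto simp: im_def)
    have "right_op f x = right_op (conv f \<alpha>) v"
      using x that Ann(1) by (auto simp: right_right)
    moreover have "conv f \<alpha> \<in> Ann"
    proof -
      have "conv f \<alpha> w = f (right_op \<alpha> w)" for w using that(1) by (simp add: functional_right_op)
      then show ?thesis
        using that(1) Ann(1)[OF x(1)] Ann_W[OF x(1)] by (simp add: Ann_def functional_conv functional_0)
    qed
    ultimately have "right_op f x \<in> im Ann" using x by (auto simp: im_def)
    then show ?case using step that(1)
      by (simp add: right_op_add right_op_scale span_add span_scale span_base)
  qed (simp add: right_op_0 that span_zero)
  then have "subcoalgebra C"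
    using imL[of Ann] by (intro subcoalgebraI finite_dimensional) (auto simp: C_def)
  moreover have "C \<noteq> {0}"
  proof -
    obtain v where v: "v \<in> V" "v \<notin> W" using V' by blast
    obtain \<alpha> where \<alpha>: "functional \<alpha>" "\<And>w. w \<in> W \<Longrightarrow> \<alpha> w = 0" "\<alpha> v = 1"
      using separating_functional[OF W(1) v(2)] by metis
    have "counit (right_op \<alpha> v) = 1"
      using \<alpha>(1,3) by (simp add: functional_right_op[OF linear_counit] conv_counit)
    then have "right_op \<alpha> v \<noteq> 0" using functional_0[OF linear_counit] by auto
    moreover have "right_op \<alpha> v \<in> C"
      unfolding C_def using \<alpha> v by (intro span_base) (auto simp: im_def Ann_def)
    ultimately show ?thesis by blast
  qed
  ultimately obtain g where g: "g \<in> grouplikes" "g \<in> C" by (rule subcoalgebra_contains_grouplike)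
  have g0: "g \<noteq> 0" using grouplike_counit[OF g(1)] functional_0[OF linear_counit] by auto
  obtain X u where X: "finite X" "X \<subseteq> im Ann" "g = (\<Sum>a\<in>X. scale (u a) a)"
    using g(2) unfolding C_def span_explicit by blast
  have "\<exists>I\<subseteq>Ann. finite I \<and> X \<subseteq> im I"
    using finite_subset_image[of X "\<lambda>(\<alpha>, v). right_op \<alpha> v" "Ann \<times> V"] X(1,2)
  proof -
    have "X \<subseteq> (\<lambda>(\<alpha>, v). right_op \<alpha> v) ` (Ann \<times> V)" using X(2) by (force simp: im_def)
    then obtain Z where Z: "Z \<subseteq> Ann \<times> V" "finite Z" "X = (\<lambda>(\<alpha>, v). right_op \<alpha> v) ` Z"
      using finite_subset_image[OF X(1)] by metis
    then show ?thesis by (intro exI[of _ "fst ` Z"]) (force simp: im_def)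
  qed
  then obtain I where I: "I \<subseteq> Ann" "finite I" "X \<subseteq> im I" by blast
  have "g \<in> span (im I)"
    unfolding X(3) using I(3) by (intro span_sum span_scale span_base) auto
  \<comment> \<open>Functionals are dropped from \<open>I\<close> as long as g stays in the span of
    the remaining images; the one that cannot be dropped yields v.\<close>
  have "\<exists>v. v \<notin> W \<and> (\<forall>f. functional f \<longrightarrow> left_op f v - scale (f g) v \<in> W)"
    using I(2,1) \<open>g \<in> span (im I)\<close>
  proof (induction I rule: finite_induct)
    case empty
    then show ?case using g0 by (simp add: im_def)
  next
    case (insert \<alpha> I)
    have \<alpha>: "\<alpha> \<in> Ann" "functional \<alpha>" and I: "I \<subseteq> Ann" using insert.prems Ann by auto
    show ?case
    proof (cases "g \<in> span (im I)")
      case True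
      then show ?thesis using insert.IH I by blast
    next
      case False
      interpret l: Vector_Spaces.linear scale scale "right_op \<alpha>" using right_op_linear[OF \<alpha>(2)] .
      have "im (insert \<alpha> I) = im I \<union> right_op \<alpha> ` V" by (auto simp: im_def)
      then have "g \<in> {x + y |x y. x \<in> span (im I) \<and> y \<in> span (right_op \<alpha> ` V)}"
        using insert.prems(2) by (simp add: span_Un)
      moreover have "span (right_op \<alpha> ` V) = right_op \<alpha> ` V"
        using l.subspace_image[OF V'(1)] by simp
      ultimately obtain x v where xv: "g = x + right_op \<alpha> v" "x \<in> span (im I)" "v \<in> V" by auto
      \<comment> \<open>\<open>Y\<close> is stable and lies between \<open>W\<close> and
        \<open>V\<close>. Once \<open>Y = W\<close> is known, \<open>right_op \<alpha>\<close> is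
        injective from \<open>V / W\<close> to the quotient by \<open>span (im I)\<close>, where the
        class of \<open>right_op \<alpha> v\<close> is that of g. The semi-invariance of g therefore
        pulls back to v.\<close>
      define Y where "Y = {y \<in> V. right_op \<alpha> y \<in> span (im I)}"
      have "Y = W \<or> Y = V"
      proof (rule dich)
        show "subspace Y"
          using V'(1) by (auto simp: Y_def subspace_def l.add l.scale right_op_0[OF \<alpha>(2)] span_zero span_add span_scale)
        show "W \<subseteq> Y" using V'(2) Ann_W[OF \<alpha>(1)] by (auto simp: Y_def span_zero)
        show "left_op f y \<in> Y" if "functional f" "y \<in> Y" for f y
          using that V'(4) imL[OF I] by (auto simp: Y_def left_right[OF _ \<alpha>(2), symmetric])
      qed (simp add: Y_def)
      moreover have "Y \<noteq> V"
      proof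
        assume "Y = V"
        then have "right_op \<alpha> v \<in> span (im I)" using xv by (auto simp: Y_def)
        then show False using False xv span_add by blast
      qed
      ultimately have Y: "Y = W" by blast
      have "v \<notin> W"
      proof
        assume "v \<in> W"
        then show False using Ann_W[OF \<alpha>(1)] xv False by simp
      qed
      moreover have "left_op f v - scale (f g) v \<in> W" if f: "functional f" for f
      proof -
        have "left_op f g - scale (f g) g = 0" using g f by (simp add: grouplike_left_op)
        then have "right_op \<alpha> (left_op f v - scale (f g) v) = scale (f g) x - left_op f x"
          using f by (subst (asm) (1 3) xv(1)) (simp add: left_op_add l.diff l.scale left_right[OF f \<alpha>(2)] scale_right_distrib algebra_simps)
        also have "\<dots> \<in> span (im I)" using imL[OF I f xv(2)] xv(2) by (simp add: span_diff span_scale)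
        finally have "left_op f v - scale (f g) v \<in> Y"
          using xv(3) V'(1) V'(4)[OF f] by (simp add: Y_def subspace_diff subspace_scale)
        then show ?thesis by (simp add: Y)
      qed
      ultimately show ?thesis by blast
    qed
  qed
  then show thesis using that g(1) by blast
qed

end

section \<open>Loewy filtrations\<close>

text \<open>The index is shifted by one: \<open>loewy J op (Suc n)\<close> is the \<open>n\<close>-th term of the filtration, so that
  \<open>loewy J op 0 = {0}\<close> stands for degree \<open>-1\<close>.\<close>

primrec loewy :: "'f set \<Rightarrow> ('f \<Rightarrow> 'a \<Rightarrow> 'a) \<Rightarrow> nat \<Rightarrow> 'a::zero set"
  where "loewy J op 0 = {0}"
  | "loewy J op (Suc n) = {x. \<forall>f\<in>J. op f x \<in> loewy J op n}"

locale pointed_comodule =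
  H: pointed_coalgebra sH comult counit + left_comodule sH comult counit sA coact
  for sH :: "'k::field \<Rightarrow> 'h::ab_group_add \<Rightarrow> 'h"
    and comult :: "'h \<Rightarrow> ('h \<times> 'h) list"
    and counit :: "'h \<Rightarrow> 'k"
    and sA :: "'k \<Rightarrow> 'a::ab_group_add \<Rightarrow> 'a"
    and coact :: "'a \<Rightarrow> ('h \<times> 'a) list"
begin

abbreviation E :: "nat \<Rightarrow> 'a set"
  where "E \<equiv> loewy H.rad T"

lemma E_subspace: "A.subspace (E n)"
proof (induction n)
  case (Suc n)
  show ?case
    by (rule A.subspaceI)
      (use Suc in \<open>auto simp: H.rad_functional T_0 T_add T_scale A.subspace_0 A.subspace_add A.subspace_scale\<close>)
qed simp

lemma E_T: "H.functional f \<Longrightarrow> x \<in> E n \<Longrightarrow> T f x \<in> E n"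
  by (cases n) (auto simp: T_0 T_T H.rad_functional H.rad_conv)

lemma E_rad: "f \<in> H.rad \<Longrightarrow> x \<in> E (Suc n) \<Longrightarrow> T f x \<in> E n"
  by simp

lemma E_Suc: "E n \<subseteq> E (Suc n)"
proof (induction n)
  case (Suc n)
  have "T f x \<in> E (Suc n)" if "x \<in> E (Suc n)" "f \<in> H.rad" for f x
    using E_rad[OF that(2,1)] Suc.IH by blast
  then show ?case by auto
qed (auto simp: H.rad_functional T_0)

lemma E_mono: "m \<le> n \<Longrightarrow> E m \<subseteq> E n"
  by (rule lift_Suc_mono_le[of E]) (rule E_Suc)

text \<open>The operator (id \<otimes> \<alpha>) after the coaction. It maps the comodule to H
  compatibly with \<open>T\<close> and \<open>left_op\<close>, and so transports facts about the
  filtration of H.\<close>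

definition matrix_coeff :: "('a \<Rightarrow> 'k) \<Rightarrow> 'a \<Rightarrow> 'h"
  where "matrix_coeff \<alpha> x = (\<Sum>(h, a)\<leftarrow>coact x. sH (\<alpha> a) h)"

lemma functional_matrix_coeff:
  "H.functional f \<Longrightarrow> A.functional \<alpha> \<Longrightarrow> f (matrix_coeff \<alpha> x) = \<alpha> (T f x)"
  by (simp add: matrix_coeff_def coact_op_def H.functional_sum_list A.functional_sum_list
      H.functional_scale A.functional_scale case_prod_unfold mult.commute)

lemma matrix_coeff_0: "A.functional \<alpha> \<Longrightarrow> matrix_coeff \<alpha> 0 = 0"
  by (rule H.eq_0_if_functionals_vanish) (simp add: functional_matrix_coeff T_0 A.functional_0)

lemma left_op_matrix_coeff:
  assumes "H.functional f" "A.functional \<alpha>"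
  shows "H.left_op f (matrix_coeff \<alpha> x) = matrix_coeff \<alpha> (T f x)"
  by (rule H.eq_if_functionals_eq)
    (simp add: assms H.functional_left_op H.functional_conv functional_matrix_coeff T_T)

text \<open>Induction on n, as the coefficient maps intertwine the operators. At n = 0 the counit
  recovers \<open>\<alpha> x\<close> from the coefficient.\<close>

lemma E_iff_matrix_coeff:
  "x \<in> E n \<longleftrightarrow> (\<forall>\<alpha>. A.functional \<alpha> \<longrightarrow> matrix_coeff \<alpha> x \<in> loewy H.rad H.left_op n)"
proof (induction n arbitrary: x)
  case 0
  have "x = 0" if *: "\<And>\<alpha>. A.functional \<alpha> \<Longrightarrow> matrix_coeff \<alpha> x = 0"
  proof (rule A.eq_0_if_functionals_vanish)
    fix \<alpha> assume \<alpha>: "A.functional \<alpha>"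
    have "\<alpha> x = counit (matrix_coeff \<alpha> x)"
      using functional_matrix_coeff[OF H.linear_counit \<alpha>, of x] by (simp add: T_counit)
    then show "\<alpha> x = 0" using *[OF \<alpha>] H.functional_0[OF H.linear_counit] by simp
  qed
  then show ?case by (auto simp: matrix_coeff_0)
next
  case (Suc n)
  show ?case by (auto simp: Suc.IH left_op_matrix_coeff H.rad_functional)
qed

end

context pointed_coalgebra
begin

lemma regular_pointed_comodule: "pointed_comodule scale comult counit scale comult"
  using pointed_coalgebra_axioms regular_comodule by (simp add: pointed_comodule_def)

interpretation reg: pointed_comodule scale comult counit scale comult
  by (rule regular_pointed_comodule)

abbreviation F :: "nat \<Rightarrow> 'h set"
  where "F \<equiv> loewy rad left_op"

lemmas F_subspace = reg.E_subspace and F_left_op = reg.E_T and F_rad = reg.E_rad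
  and F_Suc = reg.E_Suc and F_mono = reg.E_mono

text \<open>A functional f with \<open>f h = 1\<close> that kills the grouplikes lies in
  \<open>rad\<close>, so \<open>left_op f h = 0\<close>; but the counit of
  \<open>left_op f h\<close> is \<open>f h\<close>.\<close>

lemma F_1: "F (Suc 0) = span grouplikes"
proof (rule subset_antisym)
  show "span grouplikes \<subseteq> F (Suc 0)"
    by (rule span_minimal[OF _ F_subspace])
      (auto simp: grouplike_left_op rad_functional rad_grouplike)
  show "F (Suc 0) \<subseteq> span grouplikes"
  proof (rule subsetI, rule ccontr)
    fix h assume h: "h \<in> F (Suc 0)" "h \<notin> span grouplikes"
    obtain f where f: "functional f" "\<And>x. x \<in> span grouplikes \<Longrightarrow> f x = 0" "f h = 1"
      using separating_functional[OF subspace_span h(2)] by metis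
    then have "f \<in> rad" using span_base by (auto simp: rad_def)
    then have "left_op f h = 0" using h by simp
    moreover have "counit (left_op f h) = f h"
      using f(1) by (simp add: functional_left_op[OF linear_counit] conv_counit)
    ultimately show False using f(3) functional_0[OF linear_counit] by simp
  qed
qed

lemma F_right_op: "functional f \<Longrightarrow> h \<in> F n \<Longrightarrow> right_op f h \<in> F n"
proof (induction n arbitrary: h)
  case (Suc n)
  have "left_op g (right_op f h) \<in> F n" if "g \<in> rad" for g
    using Suc that by (simp add: left_right rad_functional)
  then show ?case by simp
qed (simp add: right_op_0)

text \<open>The filtration is defined by the left operators, yet the radical lowers it from the
  right as well: the two sides commute, and in the bottom degree the grouplikes span.\<close>

lemma F_right_rad: "f \<in> rad \<Longrightarrow> h \<in> F (Suc n) \<Longrightarrow> right_op f h \<in> F n"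
proof (induction n arbitrary: h)
  case 0
  interpret l: Vector_Spaces.linear scale scale "right_op f"
    using right_op_linear[OF rad_functional[OF 0(1)]] .
  have "h \<in> span grouplikes" using 0(2) F_1 by blast
  moreover have "right_op f g = 0" if "g \<in> grouplikes" for g
    using that 0(1) by (simp add: grouplike_right_op rad_functional rad_grouplike)
  ultimately show ?case using l.eq_0_on_span[of grouplikes h] by simp
next
  case (Suc n)
  have "left_op g (right_op f h) \<in> F n" if "g \<in> rad" for g
    using Suc.IH[OF Suc.prems(1) F_rad[OF that Suc.prems(2)]] that Suc.prems(1)
    by (simp add: left_right rad_functional)
  then show ?case by simp
qed

lemma dual_grouplike:
  obtains e where "\<And>g. g \<in> grouplikes \<Longrightarrow> functional (e g)"
    "\<And>g g'. g \<in> grouplikes \<Longrightarrow> g' \<in> grouplikes \<Longrightarrow> e g g' = (if g = g' then 1 else 0)"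
proof -
  have "\<exists>f. functional f \<and> (\<forall>g'\<in>grouplikes. f g' = (if g = g' then 1 else 0))" if "g \<in> grouplikes" for g
    using functional_dual_basis[OF independent_grouplikes that] by metis
  then obtain e where "\<forall>g\<in>grouplikes. functional (e g) \<and> (\<forall>g'\<in>grouplikes. e g g' = (if g = g' then 1 else 0))"
    by metis
  then show thesis using that by blast
qed

lemma functional_lin:
  "functional f \<Longrightarrow> functional g \<Longrightarrow> functional (\<lambda>x. f x - g x)"
  "functional f \<Longrightarrow> functional (\<lambda>x. c * f x)"
  "(\<And>i. i \<in> I \<Longrightarrow> functional (q i)) \<Longrightarrow> functional (\<lambda>x. \<Sum>i\<in>I. q i x)"
  by (simp_all add: functional_iff algebra_simps sum.distrib sum_distrib_left)

text \<open>The counit is the unit of the dual algebra, and the \<open>e g\<close> are orthogonal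
  idempotents modulo \<open>rad\<close> that sum to it. This splits vectors into weight components
  modulo lower terms.\<close>

lemma counit_minus_dual_rad:
  assumes "\<And>g. g \<in> grouplikes \<Longrightarrow> functional (e g)"
    "\<And>g g'. g \<in> grouplikes \<Longrightarrow> g' \<in> grouplikes \<Longrightarrow> e g g' = (if g = g' then 1 else 0)"
  shows "(\<lambda>h. counit h - (\<Sum>g\<in>grouplikes. e g h)) \<in> rad"
  unfolding rad_def
proof (intro CollectI conjI ballI functional_lin linear_counit assms(1))
  fix g assume g: "g \<in> grouplikes"
  have "(\<Sum>g'\<in>grouplikes. e g' g) = (\<Sum>g'\<in>grouplikes. if g' = g then 1 else 0)"
    using g assms(2) by (intro sum.cong) auto
  then show "counit g - (\<Sum>g'\<in>grouplikes. e g' g) = 0"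
    using g grouplike_counit finite_grouplikes by simp
qed

text \<open>Modulo \<open>rad\<close> every functional acts on the image of \<open>e\<close> by the
  scalar \<open>f g\<close>, so \<open>e\<close> projects onto weight g.\<close>

lemma conv_dual_rad:
  assumes "functional f" "g \<in> grouplikes" "functional e"
    "\<And>g'. g' \<in> grouplikes \<Longrightarrow> e g' = (if g = g' then 1 else 0)"
  shows "(\<lambda>h. conv f e h - f g * e h) \<in> rad" "(\<lambda>h. conv e f h - f g * e h) \<in> rad"
  using assms by (auto simp: rad_def grouplike_conv intro!: functional_lin functional_conv)

text \<open>While \<open>F n\<close> is proper, a vector that is semi-invariant modulo
  \<open>F n\<close> is sent into \<open>F n\<close> by \<open>rad\<close>, hence lies in
  \<open>F (Suc n)\<close>; the dimensions grow until they exhaust H.\<close>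

lemma F_exhaustive:
  obtains m where "F m = UNIV"
proof -
  obtain e where e: "\<And>g. g \<in> grouplikes \<Longrightarrow> functional (e g)"
    "\<And>g g'. g \<in> grouplikes \<Longrightarrow> g' \<in> grouplikes \<Longrightarrow> e g g' = (if g = g' then 1 else 0)"
    using dual_grouplike by metis
  have step: "dim (F n) < dim (F (Suc n))" if ne: "F n \<noteq> UNIV" for n
  proof -
    obtain g v where gv: "g \<in> grouplikes" "v \<notin> F n"
        "\<And>f. functional f \<Longrightarrow> left_op f v - scale (f g) v \<in> F n"
      using semi_invariant_mod[OF F_subspace F_left_op ne] by metis
    have "left_op f v \<in> F n" if "f \<in> rad" for f
      using gv(3)[OF rad_functional[OF that]] rad_grouplike[OF that gv(1)] by simp
    then have "v \<in> F (Suc n)" by simp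
    then show ?thesis
      using gv(2) F_Suc by (intro dim_strict_mono_fin_span[OF F_subspace fin_span _ F_subspace]) auto
  qed
  have "\<exists>m. F m = UNIV"
  proof (rule ccontr)
    assume "\<nexists>m. F m = UNIV"
    then have "n \<le> dim (F n)" for n
      using step by (induction n) (auto simp: Suc_le_eq intro: le_less_trans)
    then have "Suc (dim UNIV) \<le> dim UNIV"
      using dim_mono_fin_span[OF fin_span, of "F (Suc (dim UNIV))" UNIV] le_trans by blast
    then show False by simp
  qed
  then show thesis using that by blast
qed

end

section \<open>Isotypic components and the socle\<close>

context pointed_comodule
begin

lemma E_exhaustive:
  obtains m where "E m = UNIV"
proof -
  obtain m where "H.F m = UNIV" by (rule H.F_exhaustive)
  then have "E m = UNIV" using E_iff_matrix_coeff by blast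
  then show thesis by (rule that)
qed

text \<open>For i \<ge> k the coefficients of x lie in \<open>F i\<close>, where f vanishes, and the
  truncated \<open>k - i\<close> correctly gives \<open>E 0 = {0}\<close>. For smaller i, applying
  some g in \<open>rad\<close> afterwards replaces f by \<open>conv f g\<close>, which vanishes on
  \<open>F (Suc i)\<close>.\<close>

lemma T_lowers_degree:
  assumes "H.functional f" "\<And>h. h \<in> H.F i \<Longrightarrow> f h = 0" "x \<in> E k"
  shows "T f x \<in> E (k - i)"
  using assms
proof (induction "k - i" arbitrary: i f)
  case 0
  have "T f x = 0"
  proof (rule A.eq_0_if_functionals_vanish)
    fix \<alpha> assume \<alpha>: "A.functional \<alpha>"
    have "matrix_coeff \<alpha> x \<in> H.F i"
      using 0 \<alpha> E_iff_matrix_coeff H.F_mono[of k i] by auto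
    then show "\<alpha> (T f x) = 0" using functional_matrix_coeff[OF 0(2) \<alpha>] 0(3) by metis
  qed
  then show ?case using A.subspace_0[OF E_subspace] by simp
next
  case (Suc j)
  have "T g (T f x) \<in> E (k - Suc i)" if g: "g \<in> H.rad" for g
  proof -
    have "T (H.conv f g) x \<in> E (k - Suc i)"
    proof (rule Suc.hyps(1))
      show "H.conv f g h = 0" if "h \<in> H.F (Suc i)" for h
        using H.F_right_rad[OF g that] Suc.prems(1,2) by (simp add: H.functional_right_op[symmetric])
    qed (use Suc g in \<open>auto intro: H.functional_conv H.rad_functional\<close>)
    then show ?thesis using g Suc.prems(1) by (simp add: T_T H.rad_functional)
  qed
  then have "T f x \<in> E (Suc (k - Suc i))" by simp
  then show ?case using Suc.hyps(2) by (simp add: Suc_diff_Suc)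
qed

text \<open>The elements with coaction g \<otimes> x, in dual form.\<close>

definition isotypic :: "'h \<Rightarrow> 'a set"
  where "isotypic g = {x. \<forall>f. H.functional f \<longrightarrow> T f x = sA (f g) x}"

lemma isotypic_T: "x \<in> isotypic g \<Longrightarrow> H.functional f \<Longrightarrow> T f x = sA (f g) x"
  by (simp add: isotypic_def)

lemma isotypic_subspace: "A.subspace (isotypic g)"
  by (rule A.subspaceI) (auto simp: isotypic_def T_0 T_add T_scale A.scale_right_distrib mult.commute)

lemma isotypic_E: "g \<in> H.grouplikes \<Longrightarrow> isotypic g \<subseteq> E (Suc 0)"
  by (auto simp: isotypic_def H.rad_functional H.rad_grouplike)

lemma E_1_T_dual:
  assumes "g \<in> H.grouplikes" "H.functional e"
    "\<And>g'. g' \<in> H.grouplikes \<Longrightarrow> e g' = (if g = g' then 1 else 0)" "x \<in> E (Suc 0)"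
  shows "T e x \<in> isotypic g"
  unfolding isotypic_def
proof (intro CollectI allI impI)
  fix f assume f: "H.functional f"
  have "T (\<lambda>h. H.conv e f h - f g * e h) x = 0"
    using assms(4) H.conv_dual_rad(2)[OF f assms(1,2,3)] by simp
  then show "T f (T e x) = sA (f g) (T e x)"
    using f assms(2) by (simp add: T_T T_fun_diff T_fun_scale)
qed

lemma E_1_decomposition:
  assumes e: "\<And>g. g \<in> H.grouplikes \<Longrightarrow> H.functional (e g)"
    "\<And>g g'. g \<in> H.grouplikes \<Longrightarrow> g' \<in> H.grouplikes \<Longrightarrow> e g g' = (if g = g' then 1 else 0)"
    and x: "x \<in> E (Suc 0)"
  shows "x = (\<Sum>g\<in>H.grouplikes. T (e g) x)"
proof -
  have "T (\<lambda>h. counit h - (\<Sum>g\<in>H.grouplikes. e g h)) x = 0"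
    using x H.counit_minus_dual_rad[of e, OF e] by simp
  then show ?thesis by (simp add: T_fun_diff T_fun_sum T_counit)
qed

text \<open>Both inclusions rest on lines spanned by isotypic vectors. The components
  \<open>T (e g) x\<close> of an element of \<open>E (Suc 0)\<close> span such lines; conversely a
  simple subcomodule contains a nonzero isotypic vector and equals its line.\<close>

lemma soc_eq: "soc = E (Suc 0)"
proof (rule subset_antisym)
  obtain e where e: "\<And>g. g \<in> H.grouplikes \<Longrightarrow> H.functional (e g)"
    "\<And>g g'. g \<in> H.grouplikes \<Longrightarrow> g' \<in> H.grouplikes \<Longrightarrow> e g g' = (if g = g' then 1 else 0)"
    using H.dual_grouplike by metis
  have line: "subcomodule (A.span {v})" if v: "v \<in> isotypic g" for v g
  proof (intro subcomoduleI H.finite_dimensional A.subspace_span)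
    fix x f assume "x \<in> A.span {v}" "H.functional f"
    then obtain k where "x = sA k v" "T f x = sA k (sA (f g) v)"
      using isotypic_T[OF v] by (auto simp: A.span_singleton T_scale)
    then show "T f x \<in> A.span {v}" by (simp add: A.span_scale A.span_base del: A.scale_scale)
  qed
  show "E (Suc 0) \<subseteq> soc"
  proof
    fix x assume x: "x \<in> E (Suc 0)"
    have "T (e g) x \<in> soc" if g: "g \<in> H.grouplikes" for g
    proof (cases "T (e g) x = 0")
      case False
      let ?v = "T (e g) x"
      have v: "?v \<in> isotypic g" using E_1_T_dual[OF g e(1)[OF g] e(2)[OF g] x] .
      have "simple_subcomodule (A.span {?v})"
        unfolding simple_subcomodule_def
      proof (intro conjI allI impI line[OF v])
        show "A.span {?v} \<noteq> {0}" using False A.span_base by blast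
        fix W assume W: "subcomodule W \<and> W \<subseteq> A.span {?v}"
        then have sW: "A.subspace W" by (simp add: subcomodule_def)
        show "W = {0} \<or> W = A.span {?v}"
        proof (cases "W = {0}")
          case False
          then obtain w where w: "w \<in> W" "w \<noteq> 0" using A.subspace_0[OF sW] by blast
          then obtain k where k: "w = sA k ?v" "k \<noteq> 0" using W by (auto simp: A.span_singleton)
          then have "?v = sA (inverse k) w" by simp
          then have "?v \<in> W" using sW w by (metis A.subspace_scale)
          then show ?thesis using W sW A.span_minimal[of "{?v}" W] by blast
        qed simp
      qed
      then have "?v \<in> \<Union>{V. simple_subcomodule V}"
        using A.span_base[of ?v "{?v}"] by blast
      then show ?thesis unfolding soc_def by (rule A.span_base)
    qed (simp add: soc_def A.span_zero)
    then have "(\<Sum>g\<in>H.grouplikes. T (e g) x) \<in> soc" unfolding soc_def by (intro A.span_sum) auto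
    then show "x \<in> soc" using E_1_decomposition[of e, OF e x] by simp
  qed
  show "soc \<subseteq> E (Suc 0)"
    unfolding soc_def
  proof (rule A.span_minimal[OF _ E_subspace], rule subsetI)
    fix x assume "x \<in> \<Union>{V. simple_subcomodule V}"
    then obtain V where V: "simple_subcomodule V" "x \<in> V" by blast
    then have sV: "subcomodule V" "A.subspace V" by (auto simp: simple_subcomodule_def subcomodule_def)
    obtain v where v: "v \<in> V" "v \<noteq> 0"
      using V A.subspace_0[OF sV(2)] by (auto simp: simple_subcomodule_def)
    obtain m where "E m = UNIV" by (rule E_exhaustive)
    then have "\<exists>n. \<exists>v\<in>V. v \<noteq> 0 \<and> v \<in> E n" using v by auto
    then obtain n where n: "\<exists>v\<in>V. v \<noteq> 0 \<and> v \<in> E n" and least: "\<And>n'. n' < n \<Longrightarrow> \<not> (\<exists>v\<in>V. v \<noteq> 0 \<and> v \<in> E n')"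
      using exists_least_iff[of "\<lambda>n. \<exists>v\<in>V. v \<noteq> 0 \<and> v \<in> E n"] by blast
    then obtain w where w: "w \<in> V" "w \<noteq> 0" "w \<in> E n" by blast
    then obtain n' where n': "n = Suc n'" by (cases n) auto
    \<comment> \<open>\<open>T f w\<close> lies in \<open>V\<close> and in \<open>E n'\<close>, so
      the choice of the least n makes it 0.\<close>
    have "T f w = 0" if "f \<in> H.rad" for f
      using least[of n'] n' w that subcomodule_T[OF sV(1) w(1) H.rad_functional[OF that]] by auto
    then have w1: "w \<in> E (Suc 0)" by simp
    obtain g where g: "g \<in> H.grouplikes" "T (e g) w \<noteq> 0"
    proof (rule ccontr)
      assume *: "\<not> thesis"
      have "w = (\<Sum>g\<in>H.grouplikes. T (e g) w)" using E_1_decomposition[of e, OF e w1] .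
      also have "\<dots> = 0" using * that by (intro sum.neutral) blast
      finally show False using w by blast
    qed
    let ?v = "T (e g) w"
    have "?v \<in> isotypic g" using E_1_T_dual[OF g(1) e(1)[OF g(1)] e(2)[OF g(1)] w1] .
    moreover have "?v \<in> V" using subcomodule_T[OF sV(1) w(1) e(1)[OF g(1)]] .
    ultimately have "A.span {?v} = {0} \<or> A.span {?v} = V"
      using V(1) line[of ?v g] sV(2) A.span_minimal[of "{?v}" V] unfolding simple_subcomodule_def by blast
    then have "V = A.span {?v}" using g(2) A.span_base[of ?v "{?v}"] by auto
    moreover have "A.span {?v} \<subseteq> E (Suc 0)"
      using \<open>?v \<in> isotypic g\<close> isotypic_E[OF g(1)] by (intro A.span_minimal[OF _ E_subspace]) auto
    ultimately show "x \<in> E (Suc 0)" using V(2) by blast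
  qed
qed

end

section \<open>Products in comodule algebras\<close>

context left_comodule_algebra
begin

text \<open>Keeps the H-factors of the two coactions apart, so that \<open>f (g * h)\<close> may be
  expanded into products of functionals of g and of h.\<close>

definition T2 :: "('h \<Rightarrow> 'h \<Rightarrow> 'k) \<Rightarrow> 'a \<Rightarrow> 'a \<Rightarrow> 'a"
  where "T2 \<phi> x y = (\<Sum>(g, a)\<leftarrow>coact x. \<Sum>(h, b)\<leftarrow>coact y. sA (\<phi> g h) (a * b))"

lemma T2_prod: "T2 (\<lambda>g h. p g * q h) x y = T p x * T q y"
proof -
  have "(\<Sum>s\<leftarrow>ss. \<Sum>t\<leftarrow>ts. sA (p (fst s) * q (fst t)) (snd s * snd t))
      = (\<Sum>s\<leftarrow>ss. sA (p (fst s)) (snd s)) * (\<Sum>t\<leftarrow>ts. sA (q (fst t)) (snd t))" for ss ts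
  proof -
    have "(\<Sum>t\<leftarrow>ts. sA (c * q (fst t)) (a * snd t)) = sA c a * (\<Sum>t\<leftarrow>ts. sA (q (fst t)) (snd t))" for c a
      by (induction ts) (simp_all add: distrib_left A.mult_scale_left A.mult_scale_right)
    then show ?thesis by (induction ss) (simp_all add: distrib_right)
  qed
  then show ?thesis by (simp add: T2_def coact_op_def case_prod_unfold)
qed

lemma T2_sum: "T2 (\<lambda>g h. \<Sum>i\<in>I. \<phi> i g h) x y = (\<Sum>i\<in>I. T2 (\<phi> i) x y)"
proof -
  have "T2 (\<lambda>g h. 0) x y = 0" by (simp add: T2_def case_prod_unfold)
  moreover have "T2 (\<lambda>g h. \<phi> g h + \<psi> g h) x y = T2 \<phi> x y + T2 \<psi> x y" for \<phi> \<psi>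
    by (simp add: T2_def case_prod_unfold A.scale_left_distrib sum_list_addf)
  ultimately show ?thesis by (induction I rule: infinite_finite_induct) simp_all
qed

lemma T2_mult:
  assumes "H.functional f" shows "T f (x * y) = T2 (\<lambda>g h. f (g * h)) x y"
proof -
  have "T f (x * y) = (\<Sum>(h, a)\<leftarrow>[(g * h, a * b). (g, a) \<leftarrow> coact x, (h, b) \<leftarrow> coact y]. sA (f h) a)"
    unfolding coact_op_def
    by (rule tensor_eq_sum_list[OF A.vector_space_axioms bilinear_T[OF assms] coact_mult])
  then show ?thesis
    by (simp add: T2_def map_concat sum_list_concat_map comp_def case_prod_unfold)
qed

lemma T_one: "H.functional f \<Longrightarrow> T f 1 = sA (f 1) 1"
  using tensor_eq_sum_list[OF A.vector_space_axioms bilinear_T coact_one, of f]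
  by (simp add: coact_op_def)

lemma functional_mult_left: "H.functional f \<Longrightarrow> H.functional (\<lambda>h. f (g * h))"
  by (simp add: H.functional_iff distrib_left H.mult_scale_right)

lemma functional_mult_right: "H.functional f \<Longrightarrow> H.functional (\<lambda>h. f (h * g))"
  by (simp add: H.functional_iff distrib_right H.mult_scale_left)

text \<open>The coproduct of f in the dual Hopf algebra, written with a basis:
  \<open>f (g * h)\<close> is the sum of the \<open>coord B b g * f (b * h)\<close>.\<close>

lemma T_mult:
  assumes B: "finite B" "H.independent B" "H.span B = UNIV" and f: "H.functional f"
  shows "T f (x * y) = (\<Sum>b\<in>B. T (H.coord B b) x * T (\<lambda>h. f (b * h)) y)"
proof -
  have "(\<lambda>g h. f (g * h)) = (\<lambda>g h. \<Sum>b\<in>B. H.coord B b g * f (b * h))"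
    using H.functional_eq_sum_coord[OF B functional_mult_right[OF f]] by (intro ext)
  then show ?thesis unfolding T2_mult[OF f] by (simp only: T2_sum T2_prod)
qed

end

context bialgebra
begin

lemma regular_comodule_algebra: "left_comodule_algebra scale comult counit scale comult"
  using bialgebra_axioms regular_comodule assoc_algebra_axioms comult_mult comult_one
  by (simp add: left_comodule_algebra_def left_comodule_algebra_axioms_def)

interpretation reg: left_comodule_algebra scale comult counit scale comult
  by (rule regular_comodule_algebra)

lemmas left_op_mult = reg.T_mult and left_op_one = reg.T_one
  and functional_mult_left = reg.functional_mult_left
  and functional_mult_right = reg.functional_mult_right

text \<open>Testing against f' turns the right operator into a left one, for which the product rule
  is known. The resulting double sum is symmetric in the two sides and is read back in the other
  order.\<close>

lemma right_op_mult:
  assumes B: "finite B" "independent B" "span B = UNIV" and f: "functional f"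
  shows "right_op f (x * y) = (\<Sum>b\<in>B. right_op (coord B b) x * right_op (\<lambda>h. f (b * h)) y)"
proof (rule eq_if_functionals_eq)
  fix f' assume f': "functional f'"
  have c: "functional (coord B b)" for b using functional_coord[OF B(2,3)] .
  have mid: "f' (right_op p x * right_op q y) = (\<Sum>d\<in>B. coord B d (right_op p x) * f' (d * right_op q y))" for p q
    using functional_eq_sum_coord[OF B functional_mult_right[OF f']] .
  have "f' (right_op f (x * y)) = f (left_op f' (x * y))"
    using f f' by (simp add: functional_left_op functional_right_op)
  also have "\<dots> = (\<Sum>d\<in>B. f (left_op (coord B d) x * left_op (\<lambda>h. f' (d * h)) y))"
    using f by (simp add: left_op_mult[OF B f'] functional_sum)
  also have "\<dots> = (\<Sum>d\<in>B. \<Sum>b\<in>B. coord B b (left_op (coord B d) x) * f (b * left_op (\<lambda>h. f' (d * h)) y))"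
    by (intro sum.cong refl functional_eq_sum_coord[OF B functional_mult_right[OF f]])
  also have "\<dots> = (\<Sum>d\<in>B. \<Sum>b\<in>B. coord B d (right_op (coord B b) x) * f' (d * right_op (\<lambda>h. f (b * h)) y))"
  proof (intro sum.cong refl)
    fix b d
    have "coord B b (left_op (coord B d) x) = coord B d (right_op (coord B b) x)"
      by (simp add: functional_left_op[OF c] functional_right_op[OF c])
    moreover have "f (b * left_op (\<lambda>h. f' (d * h)) y) = f' (d * right_op (\<lambda>h. f (b * h)) y)"
      using functional_left_op[OF functional_mult_left[OF f], of b "\<lambda>h. f' (d * h)" y]
        functional_right_op[OF functional_mult_left[OF f'], of d "\<lambda>h. f (b * h)" y] by simp
    ultimately show "coord B b (left_op (coord B d) x) * f (b * left_op (\<lambda>h. f' (d * h)) y)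
        = coord B d (right_op (coord B b) x) * f' (d * right_op (\<lambda>h. f (b * h)) y)" by simp
  qed
  also have "\<dots> = (\<Sum>b\<in>B. f' (right_op (coord B b) x * right_op (\<lambda>h. f (b * h)) y))"
    unfolding mid by (rule sum.swap)
  also have "\<dots> = f' (\<Sum>b\<in>B. right_op (coord B b) x * right_op (\<lambda>h. f (b * h)) y)"
    using f' by (simp add: functional_sum)
  finally show "f' (right_op f (x * y)) = f' (\<Sum>b\<in>B. right_op (coord B b) x * right_op (\<lambda>h. f (b * h)) y)" .
qed

end

section \<open>The group of grouplikes of a pointed Hopf algebra\<close>

locale pointed_hopf = hopf_algebra scale comult counit antipode + pointed_coalgebra scale comult counit
  for scale :: "'k::field \<Rightarrow> 'h::ring_1 \<Rightarrow> 'h"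
    and comult :: "'h \<Rightarrow> ('h \<times> 'h) list"
    and counit :: "'h \<Rightarrow> 'k"
    and antipode :: "'h \<Rightarrow> 'h"
begin

interpretation reg: left_comodule_algebra scale comult counit scale comult
  by (rule regular_comodule_algebra)

lemma grouplike_one: "1 \<in> grouplikes"
  by (simp add: grouplikes_def counit_one left_op_one)

lemma left_op_mult_grouplike:
  assumes g: "g \<in> grouplikes" and f: "functional f"
  shows "left_op f (h * g) = left_op (\<lambda>x. f (x * g)) h * g"
    and "right_op f (h * g) = right_op (\<lambda>x. f (x * g)) h * g"
proof -
  obtain B where B: "finite B" "independent B" "span B = UNIV"
    using finite_basis[OF finite_dimensional] .
  have f': "functional (\<lambda>h. f (b * h))" for b using functional_mult_left[OF f] .
  have exp: "(\<lambda>x. f (x * g)) = (\<lambda>x. \<Sum>b\<in>B. f (b * g) * coord B b x)"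
  proof
    fix x
    show "f (x * g) = (\<Sum>b\<in>B. f (b * g) * coord B b x)"
      using functional_eq_sum_coord[OF B functional_mult_right[OF f, of g], of x] by (simp only: mult.commute)
  qed
  show "left_op f (h * g) = left_op (\<lambda>x. f (x * g)) h * g"
    unfolding left_op_mult[OF B f] exp grouplike_left_op[OF g f']
    by (simp add: reg.T_fun_sum reg.T_fun_scale sum_distrib_right mult_scale_left mult_scale_right)
  show "right_op f (h * g) = right_op (\<lambda>x. f (x * g)) h * g"
    unfolding right_op_mult[OF B f] exp grouplike_right_op[OF g f']
    by (simp add: right_op_fun_sum right_op_fun_scale sum_distrib_right mult_scale_left mult_scale_right)
qed

lemma grouplike_mult: "g \<in> grouplikes \<Longrightarrow> h \<in> grouplikes \<Longrightarrow> g * h \<in> grouplikes"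
  by (simp add: grouplikes_def[of] counit_mult left_op_mult_grouplike functional_mult_right mult_scale_left)

text \<open>The antipode supplies a left inverse, so multiplication by g is injective on the finite
  set of grouplikes and hence onto; some grouplike g' is sent to 1. That \<open>antipode g\<close>
  is grouplike follows from \<open>g' = antipode g\<close>.\<close>

lemma grouplike_inverse:
  assumes g: "g \<in> grouplikes"
  obtains g' where "g' \<in> grouplikes" "g * g' = 1" "g' * g = 1"
proof -
  obtain B where B: "finite B" "independent B" "span B = UNIV"
    using finite_basis[OF finite_dimensional] .
  have S: "antipode (x + y) = antipode x + antipode y" "antipode (scale c x) = scale c (antipode x)" for x y c
    using linear_antipode by (simp_all add: linear_iff)
  have "bilinear_map scale scale scale (\<lambda>a b. antipode a * b)"
    by (simp add: bilinear_map_def S distrib_left distrib_right mult_scale_left mult_scale_right)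
  from reg.coact_sum_basis[OF B vector_space_axioms this, of g]
  have "(\<Sum>b\<in>B. antipode b * left_op (coord B b) g) = 1"
    using antipode_left[of g] grouplike_counit[OF g] by simp
  moreover have "(\<Sum>b\<in>B. antipode b * left_op (coord B b) g) = antipode (\<Sum>b\<in>B. scale (coord B b g) b) * g"
  proof -
    have "antipode (\<Sum>b\<in>I. scale (coord B b g) b) = (\<Sum>b\<in>I. scale (coord B b g) (antipode b))" for I
      using S(2)[of 0 0] by (induction I rule: infinite_finite_induct) (simp_all add: S)
    then show ?thesis
      by (simp add: grouplike_left_op[OF g functional_coord[OF B(2,3)]] mult_scale_left mult_scale_right sum_distrib_right)
  qed
  ultimately have inv: "antipode g * g = 1"
    using sum_representation_eq[of B g B] B by simp
  have "inj_on ((*) g) grouplikes"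
    by (rule inj_onI) (metis inv mult.assoc mult_1)
  then have "(*) g ` grouplikes = grouplikes"
    using grouplike_mult[OF g] finite_grouplikes by (intro card_subset_eq) (auto simp: card_image)
  then obtain g' where g': "g' \<in> grouplikes" "g * g' = 1" using grouplike_one by (metis imageE)
  then have "g' = antipode g" using inv by (metis mult.assoc mult_1 mult_1_right)
  then show thesis using that g' inv by blast
qed

lemma rad_mult_grouplike: "f \<in> rad \<Longrightarrow> g \<in> grouplikes \<Longrightarrow> (\<lambda>h. f (h * g)) \<in> rad"
  by (auto simp: rad_def functional_mult_right grouplike_mult)

lemma rad_mult_span:
  assumes f: "f \<in> rad" and b: "b \<in> span grouplikes" shows "(\<lambda>h. f (b * h)) \<in> rad"
proof -
  have "f (b * g) = 0" if "g \<in> grouplikes" for g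
    by (rule functional_eq_0_on_span[OF functional_mult_right[OF rad_functional[OF f]] _ b])
      (use that f grouplike_mult rad_grouplike in blast)
  then show ?thesis using f by (auto simp: rad_def functional_mult_left)
qed

lemma F_mult_grouplike: "g \<in> grouplikes \<Longrightarrow> h \<in> F n \<Longrightarrow> h * g \<in> F n"
  by (induction n arbitrary: h) (simp_all add: left_op_mult_grouplike rad_functional rad_mult_grouplike)

section \<open>Homogeneous bases\<close>

text \<open>The h in H_n with \<Delta>(h) - h \<otimes> g in H_(n-1) \<otimes> H. Thus
  \<open>semi n g / F n\<close> is the part of right weight g in degree n of gr H.\<close>

definition semi :: "nat \<Rightarrow> 'h \<Rightarrow> 'h set"
  where "semi n g = {h \<in> F (Suc n). \<forall>f. functional f \<longrightarrow> right_op f h - scale (f g) h \<in> F n}"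

lemma semi_subspace: "subspace (semi n g)"
proof (rule subspaceI)
  show "0 \<in> semi n g"
    using subspace_0[OF F_subspace[of n]] subspace_0[OF F_subspace[of "Suc n"]]
    by (simp add: semi_def right_op_0)
next
  fix x y assume xy: "x \<in> semi n g" "y \<in> semi n g"
  have "right_op f (x + y) - scale (f g) (x + y) \<in> F n" if f: "functional f" for f
  proof -
    have "right_op f (x + y) - scale (f g) (x + y) = (right_op f x - scale (f g) x) + (right_op f y - scale (f g) y)"
      using f by (simp add: right_op_add scale_right_distrib)
    then show ?thesis using xy f subspace_add[OF F_subspace] by (auto simp: semi_def)
  qed
  then show "x + y \<in> semi n g" using xy subspace_add[OF F_subspace, of _ "Suc n"] by (auto simp: semi_def)
next
  fix c x assume x: "x \<in> semi n g"
  have "right_op f (scale c x) - scale (f g) (scale c x) \<in> F n" if f: "functional f" for f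
  proof -
    have "right_op f (scale c x) - scale (f g) (scale c x) = scale c (right_op f x - scale (f g) x)"
      using f by (simp add: right_op_scale scale_right_diff_distrib mult.commute)
    then show ?thesis using x f subspace_scale[OF F_subspace] by (auto simp: semi_def)
  qed
  then show "scale c x \<in> semi n g" using x subspace_scale[OF F_subspace, of _ "Suc n"] by (auto simp: semi_def)
qed

lemma F_semi: "F n \<subseteq> semi n g"
  using F_Suc F_right_op subspace_diff[OF F_subspace] subspace_scale[OF F_subspace]
  by (fastforce simp: semi_def simp del: loewy.simps)

lemma semi_mult_grouplike:
  assumes "h \<in> semi n g" "g' \<in> grouplikes" shows "h * g' \<in> semi n (g * g')"
proof -
  have "right_op f (h * g') - scale (f (g * g')) (h * g') \<in> F n" if f: "functional f" for f
  proof -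
    have "right_op (\<lambda>x. f (x * g')) h - scale (f (g * g')) h \<in> F n"
      using assms(1) functional_mult_right[OF f] by (auto simp: semi_def)
    from F_mult_grouplike[OF assms(2) this] show ?thesis
      by (simp add: left_op_mult_grouplike[OF assms(2) f] left_diff_distrib mult_scale_left)
  qed
  then show ?thesis using assms F_mult_grouplike by (auto simp: semi_def simp del: loewy.simps)
qed

text \<open>For e dual to g, \<open>right_op e\<close> is the identity modulo \<open>F n\<close> on
  weight g and zero on the other weights.\<close>

lemma semi_span_disjoint:
  assumes "g \<in> grouplikes" "\<Gamma> \<subseteq> grouplikes" "g \<notin> \<Gamma>"
    "x \<in> semi n g" "x \<in> span (F n \<union> (\<Union>g'\<in>\<Gamma>. semi n g'))"
  shows "x \<in> F n"
proof -
  obtain e where e: "functional e" "e g = 1" "\<And>g'. g' \<in> grouplikes \<Longrightarrow> g' \<noteq> g \<Longrightarrow> e g' = 0"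
    using functional_dual_basis[OF independent_grouplikes assms(1)] by metis
  have "right_op e x \<in> F n"
    using assms(5)
  proof (induction rule: span_induct_alt)
    case base
    show ?case using e subspace_0[OF F_subspace] by (simp add: right_op_0)
  next
    case (step c y z)
    have "right_op e y \<in> F n"
    proof (cases "y \<in> F n")
      case True
      then show ?thesis using e F_right_op by blast
    next
      case False
      then obtain g' where g': "g' \<in> \<Gamma>" "y \<in> semi n g'" using step by blast
      then have "e g' = 0" using assms e(3) by blast
      then show ?thesis using g' e(1) by (auto simp: semi_def simp del: loewy.simps)
    qed
    then show ?case
      using e step by (simp add: right_op_add right_op_scale subspace_add[OF F_subspace] subspace_scale[OF F_subspace])
  qed
  moreover have "right_op e x - scale (e g) x \<in> F n" using assms(4) e(1) by (auto simp: semi_def)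
  ultimately have "right_op e x - (right_op e x - scale (e g) x) \<in> F n"
    using subspace_diff[OF F_subspace] by blast
  then show ?thesis using e(2) by simp
qed

text \<open>The \<open>right_op (e g) h\<close> are the weight components of h. They sum to h modulo
  \<open>F n\<close>, since the \<open>e g\<close> sum to the counit modulo
  \<open>rad\<close>.\<close>

lemma F_Suc_span_semi: "F (Suc n) \<subseteq> span (F n \<union> (\<Union>g\<in>grouplikes. semi n g))"
proof
  fix h assume h: "h \<in> F (Suc n)"
  obtain e where e: "\<And>g. g \<in> grouplikes \<Longrightarrow> functional (e g)"
    "\<And>g g'. g \<in> grouplikes \<Longrightarrow> g' \<in> grouplikes \<Longrightarrow> e g g' = (if g = g' then 1 else 0)"
    using dual_grouplike by metis
  have "right_op (e g) h \<in> semi n g" if g: "g \<in> grouplikes" for g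
  proof -
    have "right_op f (right_op (e g) h) - scale (f g) (right_op (e g) h) \<in> F n" if f: "functional f" for f
      using F_right_rad[OF conv_dual_rad(1)[OF f g e(1)[OF g] e(2)[OF g]] h] f e(1)[OF g]
      by (simp add: right_right right_op_fun_diff right_op_fun_scale)
    then show ?thesis using F_right_op[OF e(1)[OF g] h] by (simp add: semi_def del: loewy.simps)
  qed
  then have "(\<Sum>g\<in>grouplikes. right_op (e g) h) \<in> span (F n \<union> (\<Union>g\<in>grouplikes. semi n g))"
    by (intro span_sum span_base) auto
  moreover have "h - (\<Sum>g\<in>grouplikes. right_op (e g) h) \<in> F n"
    using F_right_rad[OF counit_minus_dual_rad[of e, OF e] h]
    by (simp add: right_op_fun_diff right_op_fun_sum right_op_counit)
  ultimately have "(h - (\<Sum>g\<in>grouplikes. right_op (e g) h)) + (\<Sum>g\<in>grouplikes. right_op (e g) h)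
      \<in> span (F n \<union> (\<Union>g\<in>grouplikes. semi n g))"
    by (intro span_add) (auto intro: span_base)
  then show "h \<in> span (F n \<union> (\<Union>g\<in>grouplikes. semi n g))" by simp
qed

end

context vector_space
begin

lemma independent_Un_disjoint_span:
  assumes "finite B" "finite C" "independent (B \<union> C)" "B \<inter> C = {}" "x \<in> span B" "x \<in> span C"
  shows "x = 0"
proof -
  have x: "x \<in> span (B \<union> C)" using assms(5) span_mono[of B "B \<union> C"] by blast
  have "coord (B \<union> C) b x = 0" for b
    using coord_eq_0[OF assms(3) _ assms(5), of b] coord_eq_0[OF assms(3) _ assms(6), of b] assms(4) by blast
  then show ?thesis
    using sum_representation_eq[OF assms(3) x, of "B \<union> C"] assms(1,2) by simp
qed

end

context pointed_hopf
begin

definition homog :: "'h \<Rightarrow> nat \<Rightarrow> 'h \<Rightarrow> bool"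
  where "homog b i g \<longleftrightarrow> g \<in> grouplikes \<and> b \<in> semi i g \<and> b \<notin> F i"

lemma homog_F: "homog b i g \<Longrightarrow> b \<in> F (Suc i)"
  by (simp add: homog_def semi_def)

lemma homog_unique:
  assumes "homog b i g" "homog b j g'" shows "i = j" "g = g'"
proof -
  have "i \<le> j" if "homog b i g" "homog b j g'" for i j g g'
  proof (rule ccontr)
    assume "\<not> i \<le> j"
    then have "F (Suc j) \<subseteq> F i" by (intro F_mono) simp
    then show False using that homog_F[OF that(2)] by (auto simp: homog_def)
  qed
  then show ij: "i = j" using assms by (meson le_antisym)
  show "g = g'"
  proof (rule ccontr)
    assume "g \<noteq> g'"
    then have "b \<in> F i"
      using assms ij by (intro semi_span_disjoint[of g "{g'}" b i]) (auto simp: homog_def intro: span_base)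
    then show False using assms by (simp add: homog_def)
  qed
qed

text \<open>The last clause is what the final count needs: the number of basis vectors of a given
  weight does not depend on the weight.\<close>

definition homog_basis :: "nat \<Rightarrow> 'h set \<Rightarrow> bool"
  where "homog_basis n B \<longleftrightarrow> finite B \<and> independent B \<and> B \<subseteq> F n \<and>
    (\<forall>i\<le>n. F i \<subseteq> span (B \<inter> F i)) \<and> (\<forall>b\<in>B. \<exists>i g. homog b i g) \<and>
    (\<exists>r. \<forall>g\<in>grouplikes. card {b \<in> B. \<exists>i. homog b i g} = r)"

text \<open>Right multiplication by g preserves \<open>F n\<close> and carries
  \<open>semi n 1\<close> onto \<open>semi n g\<close>. So only a complement \<open>C\<close> of
  \<open>F n\<close> in \<open>semi n 1\<close> is chosen, and its translates serve all other
  weights: each weight gains \<open>card C\<close> vectors.\<close>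

lemma homog_basis_exists: "\<exists>B. homog_basis n B"
proof (induction n)
  case 0
  have "homog_basis 0 {}" by (simp add: homog_basis_def independent_empty)
  then show ?case by blast
next
  case (Suc n)
  then obtain B r where B: "finite B" "independent B" "B \<subseteq> F n"
      "\<And>i. i \<le> n \<Longrightarrow> F i \<subseteq> span (B \<inter> F i)" "\<And>b. b \<in> B \<Longrightarrow> \<exists>i g. homog b i g"
      "\<And>g. g \<in> grouplikes \<Longrightarrow> card {b \<in> B. \<exists>i. homog b i g} = r"
    unfolding homog_basis_def by blast
  have sB: "span B = F n"
    using B(3) B(4)[of n] span_minimal[OF B(3) F_subspace] by (simp add: Int_absorb2)
  have Bs: "B \<subseteq> semi n 1" using B(3) F_semi by blast
  obtain C' where C': "B \<subseteq> C'" "C' \<subseteq> semi n 1" "independent C'" "semi n 1 \<subseteq> span C'" "finite C'"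
    using fin_span_basis[OF fin_span Bs B(2)] by metis
  define C where "C = C' - B"
  have C: "finite C" "independent (B \<union> C)" "B \<inter> C = {}" "C \<subseteq> semi n 1" "semi n 1 \<subseteq> span (B \<union> C)"
    using C' by (auto simp: C_def Un_absorb1)
  have indC: "independent C" using C(2) by (rule independent_mono) blast
  have CF: "x = 0" if "x \<in> F n" "x \<in> span C" for x
    using independent_Un_disjoint_span[OF B(1) C(1-3)] that sB by blast
  define tr where "tr g = (\<lambda>c. c * g) ` C" for g
  have lin: "Vector_Spaces.linear scale scale (\<lambda>x. x * g)" for g
    using vector_space_axioms by (simp add: linear_iff distrib_right mult_scale_left)
  have inj: "inj (\<lambda>x. x * g)" if "g \<in> grouplikes" for g
  proof (rule injI)
    fix x y assume *: "x * g = y * g"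
    obtain g' where "g * g' = 1" using grouplike_inverse[OF \<open>g \<in> grouplikes\<close>] by metis
    then show "x = y" using * by (metis mult.assoc mult_1_right)
  qed
  have tr_ind: "independent (tr g)" if "g \<in> grouplikes" for g
  proof -
    interpret l: Vector_Spaces.linear scale scale "\<lambda>x. x * g" by (rule lin)
    show ?thesis unfolding tr_def
      using l.independent_injective_image[OF indC] inj[OF that] inj_on_subset by blast
  qed
  have tr_semi: "tr g \<subseteq> semi n g" if "g \<in> grouplikes" for g
    using semi_mult_grouplike[of _ n 1 g] that C(4) by (auto simp: tr_def)
  have tr_span: "x = 0" if g: "g \<in> grouplikes" and x: "x \<in> span (tr g)" "x \<in> F n" for x g
  proof -
    interpret l: Vector_Spaces.linear scale scale "\<lambda>x. x * g" by (rule lin)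
    obtain y where y: "y \<in> span C" "x = y * g"
      using x(1) unfolding tr_def l.span_image by blast
    obtain g' where g': "g' \<in> grouplikes" "g * g' = 1" using grouplike_inverse[OF g] by metis
    have "x * g' = y" using y(2) g'(2) by (simp add: mult.assoc)
    then have "y \<in> F n" using F_mult_grouplike[OF g'(1) x(2)] by simp
    then have "y = 0" using CF y(1) by blast
    then show ?thesis using y(2) by simp
  qed
  have tr_F: "b \<notin> F n" if "g \<in> grouplikes" "b \<in> tr g" for b g
    using tr_span[OF that(1), of b] that tr_ind[OF that(1)] span_base dependent_zero by metis
  have tr_homog: "homog b n g" if "g \<in> grouplikes" "b \<in> tr g" for b g
    using that tr_F tr_semi by (auto simp: homog_def)
  have tr_fin: "finite (tr g)" for g using C(1) by (simp add: tr_def)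
  define N where "N \<Gamma> = B \<union> (\<Union>g\<in>\<Gamma>. tr g)" for \<Gamma>
  have ind: "independent (N \<Gamma>)" if "finite \<Gamma>" "\<Gamma> \<subseteq> grouplikes" for \<Gamma>
    using that
  proof (induction \<Gamma> rule: finite_induct)
    case empty
    then show ?case using B(2) by (simp add: N_def)
  next
    case (insert g \<Gamma>)
    have g: "g \<in> grouplikes" "\<Gamma> \<subseteq> grouplikes" using insert.prems by auto
    \<comment> \<open>A common vector has weight g and is spanned by other weights modulo
      \<open>F n\<close>, so it lies in \<open>F n\<close>. Translated back by the inverse of g it
      falls into \<open>span C\<close>, which meets \<open>F n\<close> only in 0.\<close>
    have "span (N \<Gamma>) \<inter> span (tr g) \<subseteq> {0}"
    proof
      fix x assume x: "x \<in> span (N \<Gamma>) \<inter> span (tr g)"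
      have "x \<in> semi n g"
        using x span_minimal[OF tr_semi[OF g(1)] semi_subspace] by blast
      moreover have "N \<Gamma> \<subseteq> F n \<union> (\<Union>g'\<in>\<Gamma>. semi n g')"
        using B(3) tr_semi g(2) unfolding N_def by blast
      then have "x \<in> span (F n \<union> (\<Union>g'\<in>\<Gamma>. semi n g'))" using x span_mono by blast
      ultimately have "x \<in> F n" using semi_span_disjoint g insert.hyps by blast
      then show "x \<in> {0}" using tr_span[OF g(1)] x by blast
    qed
    moreover have "N (insert g \<Gamma>) = N \<Gamma> \<union> tr g" by (auto simp: N_def)
    ultimately show ?case
      using independent_Un[OF _ tr_ind[OF g(1)] tr_fin] insert.IH g(2) by simp
  qed
  define B' where "B' = N grouplikes"
  have BB': "B \<subseteq> B'" by (auto simp: B'_def N_def)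
  have B'F: "B' \<subseteq> F (Suc n)"
    using B(3) F_Suc homog_F[OF tr_homog] unfolding B'_def N_def by blast
  have "F (Suc n) \<subseteq> span B'"
  proof -
    have "semi n g \<subseteq> span B'" if g: "g \<in> grouplikes" for g
    proof
      fix x assume x: "x \<in> semi n g"
      interpret l: Vector_Spaces.linear scale scale "\<lambda>x. x * g" by (rule lin)
      obtain g' where g': "g' \<in> grouplikes" "g * g' = 1" "g' * g = 1" using grouplike_inverse[OF g] by metis
      have "x * g' \<in> semi n 1" using semi_mult_grouplike[OF x g'(1)] g'(2) by simp
      then have "x * g' * g \<in> (\<lambda>x. x * g) ` span (B \<union> C)" using C(5) by blast
      then have "x \<in> span ((\<lambda>x. x * g) ` (B \<union> C))"
        unfolding l.span_image using g'(3) by (simp add: mult.assoc)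
      moreover have "(\<lambda>x. x * g) ` (B \<union> C) \<subseteq> span B'"
      proof (rule image_subsetI)
        fix b assume "b \<in> B \<union> C"
        then show "b * g \<in> span B'"
        proof
          assume "b \<in> B"
          then have "b * g \<in> span B" using F_mult_grouplike[OF g] B(3) sB by blast
          then show ?thesis using BB' span_mono by blast
        next
          assume "b \<in> C"
          then have "b * g \<in> B'" using g by (auto simp: B'_def N_def tr_def)
          then show ?thesis by (rule span_base)
        qed
      qed
      ultimately show "x \<in> span B'" using span_minimal[OF _ subspace_span] by blast
    qed
    moreover have "F n \<subseteq> span B'" using sB span_mono[OF BB'] by simp
    ultimately have "span (F n \<union> (\<Union>g\<in>grouplikes. semi n g)) \<subseteq> span B'"
      by (intro span_minimal subspace_span) blast
    then show ?thesis using F_Suc_span_semi by blast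
  qed
  moreover have "F i \<subseteq> span (B' \<inter> F i)" if "i \<le> n" for i
    using B(4)[OF that] span_mono[of "B \<inter> F i" "B' \<inter> F i"] BB' by blast
  ultimately have sp: "F i \<subseteq> span (B' \<inter> F i)" if "i \<le> Suc n" for i
    using that B'F by (cases "i = Suc n") (auto simp: Int_absorb2 simp del: loewy.simps)
  have "card {b \<in> B'. \<exists>i. homog b i g} = r + card C" if g: "g \<in> grouplikes" for g
  proof -
    have "{b \<in> B'. \<exists>i. homog b i g} = {b \<in> B. \<exists>i. homog b i g} \<union> tr g"
      using tr_homog homog_unique(2) g unfolding B'_def N_def by blast
    moreover have "{b \<in> B. \<exists>i. homog b i g} \<inter> tr g = {}" using tr_F[OF g] B(3) by blast
    moreover have "card (tr g) = card C"
      unfolding tr_def using inj[OF g] by (intro card_image) (rule inj_on_subset, auto)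
    ultimately show ?thesis using B(1) tr_fin B(6)[OF g] by (simp add: card_Un_disjoint)
  qed
  moreover have "\<exists>i g. homog b i g" if "b \<in> B'" for b
    using that B(5) tr_homog unfolding B'_def N_def by blast
  moreover have "finite B'" using B(1) tr_fin finite_grouplikes by (simp add: B'_def N_def)
  moreover have "independent B'" using ind[OF finite_grouplikes] by (simp add: B'_def)
  ultimately have "homog_basis (Suc n) B'"
    unfolding homog_basis_def using sp B'F by blast
  then show ?case by blast
qed

text \<open>The number r is dim H / dim corad H, as the weights partition \<open>B\<close> into
  classes of size r.\<close>

definition adapted :: "'h set \<Rightarrow> bool"
  where "adapted B \<longleftrightarrow> finite B \<and> independent B \<and> span B = UNIV \<and>
    (\<forall>i. F i \<subseteq> span (B \<inter> F i)) \<and> (\<forall>b\<in>B. \<exists>i g. homog b i g) \<and>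
    (\<exists>r. dim UNIV = card grouplikes * r \<and> (\<forall>g\<in>grouplikes. card {b \<in> B. \<exists>i. homog b i g} = r))"

lemma adapted_basis_exists: "\<exists>B. adapted B"
proof -
  obtain m where m: "F m = UNIV" by (rule F_exhaustive)
  obtain B where "homog_basis m B" using homog_basis_exists by blast
  then obtain r where B: "finite B" "independent B" "\<And>i. i \<le> m \<Longrightarrow> F i \<subseteq> span (B \<inter> F i)"
      "\<And>b. b \<in> B \<Longrightarrow> \<exists>i g. homog b i g" "\<And>g. g \<in> grouplikes \<Longrightarrow> card {b \<in> B. \<exists>i. homog b i g} = r"
    unfolding homog_basis_def by blast
  have sB: "span B = UNIV" using B(3)[of m] m by auto
  have "F i \<subseteq> span (B \<inter> F i)" for i
  proof (cases "i \<le> m")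
    case False
    then have "F i = UNIV" using m F_mono[of m i] by auto
    then show ?thesis using sB by simp
  qed (rule B(3))
  moreover have "dim UNIV = card grouplikes * r"
  proof -
    have "B = (\<Union>g\<in>grouplikes. {b \<in> B. \<exists>i. homog b i g})"
      using B(4) unfolding homog_def by blast
    then have "card B = card (\<Union>g\<in>grouplikes. {b \<in> B. \<exists>i. homog b i g})" by simp
    also have "\<dots> = (\<Sum>g\<in>grouplikes. card {b \<in> B. \<exists>i. homog b i g})"
      using homog_unique(2) B(1) by (intro card_UN_disjoint finite_grouplikes ballI impI) (simp, blast)
    also have "\<dots> = card grouplikes * r" using B(5) by simp
    finally show ?thesis using dim_eq_card[of B UNIV] sB B(2) by simp
  qed
  ultimately have "adapted B"
    unfolding adapted_def by (intro conjI ballI allI B(1,2,4) sB exI[of _ r] B(5))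
  then show ?thesis by blast
qed

end

context pointed_hopf
begin

definition deg :: "'h \<Rightarrow> nat"
  where "deg b = (THE i. \<exists>g. homog b i g)"

definition wt :: "'h \<Rightarrow> 'h"
  where "wt b = (THE g. \<exists>i. homog b i g)"

lemma deg_wt_eq: "homog b i g \<Longrightarrow> deg b = i" "homog b i g \<Longrightarrow> wt b = g"
  unfolding deg_def wt_def using homog_unique by blast+

end

section \<open>Coordinates in an adapted basis, and multiplicativity of the Loewy filtration\<close>

locale adapted_comodule_algebra =
  H: pointed_hopf sH comult counit antipode + left_comodule_algebra sH comult counit sA coact
  for sH :: "'k::field \<Rightarrow> 'h::ring_1 \<Rightarrow> 'h"
    and comult :: "'h \<Rightarrow> ('h \<times> 'h) list"
    and counit :: "'h \<Rightarrow> 'k"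
    and antipode :: "'h \<Rightarrow> 'h"
    and sA :: "'k \<Rightarrow> 'a::ring_1 \<Rightarrow> 'a"
    and coact :: "'a \<Rightarrow> ('h \<times> 'a) list" +
  fixes B :: "'h set"
  assumes adapted: "H.adapted B"
begin

sublocale pointed_comodule sH comult counit sA coact ..

abbreviation co :: "'h \<Rightarrow> 'h \<Rightarrow> 'k"
  where "co \<equiv> H.coord B"

lemma basis: "finite B" "H.independent B" "H.span B = UNIV"
  using adapted by (simp_all add: H.adapted_def)

lemma functional_co: "H.functional (co b)"
  using H.functional_coord basis by blast

lemma homog_basis: "b \<in> B \<Longrightarrow> H.homog b (H.deg b) (H.wt b)"
  using adapted H.deg_wt_eq unfolding H.adapted_def by metis

lemma wt_grouplike: "b \<in> B \<Longrightarrow> H.wt b \<in> H.grouplikes"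
  using homog_basis H.homog_def by blast

lemma basis_F: "b \<in> B \<Longrightarrow> b \<in> H.F (Suc (H.deg b))"
  using homog_basis H.homog_F by blast

lemma basis_notin_F: "b \<in> B \<Longrightarrow> i \<le> H.deg b \<Longrightarrow> b \<notin> H.F i"
  using homog_basis H.F_mono unfolding H.homog_def by blast

lemma basis_semi: "b \<in> B \<Longrightarrow> H.functional f \<Longrightarrow> H.right_op f b - sH (f (H.wt b)) b \<in> H.F (H.deg b)"
  using homog_basis unfolding H.homog_def H.semi_def by blast

lemma co_basis: "b \<in> B \<Longrightarrow> c \<in> B \<Longrightarrow> co c b = (if b = c then 1 else 0)"
  using H.representation_basis[OF basis(2)] by simp

lemma co_F: "x \<in> H.F i \<Longrightarrow> i \<le> H.deg b \<Longrightarrow> b \<in> B \<Longrightarrow> co b x = 0"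
  using adapted basis_notin_F by (intro H.coord_eq_0[OF basis(2), of "B \<inter> H.F i"]) (auto simp: H.adapted_def)

text \<open>Modulo \<open>F (deg b)\<close> the right operators are diagonal in the basis, and
  \<open>co b\<close> does not see the elements of \<open>F (deg b)\<close>.\<close>

lemma co_right_op:
  assumes b: "b \<in> B" and f: "H.functional f" and x: "x \<in> H.F (Suc (H.deg b))"
  shows "co b (H.right_op f x) = f (H.wt b) * co b x"
proof -
  have "x \<in> H.span (B \<inter> H.F (Suc (H.deg b)))"
    using x adapted unfolding H.adapted_def by blast
  then show ?thesis
  proof (induction rule: H.span_induct_alt)
    case base
    then show ?case using f by (simp add: H.right_op_0 H.functional_0[OF functional_co])
  next
    case (step k c y)
    have c: "c \<in> B" "c \<in> H.F (Suc (H.deg b))" using step by auto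
    have "H.deg c \<le> H.deg b"
      using basis_notin_F[OF c(1), of "Suc (H.deg b)"] c(2) by (meson not_less_eq_eq)
    then have "co b (H.right_op f c - sH (f (H.wt c)) c) = 0"
      using co_F[OF basis_semi[OF c(1) f] _ b] by blast
    then have "co b (H.right_op f c) = f (H.wt b) * co b c"
      using b c by (simp add: H.functional_diff[OF functional_co] H.functional_scale[OF functional_co] co_basis split: if_splits)
    then show ?case
      using f step by (simp add: H.right_op_add H.right_op_scale H.functional_add[OF functional_co]
          H.functional_scale[OF functional_co] algebra_simps)
  qed
qed

lemma wt_eqI:
  assumes c: "c \<in> B" and x: "x \<in> H.semi (H.deg c) g" and ne: "co c x \<noteq> 0"
  shows "H.wt c = g"
proof (rule H.eq_if_functionals_eq)
  fix f assume f: "H.functional f"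
  have "co c (H.right_op f x - sH (f g) x) = 0"
    using x f co_F[OF _ order_refl c] by (auto simp: H.semi_def)
  then have "f (H.wt c) * co c x = f g * co c x"
    using co_right_op[OF c f, of x] x
    by (auto simp: H.semi_def H.functional_diff[OF functional_co] H.functional_scale[OF functional_co] simp del: loewy.simps)
  then show "f (H.wt c) = f g" using ne by simp
qed

text \<open>The dichotomy behind the degree estimates for \<open>T_mult\<close> with f in
  \<open>rad\<close>: in each term either \<open>f (b * h)\<close>, as a functional of h, is again
  in \<open>rad\<close>, or \<open>co b\<close> is, so one factor drops by a degree.\<close>

lemma basis_deg_0_or_rad:
  assumes "b \<in> B" shows "b \<in> H.span H.grouplikes \<or> co b \<in> H.rad"
proof (cases "H.deg b")
  case 0
  then show ?thesis using basis_F[OF assms] H.F_1 by auto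
next
  case (Suc d)
  then have "co b g = 0" if "g \<in> H.grouplikes" for g
    using co_F[of g "Suc 0" b] assms that H.F_1 H.span_base by (simp del: loewy.simps)
  then show ?thesis using functional_co by (simp add: H.rad_def)
qed

text \<open>Induction on the total degree: for f in \<open>rad\<close>, every summand of
  \<open>T f (x * y)\<close> has one factor of lower degree.\<close>

lemma E_mult: "x \<in> E (Suc i) \<Longrightarrow> y \<in> E (Suc j) \<Longrightarrow> x * y \<in> E (Suc (i + j))"
proof (induction "i + j" arbitrary: i j x y rule: less_induct)
  case less
  have "T f (x * y) \<in> E (i + j)" if f: "f \<in> H.rad" for f
    unfolding T_mult[OF basis H.rad_functional[OF f]]
  proof (rule A.subspace_sum[OF E_subspace])
    fix b assume b: "b \<in> B"
    show "T (co b) x * T (\<lambda>h. f (b * h)) y \<in> E (i + j)"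
      using basis_deg_0_or_rad[OF b]
    proof
      assume "b \<in> H.span H.grouplikes"
      then have y: "T (\<lambda>h. f (b * h)) y \<in> E j" using E_rad[OF H.rad_mult_span[OF f]] less.prems by blast
      have x: "T (co b) x \<in> E (Suc i)" using E_T[OF functional_co] less.prems by blast
      show ?thesis
      proof (cases j)
        case 0
        then show ?thesis using y A.subspace_0[OF E_subspace] by simp
      next
        case (Suc j')
        then show ?thesis using less.hyps[of i j'] x y by (simp del: loewy.simps)
      qed
    next
      assume "co b \<in> H.rad"
      then have x: "T (co b) x \<in> E i" using E_rad less.prems by blast
      have y: "T (\<lambda>h. f (b * h)) y \<in> E (Suc j)"
        using E_T[OF functional_mult_left[OF H.rad_functional[OF f]]] less.prems by blast
      show ?thesis
      proof (cases i)
        case 0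
        then show ?thesis using x A.subspace_0[OF E_subspace] by simp
      next
        case (Suc i')
        then show ?thesis using less.hyps[of i' j] x y by (simp del: loewy.simps)
      qed
    qed
  qed
  then show ?case by simp
qed

lemma one_E: "1 \<in> E (Suc 0)"
  by (auto simp: T_one H.rad_functional H.rad_grouplike[OF _ H.grouplike_one])

lemma T_isotypic_mult:
  assumes "u \<in> isotypic g" "H.functional f"
  shows "T f (u * x) = u * T (\<lambda>h. f (g * h)) x"
proof -
  have "T f (u * x) = (\<Sum>b\<in>B. u * T (\<lambda>h. co b g * f (b * h)) x)"
    using isotypic_T[OF assms(1) functional_co]
    by (simp add: T_mult[OF basis assms(2)] T_fun_scale A.mult_scale_left A.mult_scale_right)
  also have "\<dots> = u * T (\<lambda>h. \<Sum>b\<in>B. co b g * f (b * h)) x"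
    by (simp add: T_fun_sum sum_distrib_left)
  also have "(\<lambda>h. \<Sum>b\<in>B. co b g * f (b * h)) = (\<lambda>h. f (g * h))"
    by (rule ext, rule H.functional_eq_sum_coord[OF basis functional_mult_right[OF assms(2)], symmetric])
  finally show ?thesis .
qed

end

lemma (in pointed_hopf) adapted_regular:
  "adapted B \<Longrightarrow> adapted_comodule_algebra scale comult counit antipode scale comult B"
  using pointed_hopf_axioms regular_comodule_algebra
  by (simp add: adapted_comodule_algebra_def adapted_comodule_algebra_axioms_def)

section \<open>Invertible elements in the socle of a right H-simple comodule algebra\<close>

locale simple_comodule_algebra = adapted_comodule_algebra sH comult counit antipode sA coact B
  for sH :: "'k::field \<Rightarrow> 'h::ring_1 \<Rightarrow> 'h"
    and comult :: "'h \<Rightarrow> ('h \<times> 'h) list"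
    and counit :: "'h \<Rightarrow> 'k"
    and antipode :: "'h \<Rightarrow> 'h"
    and sA :: "'k \<Rightarrow> 'a::ring_1 \<Rightarrow> 'a"
    and coact :: "'a \<Rightarrow> ('h \<times> 'a) list"
    and B :: "'h set" +
  assumes finite_dimensional: "A.finite_dimensional"
    and right_H_simple: "right_H_simple"
begin

lemmas fin_span = A.finite_dimensional_fin_span[OF finite_dimensional]

text \<open>The right ideal u A is a subcomodule because u has coaction g \<otimes> u, so it is all
  of A; in finite dimension left multiplication by u is then injective as well.\<close>

lemma isotypic_invertible:
  assumes g: "g \<in> H.grouplikes" and u: "u \<in> isotypic g" "u \<noteq> 0"
  obtains u' where "u' \<in> E (Suc 0)" "u * u' = 1"
proof -
  have lin: "Vector_Spaces.linear sA sA ((*) u)"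
    using A.vector_space_axioms by (simp add: linear_iff distrib_left A.mult_scale_right)
  interpret l: Vector_Spaces.linear sA sA "(*) u" by (rule lin)
  have sub: "A.subspace (range ((*) u))" using l.subspace_image[OF A.subspace_UNIV] .
  have "right_ideal (range ((*) u))"
    using sub by (auto simp: right_ideal_def mult.assoc)
  moreover have "subcomodule (range ((*) u))"
    by (rule subcomoduleI[OF H.finite_dimensional sub]) (auto simp: T_isotypic_mult[OF u(1)])
  ultimately have "range ((*) u) = {0} \<or> range ((*) u) = UNIV"
    using right_H_simple by (simp add: right_H_simple_def)
  moreover have "u \<in> range ((*) u)" by (rule range_eqI[of _ _ 1]) simp
  ultimately have surj: "range ((*) u) = UNIV" using u(2) by auto
  obtain C where C: "finite C" "A.independent C" "A.span C = UNIV"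
    using A.finite_basis[OF finite_dimensional] .
  interpret fd: finite_dimensional_vector_space sA C
    using C by unfold_locales auto
  have inj: "inj ((*) u)" using fd.linear_surj_imp_inj[OF lin surj] .
  obtain u' where u': "u * u' = 1" using surj by (metis UNIV_I imageE)
  obtain g' where g': "g' \<in> H.grouplikes" "g * g' = 1" "g' * g = 1"
    using H.grouplike_inverse[OF g] by metis
  have "T f u' = 0" if f: "f \<in> H.rad" for f
  proof -
    \<comment> \<open>The shift by g' cancels the shift by g that u causes:
      \<open>T p (u * u')\<close> is \<open>u * T f u'\<close>. On the other hand
      \<open>T p 1\<close> is the multiple \<open>f g'\<close> of 1, which is 0.\<close>
    define p where "p = (\<lambda>h. f (g' * h))"
    have p: "H.functional p" unfolding p_def using functional_mult_left[OF H.rad_functional[OF f]] .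
    have "T p (u * u') = u * T f u'"
      using g'(3) by (simp add: T_isotypic_mult[OF u(1) p]) (simp add: p_def mult.assoc[symmetric])
    moreover have "T p (u * u') = 0"
      using p f g'(1) by (simp add: u' T_one) (simp add: p_def H.rad_grouplike)
    ultimately have "u * T f u' = u * 0" by simp
    then show ?thesis using inj by (meson injD)
  qed
  then have "u' \<in> E (Suc 0)" by simp
  then show thesis using that u' by blast
qed

text \<open>Some weight component \<open>T (e g) x\<close> is nonzero; it stays in \<open>X\<close>
  by stability and is isotypic, hence has a right inverse.\<close>

lemma E_1_invertible:
  assumes X: "X \<subseteq> E (Suc 0)" "\<And>f x. H.functional f \<Longrightarrow> x \<in> X \<Longrightarrow> T f x \<in> X" and x: "x \<in> X" "x \<noteq> 0"
  obtains u u' where "u \<in> X" "u' \<in> E (Suc 0)" "u * u' = 1"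
proof -
  obtain e where e: "\<And>g. g \<in> H.grouplikes \<Longrightarrow> H.functional (e g)"
    "\<And>g g'. g \<in> H.grouplikes \<Longrightarrow> g' \<in> H.grouplikes \<Longrightarrow> e g g' = (if g = g' then 1 else 0)"
    using H.dual_grouplike by metis
  have "\<exists>g\<in>H.grouplikes. T (e g) x \<noteq> 0"
  proof (rule ccontr)
    assume "\<not> ?thesis"
    then have "(\<Sum>g\<in>H.grouplikes. T (e g) x) = 0" by (intro sum.neutral) blast
    then show False using E_1_decomposition[of e, OF e, of x] x X(1) by auto
  qed
  then obtain g where g: "g \<in> H.grouplikes" "T (e g) x \<noteq> 0" by blast
  have "T (e g) x \<in> isotypic g" using E_1_T_dual[OF g(1) e(1)[OF g(1)] e(2)[OF g(1)], of x] x X(1) by blast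
  from isotypic_invertible[OF g(1) this g(2)] obtain u' where "u' \<in> E (Suc 0)" "T (e g) x * u' = 1" .
  then show thesis using that X(2)[OF e(1)[OF g(1)] x(1)] by blast
qed

end

section \<open>Counting along a filtered Hopf module\<close>

text \<open>The quotients \<open>U n / L n\<close> are the homogeneous components (shifted by one) of a graded Hopf
  module; the components \<open>E (Suc k)\<close> of the algebra act through their images in the associated
  graded algebra. The cut-off \<open>c\<close> replaces \<open>A\<close> by its subalgebra \<open>E c\<close>, for \<open>c = 1\<close> or \<open>E c = A\<close>.\<close>

locale filtered_hopf_module =
  simple_comodule_algebra sH comult counit antipode sA coact B + P: vector_space sP
  for sH :: "'k::field \<Rightarrow> 'h::ring_1 \<Rightarrow> 'h"
    and comult :: "'h \<Rightarrow> ('h \<times> 'h) list"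
    and counit :: "'h \<Rightarrow> 'k"
    and antipode :: "'h \<Rightarrow> 'h"
    and sA :: "'k \<Rightarrow> 'a::ring_1 \<Rightarrow> 'a"
    and coact :: "'a \<Rightarrow> ('h \<times> 'a) list"
    and B :: "'h set"
    and sP :: "'k \<Rightarrow> 'p::ab_group_add \<Rightarrow> 'p" +
  fixes op :: "('h \<Rightarrow> 'k) \<Rightarrow> 'p \<Rightarrow> 'p"
    and act :: "'p \<Rightarrow> 'a \<Rightarrow> 'p"
    and U L :: "nat \<Rightarrow> 'p set"
    and c M :: nat
  assumes op_linear: "H.functional f \<Longrightarrow> Vector_Spaces.linear sP sP (op f)"
    and op_fun_add: "op (\<lambda>h. f h + f' h) x = op f x + op f' x"
    and op_fun_scale: "op (\<lambda>h. r * f h) x = sP r (op f x)"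
    and op_op: "H.functional f \<Longrightarrow> H.functional f' \<Longrightarrow> op f (op f' x) = op (H.conv f' f) x"
    and op_counit: "x \<in> U n \<Longrightarrow> op counit x = x"
    and act_bilinear: "bilinear_map sP sA sP act"
    and act_act: "act (act x a) b = act x (a * b)"
    and act_one: "x \<in> U n \<Longrightarrow> act x 1 = x"
    and op_act: "H.functional f \<Longrightarrow> op f (act x a) = (\<Sum>b\<in>B. act (op (co b) x) (T (\<lambda>h. f (b * h)) a))"
    and U_subspace: "P.subspace (U n)" and L_subspace: "P.subspace (L n)"
    and U_fin_span: "P.fin_span (U n)"
    and U_0: "U 0 = {0}" and L_U: "L n \<subseteq> U n" and U_L_Suc: "U n \<subseteq> L (Suc n)"
    and U_op: "H.functional f \<Longrightarrow> x \<in> U n \<Longrightarrow> op f x \<in> U n"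
    and L_op: "H.functional f \<Longrightarrow> x \<in> L n \<Longrightarrow> op f x \<in> L n"
    and U_rad: "f \<in> H.rad \<Longrightarrow> x \<in> U (Suc n) \<Longrightarrow> op f x \<in> U n"
    and L_rad: "f \<in> H.rad \<Longrightarrow> x \<in> L (Suc n) \<Longrightarrow> op f x \<in> L n"
    and U_act: "x \<in> U n \<Longrightarrow> a \<in> E (min (Suc k) c) \<Longrightarrow> act x a \<in> U (n + k)"
    and L_act: "x \<in> L n \<Longrightarrow> a \<in> E (min (Suc k) c) \<Longrightarrow> act x a \<in> L (n + k)"
    and c_pos: "0 < c" and c_cases: "c = 1 \<or> E c = UNIV"
    and U_eventually: "M \<le> n \<Longrightarrow> U n = L n"
begin

abbreviation S :: "nat \<Rightarrow> 'a set"
  where "S k \<equiv> E (min k c)"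

lemma S_1: "S (Suc 0) = E (Suc 0)"
  using c_pos by (simp add: min_def Suc_le_eq)

lemma S_mono: "j \<le> k \<Longrightarrow> S j \<subseteq> S k"
  by (intro E_mono) simp

lemma S_T: "H.functional f \<Longrightarrow> a \<in> S k \<Longrightarrow> T f a \<in> S k"
  by (rule E_T)

lemma S_rad: "f \<in> H.rad \<Longrightarrow> a \<in> S (Suc k) \<Longrightarrow> T f a \<in> S k"
proof (cases "Suc k \<le> c")
  case True
  assume "f \<in> H.rad" "a \<in> S (Suc k)"
  then have "T f a \<in> E k" using True E_rad by (simp add: min_def del: loewy.simps)
  moreover have "min k c = k" using True by simp
  ultimately show ?thesis by simp
next
  case False
  assume "f \<in> H.rad" "a \<in> S (Suc k)"
  moreover have "min (Suc k) c = min k c" using False by simp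
  ultimately show ?thesis using E_T[OF H.rad_functional] by simp
qed

lemma S_rad_converse:
  assumes a: "a \<in> S (Suc (Suc k))" and T: "\<And>f. f \<in> H.rad \<Longrightarrow> T f a \<in> S k" shows "a \<in> S (Suc k)"
proof (cases "Suc (Suc k) \<le> c")
  case True
  then have "min k c = k" "min (Suc k) c = Suc k" by simp_all
  then show ?thesis using T by simp
next
  case False
  then have "min (Suc (Suc k)) c = min (Suc k) c" by simp
  then show ?thesis using a by metis
qed

text \<open>This is where the two admissible values of \<open>c\<close> matter: \<open>E c\<close>
  is a subalgebra, and the truncated filtration remains multiplicative on it.\<close>

lemma S_mult:
  assumes "a \<in> S (Suc i)" "b \<in> S (Suc j)" shows "a * b \<in> S (Suc (i + j))"
  using c_cases
proof
  assume "c = 1"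
  then show ?thesis using E_mult[of a 0 b 0] assms by (simp del: loewy.simps)
next
  assume c: "E c = UNIV"
  show ?thesis
  proof (cases "Suc (i + j) \<le> c")
    case True
    then have "min (Suc i) c = Suc i" "min (Suc j) c = Suc j" "min (Suc (i + j)) c = Suc (i + j)" by simp_all
    then show ?thesis using E_mult assms by metis
  next
    case False
    then have "min (Suc (i + j)) c = c" by simp
    then show ?thesis using c by simp
  qed
qed

lemma op_fun_sum: "op (\<lambda>h. \<Sum>i\<in>I. f i h) x = (\<Sum>i\<in>I. op (f i) x)"
proof -
  have "op (\<lambda>h. 0) x = 0" using op_fun_scale[of 0 "\<lambda>_. 0" x] by simp
  then show ?thesis by (induction I rule: infinite_finite_induct) (simp_all add: op_fun_add)
qed

lemma op_fun_diff: "op (\<lambda>h. f h - f' h) x = op f x - op f' x"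
  using op_fun_add[of "\<lambda>h. f h - f' h" f' x] by simp

lemma act_add: "act (x + y) a = act x a + act y a" "act x (a + b) = act x a + act x b"
  and act_scale: "act (sP k x) a = sP k (act x a)" "act x (sA k a) = sP k (act x a)"
  using act_bilinear by (simp_all add: bilinear_map_def)

lemma act_0: "act 0 a = 0" "act x 0 = 0"
  using act_scale(1)[of 0 0 a] act_scale(2)[of x 0 0] by simp_all

lemma act_diff: "act (x - y) a = act x a - act y a"
  using act_add(1)[of "x - y" y a] by simp

lemma act_sum: "act x (\<Sum>i\<in>I. a i) = (\<Sum>i\<in>I. act x (a i))"
  by (induction I rule: infinite_finite_induct) (simp_all add: act_0 act_add)

text \<open>A graded Hopf submodule of the sum of the \<open>U n / L n\<close>, given by the
  preimages of its components. Functionals in \<open>rad\<close> act with degree -1, whence the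
  clause from \<open>Suc n\<close> to \<open>n\<close>.\<close>

definition family :: "(nat \<Rightarrow> 'p set) \<Rightarrow> bool"
  where "family N \<longleftrightarrow> (\<forall>n. P.subspace (N n) \<and> L n \<subseteq> N n \<and> N n \<subseteq> U n) \<and>
    (\<forall>n f x. H.functional f \<longrightarrow> x \<in> N n \<longrightarrow> op f x \<in> N n) \<and>
    (\<forall>n f x. f \<in> H.rad \<longrightarrow> x \<in> N (Suc n) \<longrightarrow> op f x \<in> N n) \<and>
    (\<forall>n k x a. x \<in> N n \<longrightarrow> a \<in> S (Suc k) \<longrightarrow> act x a \<in> N (n + k))"

lemma family_L: "family L"
  unfolding family_def using L_subspace L_U L_op L_rad L_act by blast

text \<open>A generator m is taken in the lowest degree \<open>n0\<close> where \<open>N\<close> is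
  proper, since \<open>rad\<close> sends it into \<open>N\<close> there. The multiples of m add a
  copy of the graded algebra of \<open>E c\<close> modulo \<open>N\<close>. As
  \<open>n0 < M\<close>, the bound on \<open>M'\<close> lets the sums see all degrees of this
  copy.\<close>

lemma family_extend:
  assumes N: "family N" and ne: "N \<noteq> U" and M': "M + c \<le> M'"
  obtains N' where "family N'" "(\<Sum>n<M'. P.dim (N' n)) = (\<Sum>n<M'. P.dim (N n)) + A.dim (E c)"
proof -
  have N_sub: "P.subspace (N n)" and L_N: "L n \<subseteq> N n" and N_U: "N n \<subseteq> U n" for n
    using N by (simp_all add: family_def)
  have N_op: "op f x \<in> N n" if "H.functional f" "x \<in> N n" for f x n
    using N that by (simp add: family_def)
  have N_rad: "op f x \<in> N n" if "f \<in> H.rad" "x \<in> N (Suc n)" for f x n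
    using N that by (simp add: family_def)
  have N_act: "act x a \<in> N (n + k)" if "x \<in> N n" "a \<in> S (Suc k)" for x a n k
    using N that by (simp add: family_def)
  obtain n where "N n \<noteq> U n" using ne by blast
  then obtain n0 where n0: "N n0 \<noteq> U n0" and least: "\<And>n. n < n0 \<Longrightarrow> N n = U n"
    using exists_least_iff[of "\<lambda>n. N n \<noteq> U n"] by blast
  have "N 0 = U 0" using N_U[of 0] U_0 P.subspace_0[OF N_sub, of 0] by auto
  then obtain n1 where n1: "n0 = Suc n1" using n0 by (cases n0) auto
  have Nn1: "N n1 = U n1" using least n1 by simp
  have n0M: "n0 < M"
    using n0 U_eventually[of n0] L_N[of n0] N_U[of n0] by (metis not_less subset_antisym)
  obtain m0 where m0: "m0 \<in> U n0" "m0 \<notin> N n0" using n0 N_U by blast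
  \<comment> \<open>\<open>rad\<close> lowers the degree by one, and \<open>U n1\<close> is already
    contained in \<open>L n0\<close>; so it acts as zero on \<open>U n0 / L n0\<close>, which
    therefore splits into weights.\<close>
  have rad_small: "op f x \<in> N n0" if "f \<in> H.rad" "x \<in> U n0" for f x
    using U_rad[OF that(1), of x n1] that(2) U_L_Suc[of n1] L_N[of n0] n1 by blast
  obtain e where e: "\<And>g. g \<in> H.grouplikes \<Longrightarrow> H.functional (e g)"
    "\<And>g g'. g \<in> H.grouplikes \<Longrightarrow> g' \<in> H.grouplikes \<Longrightarrow> e g g' = (if g = g' then 1 else 0)"
    using H.dual_grouplike by metis
  have "\<exists>g\<in>H.grouplikes. op (e g) m0 \<notin> N n0"
  proof (rule ccontr)
    assume "\<not> ?thesis"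
    then have "(\<Sum>g\<in>H.grouplikes. op (e g) m0) \<in> N n0" by (intro P.subspace_sum[OF N_sub]) auto
    moreover have "m0 - (\<Sum>g\<in>H.grouplikes. op (e g) m0) \<in> N n0"
      using rad_small[OF H.counit_minus_dual_rad[of e, OF e] m0(1)]
      by (simp add: op_fun_diff op_fun_sum op_counit[OF m0(1)])
    ultimately have "m0 - (\<Sum>g\<in>H.grouplikes. op (e g) m0) + (\<Sum>g\<in>H.grouplikes. op (e g) m0) \<in> N n0"
      by (rule P.subspace_add[OF N_sub, rotated])
    then show False using m0 by simp
  qed
  then obtain g where g: "g \<in> H.grouplikes" "op (e g) m0 \<notin> N n0" by blast
  define m where "m = op (e g) m0"
  have m: "m \<in> U n0" "m \<notin> N n0" using U_op[OF e(1)[OF g(1)] m0(1)] g(2) by (simp_all add: m_def)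
  have m_semi: "op f m - sP (f g) m \<in> N n0" if f: "H.functional f" for f
    using rad_small[OF H.conv_dual_rad(2)[OF f g(1) e(1)[OF g(1)] e(2)[OF g(1)]] m0(1)] f e(1)[OF g(1)]
    by (simp add: m_def op_op op_fun_diff op_fun_scale)
  have m_act: "act m a \<in> U (n0 + k)" if "a \<in> S (Suc k)" for a k
    using U_act m(1) that by blast

  \<comment> \<open>The main term treats m as if its coaction were g \<otimes> m; the sum over
    \<open>B\<close> is the error, controlled by the next two facts.\<close>
  have co_act: "op f (act m a) = act m (T (\<lambda>h. f (g * h)) a)
      + (\<Sum>b\<in>B. act (op (co b) m - sP (co b g) m) (T (\<lambda>h. f (b * h)) a))"
    if f: "H.functional f" for f a
  proof -
    have "(\<lambda>h. f (g * h)) = (\<lambda>h. \<Sum>b\<in>B. co b g * f (b * h))"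
      by (rule ext, rule H.functional_eq_sum_coord[OF basis functional_mult_right[OF f]])
    then have "act m (T (\<lambda>h. f (g * h)) a) = (\<Sum>b\<in>B. act (sP (co b g) m) (T (\<lambda>h. f (b * h)) a))"
      by (simp add: T_fun_sum T_fun_scale act_sum act_scale)
    then show ?thesis by (simp add: op_act[OF f] act_diff sum_subtractf)
  qed
  have rest: "(\<Sum>b\<in>B. act (op (co b) m - sP (co b g) m) (T (\<lambda>h. f (b * h)) a)) \<in> N (n0 + k)"
    if f: "H.functional f" and a: "a \<in> S (Suc k)" for f a k
    by (intro P.subspace_sum[OF N_sub] N_act m_semi functional_co S_T functional_mult_left f a)
  \<comment> \<open>For f in \<open>rad\<close> the error is one degree better. Either b is in kG
    and a loses a degree, or \<open>co b\<close> is in \<open>rad\<close> and sends m into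
    \<open>U n1\<close>, which equals \<open>N n1\<close> by minimality of
    \<open>n0\<close>.\<close>
  have rest_rad: "(\<Sum>b\<in>B. act (op (co b) m - sP (co b g) m) (T (\<lambda>h. f (b * h)) a)) \<in> N (n1 + k)"
    if f: "f \<in> H.rad" and a: "a \<in> S (Suc k)" for f a k
  proof (rule P.subspace_sum[OF N_sub])
    fix b assume b: "b \<in> B"
    show "act (op (co b) m - sP (co b g) m) (T (\<lambda>h. f (b * h)) a) \<in> N (n1 + k)"
      using basis_deg_0_or_rad[OF b]
    proof
      assume "b \<in> H.span H.grouplikes"
      then have t: "T (\<lambda>h. f (b * h)) a \<in> S k" using S_rad[OF H.rad_mult_span[OF f] a] by blast
      show ?thesis
      proof (cases k)
        case 0
        then show ?thesis using t P.subspace_0[OF N_sub] by (simp add: act_0)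
      next
        case (Suc k')
        then show ?thesis using N_act[OF m_semi[OF functional_co], of _ k' b] t n1 by (simp del: loewy.simps)
      qed
    next
      assume r: "co b \<in> H.rad"
      then have "op (co b) m \<in> N n1" using U_rad[OF r, of m n1] m(1) n1 Nn1 by simp
      moreover have "co b g = 0" using H.rad_grouplike[OF r g(1)] .
      moreover have "T (\<lambda>h. f (b * h)) a \<in> S (Suc k)"
        using S_T[OF functional_mult_left[OF H.rad_functional[OF f]] a] .
      ultimately show ?thesis using N_act[of "op (co b) m" n1] by simp
    qed
  qed
  obtain g' where g': "g' \<in> H.grouplikes" "g * g' = 1" "g' * g = 1"
    using H.grouplike_inverse[OF g(1)] by metis
  \<comment> \<open>Shifting f by the inverse of g beforehand cancels the shift in
    \<open>co_act\<close>, so \<open>act m (T f a)\<close> can be read off from an operator applied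
    to \<open>act m a\<close>.\<close>
  have translate: "(\<lambda>h. (\<lambda>x. f (g' * x)) (g * h)) = f" for f :: "'h \<Rightarrow> 'k"
    using g'(3) by (simp add: mult.assoc[symmetric])

  \<comment> \<open>Injectivity of multiplication by m modulo \<open>N\<close> in each degree k: the
    class of a in \<open>S (Suc k) / S k\<close> is killed only if it is zero. For k > 0 the
    functionals in \<open>rad\<close> reduce to degree k - 1.\<close>
  have kernel: "a \<in> S k" if "a \<in> S (Suc k)" "act m a \<in> N (n0 + k)" for a k
    using that
  proof (induction k arbitrary: a)
    case 0
    \<comment> \<open>The kernel in degree 0 is stable under all operators, so if nonzero it
      contains some u with a right inverse u'; then m = (m u) u' would lie in
      \<open>N n0\<close>.\<close>
    define X where "X = {a \<in> S (Suc 0). act m a \<in> N n0}"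
    have X: "X \<subseteq> E (Suc 0)" unfolding X_def S_1 by blast
    have XT: "T f a \<in> X" if f: "H.functional f" and a: "a \<in> X" for f a
    proof -
      let ?f = "\<lambda>x. f (g' * x)"
      have f': "H.functional ?f" using functional_mult_left[OF f] .
      have a': "a \<in> S (Suc 0)" "act m a \<in> N n0" using a by (auto simp: X_def)
      have "act m (T f a) = op ?f (act m a) - (\<Sum>b\<in>B. act (op (co b) m - sP (co b g) m) (T (\<lambda>h. ?f (b * h)) a))"
        using co_act[OF f', of a] translate[of f] by simp
      also have "\<dots> \<in> N n0"
        using P.subspace_diff[OF N_sub N_op[OF f' a'(2)]] rest[OF f' a'(1)] by simp
      finally show ?thesis using S_T[OF f a'(1)] by (simp add: X_def)
    qed
    have "a = 0"
    proof (rule ccontr)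
      assume "a \<noteq> 0"
      moreover have "a \<in> X" using 0 by (simp add: X_def)
      ultimately obtain u u' where u: "u \<in> X" "u' \<in> E (Suc 0)" "u * u' = 1"
        using E_1_invertible[OF X XT] by metis
      have "act (act m u) u' \<in> N (n0 + 0)" using u S_1 by (intro N_act) (auto simp: X_def)
      then show False using m by (simp add: act_act u(3) act_one[OF m(1)])
    qed
    then show ?case by simp
  next
    case (Suc k)
    show ?case
    proof (rule S_rad_converse[OF Suc.prems(1)])
      fix f assume f: "f \<in> H.rad"
      let ?f = "\<lambda>x. f (g' * x)"
      have f': "?f \<in> H.rad" using H.rad_mult_span[OF f] g'(1) H.span_base by blast
      have "act m (T f a) = op ?f (act m a) - (\<Sum>b\<in>B. act (op (co b) m - sP (co b g) m) (T (\<lambda>h. ?f (b * h)) a))"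
        using co_act[OF H.rad_functional[OF f'], of a] translate[of f] by simp
      also have "\<dots> \<in> N (n0 + k)"
      proof (rule P.subspace_diff[OF N_sub])
        show "op ?f (act m a) \<in> N (n0 + k)" using N_rad[OF f', of _ "n0 + k"] Suc.prems(2) by simp
        show "(\<Sum>b\<in>B. act (op (co b) m - sP (co b g) m) (T (\<lambda>h. ?f (b * h)) a)) \<in> N (n0 + k)"
          using rest_rad[OF f' Suc.prems(1)] n1 by simp
      qed
      finally show "T f a \<in> S k" using Suc.IH S_rad[OF f Suc.prems(1)] by blast
    qed
  qed
  have kernel_iff: "act m a \<in> N (n0 + k) \<longleftrightarrow> a \<in> S k" if "a \<in> S (Suc k)" for a k
  proof
    assume "a \<in> S k"
    show "act m a \<in> N (n0 + k)"
    proof (cases k)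
      case 0
      then show ?thesis using \<open>a \<in> S k\<close> P.subspace_0[OF N_sub] by (simp add: act_0)
    next
      case (Suc k')
      then have "act m a \<in> U (n0 + k')" using m_act \<open>a \<in> S k\<close> by blast
      then show ?thesis using U_L_Suc L_N Suc by (metis add_Suc_right subsetD)
    qed
  qed (use kernel that in blast)

  \<comment> \<open>The truncated subtraction matters: for n < n0 the index is 0 and
    \<open>S 0 = {0}\<close>, so nothing is added below degree \<open>n0\<close>.\<close>
  define N' where "N' n = {y + act m a |y a. y \<in> N n \<and> a \<in> S (Suc n - n0)}" for n
  have lin: "Vector_Spaces.linear sA sP (act m)"
    using A.vector_space_axioms P.vector_space_axioms by (simp add: linear_iff act_add act_scale)
  interpret pr: vector_space_pair sA sP ..
  interpret l: Vector_Spaces.linear sA sP "act m" by (fact lin)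
  have N'_eq: "N' n = N n" if "n < n0" for n
    using that by (simp add: N'_def l.zero)
  have N'_sub: "P.subspace (N' n)" for n
  proof -
    have "N' n = {x + y |x y. x \<in> N n \<and> y \<in> act m ` S (Suc n - n0)}" by (auto simp: N'_def)
    then show ?thesis using P.subspace_sums[OF N_sub l.subspace_image[OF E_subspace]] by simp
  qed
  have N_N': "N n \<subseteq> N' n" for n
  proof
    fix y assume "y \<in> N n"
    then have "y = y + act m 0 \<and> y \<in> N n \<and> 0 \<in> S (Suc n - n0)"
      using A.subspace_0[OF E_subspace] by (simp add: act_0)
    then show "y \<in> N' n" unfolding N'_def by blast
  qed
  have mN': "act m a \<in> N' (n0 + k)" if "a \<in> S (Suc k)" for a k
  proof -
    have "act m a = 0 + act m a \<and> 0 \<in> N (n0 + k) \<and> a \<in> S (Suc (n0 + k) - n0)"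
      using that P.subspace_0[OF N_sub] by (simp del: loewy.simps)
    then show ?thesis unfolding N'_def by blast
  qed
  have N'E: Q
    if x: "x \<in> N' n" and old: "x \<in> N n \<Longrightarrow> Q"
      and new: "\<And>y a k. x = y + act m a \<Longrightarrow> y \<in> N n \<Longrightarrow> n = n0 + k \<Longrightarrow> a \<in> S (Suc k) \<Longrightarrow> Q" for x n Q
  proof (cases "n < n0")
    case True
    then show ?thesis using x old N'_eq by blast
  next
    case False
    then have n: "Suc n - n0 = Suc (n - n0)" "n = n0 + (n - n0)" by simp_all
    obtain y a where "x = y + act m a" "y \<in> N n" "a \<in> S (Suc (n - n0))"
      using x unfolding N'_def n(1) by blast
    then show ?thesis using new n(2) by blast
  qed
  have "family N'"
    unfolding family_def
  proof (intro conjI allI impI)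
    fix n
    show "P.subspace (N' n)" by (rule N'_sub)
    show "L n \<subseteq> N' n" using L_N N_N' by blast
    show "N' n \<subseteq> U n"
    proof
      fix x assume "x \<in> N' n"
      then show "x \<in> U n"
        by (rule N'E) (use N_U m_act P.subspace_add[OF U_subspace] in blast)+
    qed
  next
    fix n f x assume f: "H.functional f" and x: "x \<in> N' n"
    interpret o: Vector_Spaces.linear sP sP "op f" by (rule op_linear[OF f])
    show "op f x \<in> N' n"
      using x
    proof (rule N'E)
      assume "x \<in> N n"
      then show ?thesis using N_op[OF f] N_N' by blast
    next
      fix y a k assume *: "x = y + act m a" "y \<in> N n" "n = n0 + k" "a \<in> S (Suc k)"
      have "op f y \<in> N' n" using N_op[OF f *(2)] N_N' by blast
      moreover have "op f (act m a) \<in> N' n"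
        unfolding co_act[OF f] *(3) using mN'[OF S_T[OF functional_mult_left[OF f] *(4)]] rest[OF f *(4)] N_N'
        by (intro P.subspace_add[OF N'_sub]) blast+
      ultimately show ?thesis unfolding *(1) o.add by (rule P.subspace_add[OF N'_sub])
    qed
  next
    fix n f x assume f: "f \<in> H.rad" and x: "x \<in> N' (Suc n)"
    interpret o: Vector_Spaces.linear sP sP "op f" by (rule op_linear[OF H.rad_functional[OF f]])
    show "op f x \<in> N' n"
      using x
    proof (rule N'E)
      assume "x \<in> N (Suc n)"
      then show ?thesis using N_rad[OF f] N_N' by blast
    next
      fix y a k assume *: "x = y + act m a" "y \<in> N (Suc n)" "Suc n = n0 + k" "a \<in> S (Suc k)"
      have n: "n = n1 + k" using *(3) n1 by simp
      have "op f y \<in> N' n" using N_rad[OF f *(2)] N_N' by blast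
      moreover have "op f (act m a) \<in> N' n"
        unfolding co_act[OF H.rad_functional[OF f]]
      proof (rule P.subspace_add[OF N'_sub])
        show "(\<Sum>b\<in>B. act (op (co b) m - sP (co b g) m) (T (\<lambda>h. f (b * h)) a)) \<in> N' n"
          using rest_rad[OF f *(4)] N_N' n by blast
        have t: "T (\<lambda>h. f (g * h)) a \<in> S k"
          using S_rad[OF H.rad_mult_span[OF f] *(4)] g(1) H.span_base by blast
        show "act m (T (\<lambda>h. f (g * h)) a) \<in> N' n"
        proof (cases k)
          case 0
          then show ?thesis using t P.subspace_0[OF N'_sub] by (simp add: act_0)
        next
          case (Suc k')
          then show ?thesis using mN'[of _ k'] t n n1 by (simp del: loewy.simps)
        qed
      qed
      ultimately show ?thesis unfolding *(1) o.add by (rule P.subspace_add[OF N'_sub])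
    qed
  next
    fix n k x a' assume x: "x \<in> N' n" and a': "a' \<in> S (Suc k)"
    show "act x a' \<in> N' (n + k)"
      using x
    proof (rule N'E)
      assume "x \<in> N n"
      then show ?thesis using N_act a' N_N' by blast
    next
      fix y a j assume *: "x = y + act m a" "y \<in> N n" "n = n0 + j" "a \<in> S (Suc j)"
      have "act y a' \<in> N' (n + k)" using N_act[OF *(2) a'] N_N' by blast
      moreover have "act m (a * a') \<in> N' (n + k)"
        using mN'[OF S_mult[OF *(4) a']] *(3) by (simp add: add.assoc)
      ultimately show ?thesis unfolding *(1) by (simp add: act_add act_act P.subspace_add[OF N'_sub])
    qed
  qed
  moreover have "(\<Sum>n<M'. P.dim (N' n)) = (\<Sum>n<M'. P.dim (N n)) + A.dim (E c)"
  proof -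
    have dimN': "P.dim (N' (n0 + k)) + A.dim (S k) = P.dim (N (n0 + k)) + A.dim (S (Suc k))" for k
    proof -
      have "N' (n0 + k) = {x + act m a |x a. x \<in> N (n0 + k) \<and> a \<in> S (Suc k)}"
        by (simp add: N'_def del: loewy.simps)
      then show ?thesis
        using pr.dim_sum_image(1)[OF lin E_subspace fin_span E_subspace S_mono[of k "Suc k"] N_sub
            P.fin_span_mono[OF U_fin_span N_U] kernel_iff]
        by simp
    qed
    \<comment> \<open>The gains dim \<open>S (Suc k)\<close> - dim \<open>S k\<close> telescope, and
      \<open>S k\<close> has reached \<open>E c\<close> at k = M' - n0 because n0 < M.\<close>
    have tele: "(\<Sum>n<n0 + k. P.dim (N' n)) + A.dim {0} = (\<Sum>n<n0 + k. P.dim (N n)) + A.dim (S k)" for k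
    proof (induction k)
      case 0
      have "(\<Sum>n<n0. P.dim (N' n)) = (\<Sum>n<n0. P.dim (N n))" by (intro sum.cong) (auto simp: N'_eq)
      then show ?case by simp
    next
      case (Suc k)
      then show ?case using dimN'[of k] by (simp del: loewy.simps)
    qed
    have "A.dim {0} = 0" using A.dim_unique[of "{}" "{0}" 0] A.independent_empty by simp
    moreover have "min (M' - n0) c = c" "n0 + (M' - n0) = M'" using n0M M' by auto
    ultimately show ?thesis using tele[of "M' - n0"] by simp
  qed
  ultimately show thesis by (rule that)
qed

lemma dim_E_pos: "0 < A.dim (E c)"
proof -
  have "E (Suc 0) \<subseteq> E c" using c_pos by (intro E_mono) simp
  then have "1 \<in> E c" using one_E by blast
  then have "{0} \<noteq> E c" by (metis singletonD zero_neq_one)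
  then show ?thesis
    using A.dim_strict_mono_fin_span[OF A.subspace_single_0 fin_span _ E_subspace] A.subspace_0[OF E_subspace]
    by (metis bot.extremum gr_zeroI insert_subset not_less_zero)
qed

text \<open>Extend the family \<open>L\<close> repeatedly until it becomes \<open>U\<close>. Every
  extension adds exactly dim \<open>E c\<close>, and the total dimension of \<open>U\<close> bounds
  the process.\<close>

theorem dim_dvd:
  assumes "M + c \<le> M'"
  shows "A.dim (E c) dvd (\<Sum>n<M'. P.dim (U n) - P.dim (L n))"
proof -
  have le: "(\<Sum>n<M'. P.dim (N n)) \<le> (\<Sum>n<M'. P.dim (U n))" if "family N" for N
    using that P.dim_mono_fin_span[OF U_fin_span] by (intro sum_mono) (simp add: family_def)
  have "A.dim (E c) dvd (\<Sum>n<M'. P.dim (U n)) - (\<Sum>n<M'. P.dim (N n))" if "family N" for N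
    using that
  proof (induction "(\<Sum>n<M'. P.dim (U n)) - (\<Sum>n<M'. P.dim (N n))" arbitrary: N rule: less_induct)
    case less
    show ?case
    proof (cases "N = U")
      case False
      obtain N' where N': "family N'" "(\<Sum>n<M'. P.dim (N' n)) = (\<Sum>n<M'. P.dim (N n)) + A.dim (E c)"
        using family_extend[OF less.prems False assms] .
      have "A.dim (E c) dvd (\<Sum>n<M'. P.dim (U n)) - (\<Sum>n<M'. P.dim (N' n))"
        using less.hyps[OF _ N'(1)] le[OF N'(1)] dim_E_pos N'(2) by simp
      then have "A.dim (E c) dvd ((\<Sum>n<M'. P.dim (U n)) - (\<Sum>n<M'. P.dim (N' n))) + A.dim (E c)"
        by (rule dvd_add) simp
      also have "((\<Sum>n<M'. P.dim (U n)) - (\<Sum>n<M'. P.dim (N' n))) + A.dim (E c)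
          = (\<Sum>n<M'. P.dim (U n)) - (\<Sum>n<M'. P.dim (N n))"
        using le[OF N'(1)] N'(2) by simp
      finally show ?thesis .
    qed simp
  qed
  from this[OF family_L] show ?thesis
    using P.dim_mono_fin_span[OF U_fin_span L_U] by (subst sum_subtractf_nat) auto
qed

end

section \<open>Dimension of the socle: divisibility and decomposition by weights\<close>

context simple_comodule_algebra
begin

text \<open>The counting theorem for gr A as a Hopf module over \<open>A_0\<close>, that is, with
  \<open>c = 1\<close>. The component \<open>E n / E (n - 1)\<close> is degree n - 1 of gr A, zero
  for n = 0, and the dimensions telescope to dim A.\<close>

lemma dim_soc_dvd: "A.dim (E (Suc 0)) dvd A.dim UNIV"
proof -
  obtain m where m: "E m = UNIV" by (rule E_exhaustive)
  have mult: "x * a \<in> E n" if "x \<in> E n" "a \<in> E (Suc 0)" for x a n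
    using that E_mult[of x "n - 1" a 0] by (cases n) (auto simp del: loewy.simps(2))
  interpret reg: filtered_hopf_module sH comult counit antipode sA coact B sA T "(*)" E "\<lambda>n. E (n - 1)" 1 "Suc m"
  proof unfold_locales
    fix n k x a f
    show "bilinear_map sA sA sA (*)"
      by (simp add: bilinear_map_def distrib_left distrib_right A.mult_scale_left A.mult_scale_right)
    show "x * a \<in> E (n + k)" if "x \<in> E n" "a \<in> E (min (Suc k) 1)"
      using mult[of x n a] that E_mono[of n "n + k"] by (simp del: loewy.simps) blast
    show "x * a \<in> E (n + k - 1)" if "x \<in> E (n - 1)" "a \<in> E (min (Suc k) 1)"
    proof -
      have "E (n - 1) \<subseteq> E (n + k - 1)" by (intro E_mono) simp
      then show ?thesis using mult[of x "n - 1" a] that by auto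
    qed
    show "T f x \<in> E (n - 1)" if "f \<in> H.rad" "x \<in> E (Suc n - 1)"
      using that E_rad[of f x "n - 1"] T_0[OF H.rad_functional[OF that(1)]] by (cases n) (auto simp del: loewy.simps(2))
    show "E n = E (n - 1)" if "Suc m \<le> n"
    proof -
      have "m \<le> n" "m \<le> n - 1" using that by simp_all
      from E_mono[OF this(1)] E_mono[OF this(2)] show ?thesis using m by blast
    qed
    show "E n \<subseteq> E (Suc n - 1)" by (simp del: loewy.simps)
    show "E (n - 1) \<subseteq> E n" by (rule E_mono) simp
  qed (use T_add T_scale T_fun_add T_fun_scale T_T T_counit T_mult[OF basis] E_subspace E_T E_rad fin_span
      in \<open>simp_all add: mult.assoc del: loewy.simps(2)\<close>)
  have "A.dim (E 1) dvd (\<Sum>n<m + 2. A.dim (E n) - A.dim (E (n - 1)))"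
    by (rule reg.dim_dvd) simp
  also have "(\<Sum>n<m + 2. A.dim (E n) - A.dim (E (n - 1))) = (\<Sum>n<Suc m. A.dim (E (Suc n)) - A.dim (E n))"
    by (subst numeral_2_eq_2, subst add_Suc_right, subst sum.lessThan_Suc_shift) (simp del: loewy.simps sum.lessThan_Suc)
  also have "\<dots> = A.dim (E (Suc m)) - A.dim (E 0)"
  proof (induction m)
    case (Suc m)
    have "A.dim (E 0) \<le> A.dim (E (Suc m))" "A.dim (E (Suc m)) \<le> A.dim (E (Suc (Suc m)))"
      by (intro A.dim_mono_fin_span[OF fin_span] E_mono; simp)+
    then show ?case using Suc by (simp del: loewy.simps)
  qed (simp del: loewy.simps)
  also have "A.dim (E 0) = 0" using A.dim_unique[of "{}" "{0}" 0] A.independent_empty by simp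
  also have "E (Suc m) = UNIV" using E_Suc[of m] m by auto
  finally show ?thesis by (simp del: loewy.simps)
qed

text \<open>The sum of the isotypic components is direct, since \<open>T (e g)\<close> is the
  identity on the one of weight g and zero on the others.\<close>

lemma dim_E_1: "A.dim (E (Suc 0)) = (\<Sum>g\<in>H.grouplikes. A.dim (isotypic g))"
proof -
  obtain e where e: "\<And>g. g \<in> H.grouplikes \<Longrightarrow> H.functional (e g)"
    "\<And>g g'. g \<in> H.grouplikes \<Longrightarrow> g' \<in> H.grouplikes \<Longrightarrow> e g g' = (if g = g' then 1 else 0)"
    using H.dual_grouplike by metis
  interpret pr: vector_space_pair sA sA ..
  have dim0: "A.dim {0} = 0" using A.dim_unique[of "{}" "{0}" 0] A.independent_empty by simp
  have dims: "A.dim (A.span (\<Union>g\<in>\<Gamma>. isotypic g)) = (\<Sum>g\<in>\<Gamma>. A.dim (isotypic g))"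
    if "finite \<Gamma>" "\<Gamma> \<subseteq> H.grouplikes" for \<Gamma>
    using that
  proof (induction \<Gamma> rule: finite_induct)
    case empty
    then show ?case using dim0 by simp
  next
    case (insert g \<Gamma>)
    have g: "g \<in> H.grouplikes" "\<Gamma> \<subseteq> H.grouplikes" using insert.prems by auto
    interpret l: Vector_Spaces.linear sA sA "T (e g)" by (rule T_linear[OF e(1)[OF g(1)]])
    let ?X = "A.span (\<Union>g\<in>\<Gamma>. isotypic g)"
    have X0: "T (e g) x = 0" if "x \<in> ?X" for x
    proof (rule l.eq_0_on_span[OF _ that])
      fix y assume "y \<in> (\<Union>g\<in>\<Gamma>. isotypic g)"
      then obtain g' where "g' \<in> \<Gamma>" "y \<in> isotypic g'" by blast
      moreover from this have "e g g' = 0" using e(2)[OF g(1), of g'] g(2) insert.hyps by auto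
      ultimately show "T (e g) y = 0" using isotypic_T e(1)[OF g(1)] by simp
    qed
    have iff: "a \<in> ?X \<longleftrightarrow> a \<in> {0}" if "a \<in> isotypic g" for a
      using X0[of a] isotypic_T[OF that e(1)[OF g(1)]] e(2)[OF g(1) g(1)] A.span_zero by auto
    have lin: "Vector_Spaces.linear sA sA (\<lambda>x. x)"
      using A.vector_space_axioms by (simp add: linear_iff)
    have "A.span (\<Union>g\<in>insert g \<Gamma>. isotypic g) = {x + a |x a. x \<in> ?X \<and> a \<in> isotypic g}"
      using A.span_Un[of "\<Union>g\<in>\<Gamma>. isotypic g" "isotypic g"] A.span_eq_iff[THEN iffD2, OF isotypic_subspace]
      by (simp add: Un_commute)
    moreover have "A.dim {x + a |x a. x \<in> ?X \<and> a \<in> isotypic g} + A.dim {0} = A.dim ?X + A.dim (isotypic g)"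
      using pr.dim_sum_image(1)[OF lin isotypic_subspace fin_span A.subspace_single_0 _ A.subspace_span fin_span iff]
        A.subspace_0[OF isotypic_subspace] by blast
    ultimately show ?case using insert.IH g(2) insert.hyps dim0 by simp
  qed
  have "A.span (\<Union>g\<in>H.grouplikes. isotypic g) = E (Suc 0)"
  proof (rule subset_antisym)
    show "A.span (\<Union>g\<in>H.grouplikes. isotypic g) \<subseteq> E (Suc 0)"
      using isotypic_E by (intro A.span_minimal[OF _ E_subspace]) blast
    show "E (Suc 0) \<subseteq> A.span (\<Union>g\<in>H.grouplikes. isotypic g)"
    proof
      fix x assume x: "x \<in> E (Suc 0)"
      have "(\<Sum>g\<in>H.grouplikes. T (e g) x) \<in> A.span (\<Union>g\<in>H.grouplikes. isotypic g)"
        using E_1_T_dual[OF _ e(1) e(2) x] by (intro A.span_sum A.span_base) blast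
      then show "x \<in> A.span (\<Union>g\<in>H.grouplikes. isotypic g)"
        using E_1_decomposition[of e, OF e x] by simp
    qed
  qed
  then show ?thesis using dims[OF H.finite_grouplikes order_refl] by simp
qed

end

section \<open>The tensor product as a filtered Hopf module\<close>

context adapted_comodule_algebra
begin

interpretation reg: adapted_comodule_algebra sH comult counit antipode sH comult B
  by (rule H.adapted_regular[OF adapted])

lemma F_mult: "x \<in> H.F i \<Longrightarrow> y \<in> H.F (Suc j) \<Longrightarrow> x * y \<in> H.F (i + j)"
  using reg.E_mult[of x "i - 1" y j] H.subspace_0[OF H.F_subspace]
  by (cases i) (auto simp del: loewy.simps(2))

lemma left_op_semi: "b \<in> B \<Longrightarrow> H.functional f \<Longrightarrow> H.left_op f b \<in> H.semi (H.deg b) (H.wt b)"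
proof -
  assume b: "b \<in> B" and f: "H.functional f"
  have "H.right_op f' (H.left_op f b) - sH (f' (H.wt b)) (H.left_op f b) \<in> H.F (H.deg b)"
    if f': "H.functional f'" for f'
    using H.F_left_op[OF f basis_semi[OF b f']]
    by (simp add: H.left_op_diff[OF f] H.left_op_scale[OF f] H.left_right[OF f f'])
  then show ?thesis using H.F_left_op[OF f basis_F[OF b]] by (simp add: H.semi_def del: loewy.simps)
qed

lemma left_op_rad_semi:
  assumes b: "b \<in> B" and f: "f \<in> H.rad" and d: "H.deg b = Suc d"
  shows "H.left_op f b \<in> H.semi d (H.wt b)"
proof -
  have f': "H.functional f" using H.rad_functional[OF f] .
  have "H.right_op p (H.left_op f b) - sH (p (H.wt b)) (H.left_op f b) \<in> H.F d"
    if p: "H.functional p" for p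
    using H.F_rad[OF f basis_semi[OF b p, unfolded d]]
    by (simp add: H.left_op_diff[OF f'] H.left_op_scale[OF f'] H.left_right[OF f' p])
  then show ?thesis using H.F_rad[OF f basis_F[OF b]] d by (simp add: H.semi_def del: loewy.simps)
qed

text \<open>Left operators commute with right ones. They therefore do not raise the degree of a
  basis element, and in its own degree they keep its right weight.\<close>

lemma co_left_op:
  assumes b: "b \<in> B" and c: "c \<in> B" and f: "H.functional f" and ne: "co c (H.left_op f b) \<noteq> 0"
  shows "H.deg c \<le> H.deg b" "H.deg c = H.deg b \<Longrightarrow> H.wt c = H.wt b"
proof -
  show "H.deg c \<le> H.deg b"
    using co_F[OF H.F_left_op[OF f basis_F[OF b]] _ c] ne by (meson not_less_eq_eq)
  show "H.wt c = H.wt b" if "H.deg c = H.deg b"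
    using wt_eqI[OF c _ ne, of "H.wt b"] left_op_semi[OF b f] that by simp
qed

lemma co_left_op_rad:
  assumes b: "b \<in> B" and c: "c \<in> B" and f: "f \<in> H.rad" and ne: "co c (H.left_op f b) \<noteq> 0"
  shows "H.deg c < H.deg b" "Suc (H.deg c) = H.deg b \<Longrightarrow> H.wt c = H.wt b"
proof -
  show "H.deg c < H.deg b"
    using co_F[OF H.F_rad[OF f basis_F[OF b]] _ c] ne by (meson not_less)
  show "H.wt c = H.wt b" if "Suc (H.deg c) = H.deg b"
    using wt_eqI[OF c _ ne, of "H.wt b"] left_op_rad_semi[OF b f that[symmetric]] by simp
qed

text \<open>A function \<open>x\<close> on the basis \<open>B\<close> of \<open>H\<close> encodes the tensor \<open>\<Sum>b\<in>B. b \<otimes> x b\<close> of \<open>H \<otimes> A\<close>;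
  \<open>tensor_op\<close> comes from the coaction on the factor \<open>H\<close> and \<open>tensor_act\<close> is the diagonal action of \<open>A\<close>.\<close>

definition tensor_op :: "('h \<Rightarrow> 'k) \<Rightarrow> ('h \<Rightarrow> 'a) \<Rightarrow> 'h \<Rightarrow> 'a"
  where "tensor_op f x = (\<lambda>c. if c \<in> B then \<Sum>b\<in>B. sA (co c (H.left_op f b)) (x b) else 0)"

definition tensor_act :: "('h \<Rightarrow> 'a) \<Rightarrow> 'a \<Rightarrow> 'h \<Rightarrow> 'a"
  where "tensor_act x a = (\<lambda>c. if c \<in> B then \<Sum>b\<in>B. x b * T (\<lambda>h. co c (b * h)) a else 0)"

abbreviation sP :: "'k \<Rightarrow> ('h \<Rightarrow> 'a) \<Rightarrow> 'h \<Rightarrow> 'a"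
  where "sP \<equiv> \<lambda>r x b. sA r (x b)"

lemma functional_co_mult: "H.functional (\<lambda>h. co c (b * h))"
  using functional_mult_left[OF functional_co] .

lemma functional_co_left_op: "H.functional f \<Longrightarrow> H.functional (\<lambda>h. co c (H.left_op f h))"
  using functional_co by (intro H.functionalI)
    (simp_all add: H.left_op_add H.left_op_scale H.functional_add[OF functional_co] H.functional_scale[OF functional_co])

lemma tensor_op_add: "tensor_op f (x + y) = tensor_op f x + tensor_op f y"
  and tensor_op_scale: "tensor_op f (sP r x) = sP r (tensor_op f x)"
  by (auto simp: tensor_op_def fun_eq_iff A.scale_right_distrib sum.distrib A.scale_sum_right mult.commute)

lemma tensor_op_fun_add: "tensor_op (\<lambda>h. f h + f' h) x = tensor_op f x + tensor_op f' x"
  by (auto simp: tensor_op_def fun_eq_iff reg.T_fun_add H.functional_add[OF functional_co] A.scale_left_distrib sum.distrib)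

lemma tensor_op_fun_scale: "tensor_op (\<lambda>h. r * f h) x = sP r (tensor_op f x)"
  by (auto simp: tensor_op_def fun_eq_iff reg.T_fun_scale H.functional_scale[OF functional_co] A.scale_sum_right)

lemma tensor_op_op:
  assumes "H.functional f" "H.functional f'"
  shows "tensor_op f (tensor_op f' x) = tensor_op (H.conv f' f) x"
proof
  fix c
  have "(\<Sum>b\<in>B. sA (co c (H.left_op f b)) (\<Sum>b'\<in>B. sA (co b (H.left_op f' b')) (x b')))
      = (\<Sum>b\<in>B. \<Sum>b'\<in>B. sA (co b (H.left_op f' b') * co c (H.left_op f b)) (x b'))"
    by (simp add: A.scale_sum_right mult.commute)
  also have "\<dots> = (\<Sum>b'\<in>B. sA (\<Sum>b\<in>B. co b (H.left_op f' b') * co c (H.left_op f b)) (x b'))"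
    by (subst sum.swap) (simp add: A.scale_sum_left)
  also have "\<dots> = (\<Sum>b'\<in>B. sA (co c (H.left_op f (H.left_op f' b'))) (x b'))"
    by (simp only: H.functional_eq_sum_coord[OF basis functional_co_left_op[OF assms(1)], symmetric])
  finally show "tensor_op f (tensor_op f' x) c = tensor_op (H.conv f' f) x c"
    using assms by (simp add: tensor_op_def H.left_left)
qed

lemma tensor_op_counit: "(\<And>b. b \<notin> B \<Longrightarrow> x b = 0) \<Longrightarrow> tensor_op counit x = x"
proof
  fix c assume x: "\<And>b. b \<notin> B \<Longrightarrow> x b = 0"
  have "(\<Sum>b\<in>B. sA (co c b) (x b)) = x c" if "c \<in> B"
  proof -
    have "(\<Sum>b\<in>B. sA (co c b) (x b)) = (\<Sum>b\<in>B. if b = c then x b else 0)"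
      using that by (intro sum.cong) (auto simp: co_basis)
    then show ?thesis using basis(1) that by simp
  qed
  then show "tensor_op counit x c = x c" using x by (simp add: tensor_op_def H.left_op_counit)
qed

lemma tensor_act_bilinear: "bilinear_map sP sA sP tensor_act"
proof -
  have "T (\<lambda>h. co c (b * h)) (a + a') = T (\<lambda>h. co c (b * h)) a + T (\<lambda>h. co c (b * h)) a'"
    "T (\<lambda>h. co c (b * h)) (sA r a) = sA r (T (\<lambda>h. co c (b * h)) a)" for b c a a' r
    using T_add[OF functional_co_mult] T_scale[OF functional_co_mult] by blast+
  then show ?thesis
    by (auto simp: bilinear_map_def tensor_act_def fun_eq_iff distrib_left distrib_right sum.distrib
        A.mult_scale_left A.mult_scale_right A.scale_sum_right)
qed

lemma tensor_act_act: "tensor_act (tensor_act x a) a' = tensor_act x (a * a')"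
proof
  fix c
  have T: "(\<Sum>b\<in>B. T (\<lambda>h. co b (b' * h)) a * T (\<lambda>h. co c (b * h)) a') = T (\<lambda>h. co c (b' * h)) (a * a')" for b'
  proof -
    have eq: "(\<lambda>g h. co c (b' * (g * h))) = (\<lambda>g h. \<Sum>b\<in>B. co b (b' * g) * co c (b * h))"
    proof (intro ext)
      fix g h
      have "co c ((b' * g) * h) = (\<Sum>b\<in>B. co b (b' * g) * co c (b * h))"
        by (rule H.functional_eq_sum_coord[OF basis functional_mult_right[OF functional_co]])
      then show "co c (b' * (g * h)) = (\<Sum>b\<in>B. co b (b' * g) * co c (b * h))"
        by (simp only: mult.assoc)
    qed
    show ?thesis unfolding T2_mult[OF functional_co_mult] eq by (simp only: T2_sum T2_prod)
  qed
  have "(\<Sum>b\<in>B. (\<Sum>b'\<in>B. x b' * T (\<lambda>h. co b (b' * h)) a) * T (\<lambda>h. co c (b * h)) a')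
      = (\<Sum>b'\<in>B. x b' * (\<Sum>b\<in>B. T (\<lambda>h. co b (b' * h)) a * T (\<lambda>h. co c (b * h)) a'))"
    by (simp add: sum_distrib_left sum_distrib_right mult.assoc) (rule sum.swap)
  then show "tensor_act (tensor_act x a) a' c = tensor_act x (a * a') c"
    by (simp add: tensor_act_def T)
qed

lemma tensor_act_one: "(\<And>b. b \<notin> B \<Longrightarrow> x b = 0) \<Longrightarrow> tensor_act x 1 = x"
proof
  fix c assume x: "\<And>b. b \<notin> B \<Longrightarrow> x b = 0"
  have "(\<Sum>b\<in>B. x b * T (\<lambda>h. co c (b * h)) 1) = x c" if "c \<in> B"
  proof -
    have "(\<Sum>b\<in>B. x b * T (\<lambda>h. co c (b * h)) 1) = (\<Sum>b\<in>B. if b = c then x b else 0)"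
      using that by (intro sum.cong)
        (auto simp: T_one[OF functional_co_mult] co_basis A.mult_scale_right)
    then show ?thesis using basis(1) that by simp
  qed
  then show "tensor_act x 1 c = x c" using x by (simp add: tensor_act_def)
qed

text \<open>Compatibility of coaction and diagonal action. \<open>key\<close> is the product rule
  for \<open>left_op\<close> in H read in coordinates; it turns both sides into the same triple
  sum.\<close>

lemma tensor_op_act:
  assumes f: "H.functional f"
  shows "tensor_op f (tensor_act x a) = (\<Sum>e\<in>B. tensor_act (tensor_op (co e) x) (T (\<lambda>h. f (e * h)) a))"
proof
  fix c
  have fe: "H.functional (\<lambda>h. f (e * h))" for e using functional_mult_left[OF f] .
  have key: "co c (H.left_op f (b' * h)) = (\<Sum>e\<in>B. \<Sum>b\<in>B. co b (H.left_op (co e) b') * H.conv (\<lambda>h. f (e * h)) (\<lambda>h. co c (b * h)) h)" for b' h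
  proof -
    have "co c (H.left_op f (b' * h)) = (\<Sum>e\<in>B. co c (H.left_op (co e) b' * H.left_op (\<lambda>h. f (e * h)) h))"
      by (simp add: H.left_op_mult[OF basis f] H.functional_sum[OF functional_co])
    also have "\<dots> = (\<Sum>e\<in>B. \<Sum>b\<in>B. co b (H.left_op (co e) b') * co c (b * H.left_op (\<lambda>h. f (e * h)) h))"
      by (intro sum.cong refl H.functional_eq_sum_coord[OF basis functional_mult_right[OF functional_co]])
    finally show ?thesis
      using H.functional_left_op[OF functional_co_mult] by simp
  qed
  show "tensor_op f (tensor_act x a) c = (\<Sum>e\<in>B. tensor_act (tensor_op (co e) x) (T (\<lambda>h. f (e * h)) a)) c"
  proof (cases "c \<in> B")
    case True
    have sum_app: "(\<Sum>e\<in>I. p e) c = (\<Sum>e\<in>I. p e c)" for I :: "'h set" and p :: "'h \<Rightarrow> 'h \<Rightarrow> 'a"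
      by (induction I rule: infinite_finite_induct) auto
    have "tensor_op f (tensor_act x a) c = (\<Sum>b\<in>B. \<Sum>b'\<in>B. x b' * T (\<lambda>h. co b (b' * h) * co c (H.left_op f b)) a)"
    proof -
      have "T (\<lambda>h. p h * r) a = sA r (T p a)" for p r
        using T_fun_scale[of r p a] by (simp add: mult.commute)
      then show ?thesis using True by (simp add: tensor_op_def tensor_act_def A.scale_sum_right A.mult_scale_right)
    qed
    also have "\<dots> = (\<Sum>b'\<in>B. x b' * T (\<lambda>h. \<Sum>b\<in>B. co b (b' * h) * co c (H.left_op f b)) a)"
      by (subst sum.swap) (simp add: T_fun_sum sum_distrib_left)
    also have "\<dots> = (\<Sum>b'\<in>B. x b' * T (\<lambda>h. co c (H.left_op f (b' * h))) a)"
      by (simp only: H.functional_eq_sum_coord[OF basis functional_co_left_op[OF f], symmetric])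
    also have "\<dots> = (\<Sum>b'\<in>B. \<Sum>e\<in>B. \<Sum>b\<in>B. sA (co b (H.left_op (co e) b')) (x b' * T (H.conv (\<lambda>h. f (e * h)) (\<lambda>h. co c (b * h))) a))"
      unfolding key by (simp add: T_fun_sum T_fun_scale sum_distrib_left A.mult_scale_right)
    also have "\<dots> = (\<Sum>e\<in>B. \<Sum>b\<in>B. \<Sum>b'\<in>B. sA (co b (H.left_op (co e) b')) (x b' * T (H.conv (\<lambda>h. f (e * h)) (\<lambda>h. co c (b * h))) a))"
      by (subst sum.swap) (intro sum.cong refl sum.swap)
    also have "\<dots> = (\<Sum>e\<in>B. tensor_act (tensor_op (co e) x) (T (\<lambda>h. f (e * h)) a) c)"
      using True by (intro sum.cong refl)
        (simp add: tensor_act_def tensor_op_def T_T[OF functional_co_mult fe] sum_distrib_right A.mult_scale_left)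
    finally show ?thesis by (simp add: sum_app)
  next
    case False
    have "(\<Sum>e\<in>I. tensor_act (tensor_op (co e) x) (T (\<lambda>h. f (e * h)) a)) c = 0" for I
      using False by (induction I rule: infinite_finite_induct) (auto simp: tensor_act_def)
    then show ?thesis using False by (simp add: tensor_op_def)
  qed
qed

text \<open>With \<open>U n = fun_box B (Ub n)\<close>, \<open>L n = fun_box B (Lb n)\<close> and \<open>H_n\<close>, \<open>A_n\<close> the Loewy filtrations,
  \<open>L (Suc n)\<close> is the sum of the \<open>H_i \<otimes> A_(n - i)\<close> with \<open>i < n\<close>, and \<open>U (Suc n) / L (Suc n)\<close> is the
  cotensor product of \<open>H_n / H_(n - 1)\<close> and \<open>A_0\<close> over the coradical.\<close>

definition Ub :: "nat \<Rightarrow> 'h \<Rightarrow> 'a set"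
  where "Ub n b = (if Suc (H.deg b) < n then E (n - H.deg b)
    else if Suc (H.deg b) = n then isotypic (H.wt b) else {0})"

definition Lb :: "nat \<Rightarrow> 'h \<Rightarrow> 'a set"
  where "Lb n b = (if Suc (H.deg b) < n then E (n - H.deg b) else {0})"

lemma Ub_E: assumes "b \<in> B" shows "Ub n b \<subseteq> E (n - H.deg b)"
  using isotypic_E[OF wt_grouplike[OF assms]] A.subspace_0[OF E_subspace]
  by (auto simp: Ub_def simp del: loewy.simps)

lemma Lb_Ub: "Lb n b \<subseteq> Ub n b"
  using A.subspace_0[OF isotypic_subspace] by (auto simp: Ub_def Lb_def)

lemma Ub_subspace: "A.subspace (Ub n b)" and Lb_subspace: "A.subspace (Lb n b)"
  using E_subspace isotypic_subspace by (simp_all add: Ub_def Lb_def)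

text \<open>Lets the degree estimates below assume that the term in question is nonzero, which
  bounds the degrees of the basis elements involved.\<close>

lemma sum_mem_if_nonzero:
  assumes "A.subspace V" "\<And>b. b \<in> I \<Longrightarrow> y b \<noteq> 0 \<Longrightarrow> y b \<in> V" shows "(\<Sum>b\<in>I. y b) \<in> V"
  using assms A.subspace_0[OF assms(1)] by (intro A.subspace_sum) metis+

text \<open>A contribution from b to c of the same degree keeps the weight, so the condition on the
  coefficient is unchanged. If c has smaller degree, the coefficient only has to lie in the larger
  space \<open>E (n - deg c)\<close>.\<close>

lemma tensor_op_Ub:
  assumes f: "H.functional f" and x: "x \<in> fun_box B (Ub n)" shows "tensor_op f x \<in> fun_box B (Ub n)"
proof -
  have "(\<Sum>b\<in>B. sA (co c (H.left_op f b)) (x b)) \<in> Ub n c" if c: "c \<in> B" for c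
  proof (rule sum_mem_if_nonzero[OF Ub_subspace])
    fix b assume b: "b \<in> B" and ne: "sA (co c (H.left_op f b)) (x b) \<noteq> 0"
    have xb: "x b \<in> Ub n b" using x b by (simp add: fun_box_mem)
    have "co c (H.left_op f b) \<noteq> 0" "x b \<noteq> 0" using ne by auto
    note d = co_left_op[OF b c f this(1)]
    have n: "Suc (H.deg b) \<le> n" using xb \<open>x b \<noteq> 0\<close> by (auto simp: Ub_def split: if_splits)
    have "x b \<in> Ub n c"
    proof (cases "H.deg c = H.deg b")
      case True
      then show ?thesis using xb d(2) by (auto simp: Ub_def simp del: loewy.simps split: if_splits)
    next
      case False
      have "E (n - H.deg b) \<subseteq> E (n - H.deg c)" using d(1) by (intro E_mono) simp
      then have "x b \<in> E (n - H.deg c)" using Ub_E[OF b] xb by blast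
      then show ?thesis using False d(1) n by (simp add: Ub_def)
    qed
    then show "sA (co c (H.left_op f b)) (x b) \<in> Ub n c" by (rule A.subspace_scale[OF Ub_subspace])
  qed
  then show ?thesis by (simp add: fun_box_mem tensor_op_def)
qed

lemma tensor_op_Lb:
  assumes f: "H.functional f" and x: "x \<in> fun_box B (Lb n)" shows "tensor_op f x \<in> fun_box B (Lb n)"
proof -
  have "(\<Sum>b\<in>B. sA (co c (H.left_op f b)) (x b)) \<in> Lb n c" if c: "c \<in> B" for c
  proof (rule sum_mem_if_nonzero[OF Lb_subspace])
    fix b assume b: "b \<in> B" and ne: "sA (co c (H.left_op f b)) (x b) \<noteq> 0"
    have xb: "x b \<in> Lb n b" using x b by (simp add: fun_box_mem)
    have "co c (H.left_op f b) \<noteq> 0" "x b \<noteq> 0" using ne by auto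
    note d = co_left_op(1)[OF b c f this(1)]
    have n: "Suc (H.deg b) < n" "x b \<in> E (n - H.deg b)"
      using xb \<open>x b \<noteq> 0\<close> by (auto simp: Lb_def split: if_splits)
    have "E (n - H.deg b) \<subseteq> E (n - H.deg c)" using d by (intro E_mono) simp
    then have "x b \<in> E (n - H.deg c)" using n by blast
    then have "x b \<in> Lb n c" using d n by (simp add: Lb_def)
    then show "sA (co c (H.left_op f b)) (x b) \<in> Lb n c" by (rule A.subspace_scale[OF Lb_subspace])
  qed
  then show ?thesis by (simp add: fun_box_mem tensor_op_def)
qed

lemma tensor_op_rad_Ub:
  assumes f: "f \<in> H.rad" and x: "x \<in> fun_box B (Ub (Suc n))" shows "tensor_op f x \<in> fun_box B (Ub n)"
proof -
  have "(\<Sum>b\<in>B. sA (co c (H.left_op f b)) (x b)) \<in> Ub n c" if c: "c \<in> B" for c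
  proof (rule sum_mem_if_nonzero[OF Ub_subspace])
    fix b assume b: "b \<in> B" and ne: "sA (co c (H.left_op f b)) (x b) \<noteq> 0"
    have xb: "x b \<in> Ub (Suc n) b" using x b by (simp add: fun_box_mem)
    have "co c (H.left_op f b) \<noteq> 0" "x b \<noteq> 0" using ne by auto
    note d = co_left_op_rad[OF b c f this(1)]
    have n: "H.deg b \<le> n" using xb \<open>x b \<noteq> 0\<close> by (auto simp: Ub_def split: if_splits)
    have "x b \<in> Ub n c"
    proof (cases "Suc (H.deg c) = H.deg b")
      case True
      then show ?thesis using xb d(2) n by (auto simp: Ub_def Suc_diff_Suc[symmetric] simp del: loewy.simps split: if_splits)
    next
      case False
      have "E (Suc n - H.deg b) \<subseteq> E (n - H.deg c)" using d(1) by (intro E_mono) simp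
      then have "x b \<in> E (n - H.deg c)" using Ub_E[OF b] xb by blast
      then show ?thesis using False d(1) n by (simp add: Ub_def)
    qed
    then show "sA (co c (H.left_op f b)) (x b) \<in> Ub n c" by (rule A.subspace_scale[OF Ub_subspace])
  qed
  then show ?thesis by (simp add: fun_box_mem tensor_op_def)
qed

lemma tensor_op_rad_Lb:
  assumes f: "f \<in> H.rad" and x: "x \<in> fun_box B (Lb (Suc n))" shows "tensor_op f x \<in> fun_box B (Lb n)"
proof -
  have "(\<Sum>b\<in>B. sA (co c (H.left_op f b)) (x b)) \<in> Lb n c" if c: "c \<in> B" for c
  proof (rule sum_mem_if_nonzero[OF Lb_subspace])
    fix b assume b: "b \<in> B" and ne: "sA (co c (H.left_op f b)) (x b) \<noteq> 0"
    have xb: "x b \<in> Lb (Suc n) b" using x b by (simp add: fun_box_mem)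
    have "co c (H.left_op f b) \<noteq> 0" "x b \<noteq> 0" using ne by auto
    note d = co_left_op_rad(1)[OF b c f this(1)]
    have n: "H.deg b < n" "x b \<in> E (Suc n - H.deg b)"
      using xb \<open>x b \<noteq> 0\<close> by (auto simp: Lb_def simp del: loewy.simps split: if_splits)
    have "E (Suc n - H.deg b) \<subseteq> E (n - H.deg c)" using d by (intro E_mono) simp
    then have "x b \<in> E (n - H.deg c)" using n by blast
    then have "x b \<in> Lb n c" using d n by (simp add: Lb_def)
    then show "sA (co c (H.left_op f b)) (x b) \<in> Lb n c" by (rule A.subspace_scale[OF Lb_subspace])
  qed
  then show ?thesis by (simp add: fun_box_mem tensor_op_def)
qed

lemma isotypic_mult: "x \<in> isotypic g \<Longrightarrow> y \<in> isotypic h \<Longrightarrow> x * y \<in> isotypic (g * h)"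
  unfolding isotypic_def[of "g * h"]
  by (auto simp only: T_isotypic_mult isotypic_T functional_mult_left A.mult_scale_right)

text \<open>The functional \<open>co c (b * h)\<close> of h vanishes on
  \<open>F (deg c - deg b)\<close>, since b times that space lies in \<open>F (deg c)\<close>, where
  \<open>co c\<close> is zero.\<close>

lemma T_co_mult_E:
  assumes b: "b \<in> B" and c: "c \<in> B" and a: "a \<in> E (Suc k)"
  shows "T (\<lambda>h. co c (b * h)) a \<in> E (Suc k - (H.deg c - H.deg b))"
proof (rule T_lowers_degree[OF functional_co_mult _ a])
  fix h assume h: "h \<in> H.F (H.deg c - H.deg b)"
  show "co c (b * h) = 0"
  proof (cases "H.deg c - H.deg b")
    case 0
    then show ?thesis using h by (simp add: H.functional_0[OF functional_co])
  next
    case (Suc i)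
    then have "b * h \<in> H.F (Suc (H.deg b) + i)" using F_mult[OF basis_F[OF b]] h by simp
    moreover have "Suc (H.deg b) + i = H.deg c" using Suc by simp
    ultimately have "b * h \<in> H.F (H.deg c)" by metis
    then show ?thesis using co_F[OF _ order_refl c] by blast
  qed
qed

text \<open>Weights multiply in gr H: if b and c differ by the full degree k, only the part of
  weight \<open>g' * wt c\<close> in the H-factor of a can carry b to c, where g' is the inverse of
  \<open>wt b\<close>.\<close>

lemma T_co_mult_isotypic:
  assumes b: "b \<in> B" and c: "c \<in> B" and a: "a \<in> E (Suc k)" and d: "H.deg c = H.deg b + k"
    and g': "H.wt b * g' = 1" "g' * H.wt b = 1"
  shows "T (\<lambda>h. co c (b * h)) a \<in> isotypic (g' * H.wt c)"
  unfolding isotypic_def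
proof (intro CollectI allI impI)
  fix f assume f: "H.functional f"
  let ?q = "\<lambda>h. co c (b * h)" and ?p = "\<lambda>h. f (g' * h)"
  have p: "H.functional ?p" using functional_mult_left[OF f] .
  have q: "H.functional ?q" by (rule functional_co_mult)
  \<comment> \<open>A functional that vanishes on \<open>F (Suc k)\<close> sends a to
    \<open>E 0 = {0}\<close>, so this identity is exactly the isotypic condition on
    \<open>T ?q a\<close>.\<close>
  have "H.conv ?q f h - f (g' * H.wt c) * ?q h = 0" if h: "h \<in> H.F (Suc k)" for h
  proof -
    have "(\<lambda>h. ?p (H.wt b * h)) = (\<lambda>h. \<Sum>e\<in>B. co e (H.wt b) * ?p (e * h))"
      by (rule ext, rule H.functional_eq_sum_coord[OF basis functional_mult_right[OF p]])
    moreover have "(\<lambda>h. ?p (H.wt b * h)) = f"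
      using g'(2) by (simp add: mult.assoc[symmetric])
    ultimately have fe: "f = (\<lambda>h. \<Sum>e\<in>B. co e (H.wt b) * ?p (e * h))" by metis
    have Rf: "b * H.right_op f h = (\<Sum>e\<in>B. sH (co e (H.wt b)) b * H.right_op (\<lambda>h. ?p (e * h)) h)"
      by (subst fe) (simp add: H.right_op_fun_sum H.right_op_fun_scale sum_distrib_left H.mult_scale_left H.mult_scale_right)
    \<comment> \<open>Replacing b by its weight in the product rule for \<open>b * h\<close> leaves
      an error in \<open>F (deg b + k)\<close>, which is \<open>F (deg c)\<close> and hence
      invisible to \<open>co c\<close>.\<close>
    have "H.right_op ?p (b * h) - b * H.right_op f h
        = (\<Sum>e\<in>B. (H.right_op (co e) b - sH (co e (H.wt b)) b) * H.right_op (\<lambda>h. ?p (e * h)) h)"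
      unfolding Rf by (simp add: H.right_op_mult[OF basis p] sum_subtractf left_diff_distrib)
    also have "\<dots> \<in> H.F (H.deg b + k)"
      by (intro H.subspace_sum[OF H.F_subspace] F_mult basis_semi[OF b functional_co]
          H.F_right_op[OF functional_mult_left[OF p] h])
    finally have "co c (H.right_op ?p (b * h) - b * H.right_op f h) = 0"
      using co_F[OF _ order_refl c] d by simp
    then have "co c (b * H.right_op f h) = co c (H.right_op ?p (b * h))"
      by (simp add: H.functional_diff[OF functional_co])
    moreover have "b * h \<in> H.F (Suc (H.deg c))" using F_mult[OF basis_F[OF b] h] d by simp
    ultimately have "co c (b * H.right_op f h) = f (g' * H.wt c) * ?q h"
      using co_right_op[OF c p] by simp
    then show ?thesis using H.functional_right_op[OF q, of f h] by simp
  qed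
  then have "T (\<lambda>h. H.conv ?q f h - f (g' * H.wt c) * ?q h) a \<in> E (Suc k - Suc k)"
    by (intro T_lowers_degree[OF _ _ a] H.functional_lin H.functional_conv q f) auto
  then show "T f (T ?q a) = sA (f (g' * H.wt c)) (T ?q a)"
    by (simp add: T_T[OF f q] T_fun_diff T_fun_scale)
qed

text \<open>Nonzero factors lie in some \<open>E (Suc i)\<close> and \<open>E (Suc j)\<close> with
  \<open>Suc (i + j)\<close> at most \<open>n + k - deg c\<close>. In the top case this forces i = j
  = 0, so a top term of the product arises only from a top term of x, and both factors are isotypic.
  This is why \<open>L\<close> is stable and \<open>U / L\<close> keeps its weights.\<close>

lemma tensor_act_term:
  assumes b: "b \<in> B" and c: "c \<in> B" and x: "y \<in> Ub n b" and a: "a \<in> E (Suc k)"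
    and ne: "y * T (\<lambda>h. co c (b * h)) a \<noteq> 0"
  shows "y * T (\<lambda>h. co c (b * h)) a \<in> E (n + k - H.deg c)" (is ?t1)
    and "H.deg c < n + k" (is ?t2)
    and "Suc (H.deg c) = n + k \<Longrightarrow> Suc (H.deg b) = n \<and> y * T (\<lambda>h. co c (b * h)) a \<in> isotypic (H.wt c)"
proof -
  let ?t = "T (\<lambda>h. co c (b * h)) a"
  have y: "y \<in> E (n - H.deg b)" using Ub_E[OF b] x by blast
  have t: "?t \<in> E (Suc k - (H.deg c - H.deg b))" using T_co_mult_E[OF b c a] .
  obtain i where i: "n - H.deg b = Suc i" using y ne by (cases "n - H.deg b") auto
  obtain j where j: "Suc k - (H.deg c - H.deg b) = Suc j" using t ne by (cases "Suc k - (H.deg c - H.deg b)") auto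
  have "y * ?t \<in> E (Suc (i + j))" using E_mult y t i j by (metis)
  moreover have le: "Suc (i + j) \<le> n + k - H.deg c" using i j by linarith
  ultimately show ?t1 using E_mono by blast
  show ?t2 using le by simp
  assume top: "Suc (H.deg c) = n + k"
  then have ij: "i = 0" "j = 0" using le by simp_all
  have n: "Suc (H.deg b) = n" using i ij by linarith
  have d: "H.deg c = H.deg b + k" using n top by linarith
  obtain g' where g': "g' \<in> H.grouplikes" "H.wt b * g' = 1" "g' * H.wt b = 1"
    using H.grouplike_inverse[OF wt_grouplike[OF b]] by metis
  have "y \<in> isotypic (H.wt b)" using x n by (simp add: Ub_def)
  from isotypic_mult[OF this T_co_mult_isotypic[OF b c a d g'(2,3)]]
  have "y * ?t \<in> isotypic (H.wt c)" using g'(2) by (simp add: mult.assoc[symmetric])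
  then show "Suc (H.deg b) = n \<and> y * ?t \<in> isotypic (H.wt c)" using n by blast
qed

lemma tensor_act_Ub:
  assumes x: "x \<in> fun_box B (Ub n)" and a: "a \<in> E (Suc k)"
  shows "tensor_act x a \<in> fun_box B (Ub (n + k))"
proof -
  have "(\<Sum>b\<in>B. x b * T (\<lambda>h. co c (b * h)) a) \<in> Ub (n + k) c" if c: "c \<in> B" for c
  proof (rule sum_mem_if_nonzero[OF Ub_subspace])
    fix b assume b: "b \<in> B" and ne: "x b * T (\<lambda>h. co c (b * h)) a \<noteq> 0"
    have "x b \<in> Ub n b" using x b by (simp add: fun_box_mem)
    note t = tensor_act_term[OF b c this a ne]
    then show "x b * T (\<lambda>h. co c (b * h)) a \<in> Ub (n + k) c" by (auto simp: Ub_def)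
  qed
  then show ?thesis by (simp add: fun_box_mem tensor_act_def)
qed

lemma tensor_act_Lb:
  assumes x: "x \<in> fun_box B (Lb n)" and a: "a \<in> E (Suc k)"
  shows "tensor_act x a \<in> fun_box B (Lb (n + k))"
proof -
  have "(\<Sum>b\<in>B. x b * T (\<lambda>h. co c (b * h)) a) \<in> Lb (n + k) c" if c: "c \<in> B" for c
  proof (rule sum_mem_if_nonzero[OF Lb_subspace])
    fix b assume b: "b \<in> B" and ne: "x b * T (\<lambda>h. co c (b * h)) a \<noteq> 0"
    have xb: "x b \<in> Lb n b" using x b by (simp add: fun_box_mem)
    then have "Suc (H.deg b) < n" using ne by (auto simp: Lb_def split: if_splits)
    moreover have "x b \<in> Ub n b" using xb Lb_Ub by blast
    note t = tensor_act_term[OF b c this a ne]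
    ultimately have "Suc (H.deg c) \<noteq> n + k" by auto
    then show "x b * T (\<lambda>h. co c (b * h)) a \<in> Lb (n + k) c" using t(1,2) by (simp add: Lb_def)
  qed
  then show ?thesis by (simp add: fun_box_mem tensor_act_def)
qed

end

section \<open>The final dimension count\<close>

context simple_comodule_algebra
begin

text \<open>The counting theorem for the cotensor product. \<open>Ub n\<close> and
  \<open>Lb n\<close> differ only at b with \<open>Suc (deg b) = n\<close>, so each basis element
  contributes the dimension of one isotypic component, for exactly one n.\<close>

lemma dim_dvd_sum_isotypic: "A.dim UNIV dvd (\<Sum>b\<in>B. A.dim (isotypic (H.wt b)))"
proof -
  obtain m where m: "E m = UNIV" by (rule E_exhaustive)
  define K where "K = Suc m"
  have K: "E K = UNIV" "0 < K" using m E_Suc[of m] by (auto simp: K_def)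
  define D where "D = (\<Sum>b\<in>B. H.deg b)"
  have D: "H.deg b \<le> D" if "b \<in> B" for b
    unfolding D_def using that basis(1) by (intro member_le_sum) auto
  let ?U = "\<lambda>n. fun_box B (Ub n)" and ?L = "\<lambda>n. fun_box B (Lb n)"
  note boxU = A.fun_box[of B "Ub n" for n, OF basis(1) Ub_subspace fin_span]
  note boxL = A.fun_box[of B "Lb n" for n, OF basis(1) Lb_subspace fin_span]
  have supp: "x b = 0" if "x \<in> ?U n" "b \<notin> B" for x n b
    using that by (simp add: fun_box_mem)
  have mono: "E (min (Suc k) K) \<subseteq> E (Suc k)" for k by (intro E_mono) simp
  have dim0: "A.dim {0} = 0" using A.dim_unique[of "{}" "{0}" 0] A.independent_empty by simp
  interpret P: vector_space sP by (rule A.vector_space_fun)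
  \<comment> \<open>The cut-off \<open>K\<close> lets all of A act. From \<open>D + 2\<close> on,
    every b satisfies \<open>Suc (deg b) < n\<close>, so \<open>Ub\<close> and \<open>Lb\<close>
    agree.\<close>
  interpret M: filtered_hopf_module sH comult counit antipode sA coact B sP tensor_op tensor_act ?U ?L K "D + 2"
  proof unfold_locales
    fix n k x a f
    show "?U 0 = {0}" by (auto simp: fun_box_def Ub_def fun_eq_iff)
    show "?L n \<subseteq> ?U n" using Lb_Ub by (auto simp: fun_box_def)
    show "?U n \<subseteq> ?L (Suc n)"
    proof
      fix x assume x: "x \<in> ?U n"
      have "x b \<in> Lb (Suc n) b" if b: "b \<in> B" for b
      proof -
        have xb: "x b \<in> Ub n b" using x b by (simp add: fun_box_mem)
        show ?thesis
        proof (cases "Suc (H.deg b) \<le> n")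
          case True
          have "E (n - H.deg b) \<subseteq> E (Suc n - H.deg b)" by (intro E_mono) simp
          then show ?thesis using True xb Ub_E[OF b] by (auto simp: Lb_def simp del: loewy.simps)
        next
          case False
          then have "x b = 0" using xb by (simp add: Ub_def)
          then show ?thesis using A.subspace_0[OF Lb_subspace] by simp
        qed
      qed
      then show "x \<in> ?L (Suc n)" using x by (simp add: fun_box_mem)
    qed
    show "?U n = ?L n" if "D + 2 \<le> n"
    proof -
      have "Suc (H.deg b) < n" if "b \<in> B" for b using D[OF that] \<open>D + 2 \<le> n\<close> by simp
      then show ?thesis by (auto simp: fun_box_def Ub_def Lb_def simp del: loewy.simps)
    qed
    show "tensor_act x a \<in> ?U (n + k)" if "x \<in> ?U n" "a \<in> E (min (Suc k) K)"
      using tensor_act_Ub[OF that(1)] that(2) mono by blast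
    show "tensor_act x a \<in> ?L (n + k)" if "x \<in> ?L n" "a \<in> E (min (Suc k) K)"
      using tensor_act_Lb[OF that(1)] that(2) mono by blast
    show "tensor_act x 1 = x" if "x \<in> ?U n" using tensor_act_one supp that by blast
    show "tensor_op counit x = x" if "x \<in> ?U n" using tensor_op_counit supp that by blast
    show "P.subspace (?U n)" by (rule boxU(1))
    show "P.subspace (?L n)" by (rule boxL(1))
    show "P.fin_span (?U n)" by (rule boxU(2))
    show "bilinear_map sP sA sP tensor_act" by (rule tensor_act_bilinear)
    show "K = 1 \<or> E K = UNIV" using K by blast
  qed (rule tensor_op_add tensor_op_scale tensor_op_fun_add tensor_op_fun_scale tensor_op_op tensor_act_act tensor_op_act
      tensor_op_Ub tensor_op_Lb tensor_op_rad_Ub tensor_op_rad_Lb K(2); assumption)+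
  define N where "N = D + 2 + K"
  have "A.dim (E K) dvd (\<Sum>n<N. P.dim (?U n) - P.dim (?L n))"
    unfolding N_def by (rule M.dim_dvd) simp
  also have "(\<Sum>n<N. P.dim (?U n) - P.dim (?L n))
      = (\<Sum>n<N. \<Sum>b\<in>B. if n = Suc (H.deg b) then A.dim (isotypic (H.wt b)) else 0)"
  proof (rule sum.cong[OF refl])
    fix n
    have "P.dim (?U n) - P.dim (?L n) = (\<Sum>b\<in>B. A.dim (Ub n b) - A.dim (Lb n b))"
      unfolding boxU(3) boxL(3)
      by (rule sum_subtractf_nat[symmetric]) (intro A.dim_mono_fin_span fin_span Lb_Ub)
    also have "\<dots> = (\<Sum>b\<in>B. if n = Suc (H.deg b) then A.dim (isotypic (H.wt b)) else 0)"
      by (intro sum.cong) (auto simp: Ub_def Lb_def dim0 simp del: loewy.simps)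
    finally show "P.dim (?U n) - P.dim (?L n) = \<dots>" .
  qed
  also have "\<dots> = (\<Sum>b\<in>B. \<Sum>n<N. if n = Suc (H.deg b) then A.dim (isotypic (H.wt b)) else 0)"
    by (rule sum.swap)
  also have "\<dots> = (\<Sum>b\<in>B. A.dim (isotypic (H.wt b)))"
  proof (rule sum.cong[OF refl])
    fix b assume "b \<in> B"
    then have "Suc (H.deg b) < N" using D by (simp add: N_def less_Suc_eq_le trans_le_add1)
    then show "(\<Sum>n<N. if n = Suc (H.deg b) then A.dim (isotypic (H.wt b)) else 0) = A.dim (isotypic (H.wt b))"
      by (subst sum.delta) auto
  qed
  finally show ?thesis using K(1) by simp
qed

text \<open>Each weight occurs r times in \<open>B\<close>, so the sum of the isotypic dimensions is
  r dim soc A. Writing dim A = t dim soc A and cancelling gives that t divides r.\<close>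

theorem dim_quotient_dvd:
  "(A.dim UNIV div A.dim soc) dvd (H.dim UNIV div H.dim H.corad)"
proof -
  obtain r where r: "H.dim UNIV = card H.grouplikes * r"
    "\<And>g. g \<in> H.grouplikes \<Longrightarrow> card {b \<in> B. \<exists>i. H.homog b i g} = r"
    using adapted unfolding H.adapted_def by blast
  have fibre: "card {b \<in> B. H.wt b = g} = r" if g: "g \<in> H.grouplikes" for g
  proof -
    have "{b \<in> B. H.wt b = g} = {b \<in> B. \<exists>i. H.homog b i g}"
      using homog_basis H.deg_wt_eq(2) by blast
    then show ?thesis using r(2)[OF g] by simp
  qed
  have "(\<Sum>b\<in>B. A.dim (isotypic (H.wt b))) = (\<Sum>g\<in>H.grouplikes. \<Sum>b\<in>{b \<in> B. H.wt b = g}. A.dim (isotypic (H.wt b)))"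
    by (rule sum.group[symmetric, OF basis(1) H.finite_grouplikes]) (use wt_grouplike in blast)
  also have "\<dots> = (\<Sum>g\<in>H.grouplikes. r * A.dim (isotypic g))"
    by (intro sum.cong) (simp_all add: fibre)
  also have "\<dots> = r * A.dim (E (Suc 0))" by (simp only: sum_distrib_left[symmetric] dim_E_1)
  finally have dvd: "A.dim UNIV dvd r * A.dim soc" using dim_dvd_sum_isotypic by (simp only: soc_eq)
  obtain t where t: "A.dim UNIV = A.dim soc * t" using dim_soc_dvd unfolding soc_eq by (rule dvdE)
  have "A.dim {0} < A.dim UNIV"
    by (rule A.dim_strict_mono_fin_span[OF A.subspace_single_0 fin_span subset_UNIV A.subspace_UNIV])
      (use right_H_simple in \<open>auto simp: right_H_simple_def\<close>)
  then have "0 < A.dim UNIV" by simp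
  then have soc: "0 < A.dim soc" using t by (cases "A.dim soc") auto
  have "A.dim soc * t dvd A.dim soc * r" using dvd t by (simp add: mult.commute)
  then have "t dvd r" using soc by simp
  moreover have "0 < card H.grouplikes"
    using H.finite_grouplikes H.grouplike_one by (auto simp: card_gt_0_iff)
  ultimately show ?thesis using t r(1) soc by (simp add: H.dim_corad)
qed

end

theorem propositionA1:
  fixes sH :: "'k::field \<Rightarrow> 'h::ring_1 \<Rightarrow> 'h"
    and comult :: "'h \<Rightarrow> ('h \<times> 'h) list"
    and counit :: "'h \<Rightarrow> 'k"
    and antipode :: "'h \<Rightarrow> 'h"
    and sA :: "'k \<Rightarrow> 'a::ring_1 \<Rightarrow> 'a"
    and coact :: "'a \<Rightarrow> ('h \<times> 'a) list"
  assumes "hopf_algebra sH comult counit antipode"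
    and "vector_space.finite_dimensional sH"
    and "coalgebra.pointed sH comult"
    and "left_comodule_algebra sH comult counit sA coact"
    and "vector_space.finite_dimensional sA"
    and "left_comodule_algebra.right_H_simple sH sA coact"
  shows "(vector_space.dim sA UNIV div vector_space.dim sA (left_comodule.soc sH sA coact)) dvd
         (vector_space.dim sH UNIV div vector_space.dim sH (coalgebra.corad sH comult))"
proof -
  interpret H: hopf_algebra sH comult counit antipode by fact
  interpret H: pointed_hopf sH comult counit antipode
    by unfold_locales (fact assms)+
  interpret A: left_comodule_algebra sH comult counit sA coact by fact
  obtain B where "H.adapted B" using H.adapted_basis_exists by blast
  then interpret A: simple_comodule_algebra sH comult counit antipode sA coact B
    by unfold_locales (use assms in auto)
  show ?thesis by (rule A.dim_quotient_dvd)
qed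

end
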